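(* Every $BTC^*$ $\mathcal C$ is a ribbon category, i.e. has a twist: there is a family of unitary arrows $\{\kappa(\rho)\in\mathrm{Hom}(\rho,\rho)\}_{\rho\in\mathcal C}$ such that (1) $T\circ\kappa(\rho)=\kappa(\sigma)\circ T$ for all $T\in\mathrm{Hom}(\rho,\sigma)$; (2) $\kappa(\rho_1\rho_2)=(\kappa(\rho_1)\times\kappa(\rho_2))\circ\varepsilon(\rho_2,\rho_1)\circ\varepsilon(\rho_1,\rho_2)$ for all $\rho_1,\rho_2\in\mathcal C$; (3) $(\kappa(\bar\rho)\times\mathrm{id}_\rho)\circ R=(\mathrm{id}_{\bar\rho}\times\kappa(\rho))\circ R$ for every standard solution $(\rho,\bar\rho,R,\bar R)$ of the conjugate equations.
   Context: Tensor categories are small and strict. Composition of arrows is $\circ$, the tensor product of objects is $\rho\sigma$, that of arrows is $R\times R'$, the unit object is $\iota$. A complex tensor category has complex vector spaces as Hom-sets, with $\circ,\times$ bilinear. A $*$-operation assigns to $X\in\mathrm{Hom}(\rho,\sigma)$ an arrow $X^*\in\mathrm{Hom}(\sigma,\rho)$ and is antilinear, involutive, contravariant and monoidal ($(S\times T)^*=S^*\times T^*$); it is positive if $X^*\circ X=0$ implies $X=0$. A tensor $*$-category is a complex tensor category with positive $*$-operation. $\rho$ is irreducible if $\mathrm{Hom}(\rho,\rho)=\mathbb C\,\mathrm{id}_\rho$. An isometry $V$ satisfies $V^*\circ V=\mathrm{id}$. The category has subobjects if for each projection $E=E^*=E^2\in\mathrm{Hom}(\rho,\rho)$ there are $\sigma$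 and an isometry $V\in\mathrm{Hom}(\sigma,\rho)$ with $V\circ V^*=E$; it has direct sums if for all $\rho_1,\rho_2$ there are $\tau$ and isometries $V_i\in\mathrm{Hom}(\rho_i,\tau)$ with $V_1V_1^*+V_2V_2^*=\mathrm{id}_\tau$. Conjugates: $\bar\rho$ is conjugate to $\rho$ if there are $R\in\mathrm{Hom}(\iota,\bar\rho\rho)$, $\bar R\in\mathrm{Hom}(\iota,\rho\bar\rho)$ satisfying the conjugate equations $(\bar R^*\times\mathrm{id}_\rho)\circ(\mathrm{id}_\rho\times R)=\mathrm{id}_\rho$ and $(R^*\times\mathrm{id}_{\bar\rho})\circ(\mathrm{id}_{\bar\rho}\times\bar R)=\mathrm{id}_{\bar\rho}$. For irreducible $\rho$ one takes $\bar\rho$ irreducible and normalizes so that $R^*\circ R=\bar R^*\circ\bar R$. A solution for reducible $\rho$ is standard if $R=\sum_i(\bar W_i\times W_i)\circ R_i$ (and analogously $\bar R=\sum_i (W_i\times\bar W_i)\circ\bar R_i$), where the isometries $W_i\in\mathrm{Hom}(\rho_i,\rho)$, $\bar W_i\in\mathrm{Hom}(\bar\rho_i,\bar\rho)$ effect decompositions into irreducibles and $(R_i,\bar R_i)$ are normalized solutions for $\rho_i$. A $TC^*$ is a small strict tensor $*$-category with conjugates, direct sums, subobjects, finite dimensional spaces of arrows and irreducible unit object. A $BTC^*$ is a $TC^*$ with a unitary braiding $\varepsilon(\rho,\sigma)\in\mathrm{Hom}(\rho\sigma,\sigma\rho)$ (natural in both variables and satisfying the two hexagon identities). *)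

theory Defs
  imports Complex_Main "Jordan_Normal_Form.VS_Connect"
begin

text \<open>
  Raw data of a strict tensor category with a star operation. Objects are the elements of \<open>Obj\<close>;
  each space of arrows is a complex vector space, given as a module record over the field
  \<open>class_ring\<close> of complex numbers. The ring fields \<open>mult\<close> and \<open>one\<close> of these module records
  carry no meaning.
\<close>

record ('o, 'm) tensor_cat =
  Obj :: "'o set"
  homspace :: "'o \<Rightarrow> 'o \<Rightarrow> (complex, 'm) module"
  idn :: "'o \<Rightarrow> 'm" (\<open>\<i>\<d>\<index>\<close>)
  cmp :: "'m \<Rightarrow> 'm \<Rightarrow> 'm" (infixr \<open>\<cdot>\<index>\<close> 60)
  unit_obj :: 'o (\<open>\<iota>\<index>\<close>)
  tobj :: "'o \<Rightarrow> 'o \<Rightarrow> 'o" (infixr \<open>\<diamondop>\<index>\<close> 75)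
  tarr :: "'m \<Rightarrow> 'm \<Rightarrow> 'm" (infixr \<open>\<boxtimes>\<index>\<close> 70)
  star :: "'m \<Rightarrow> 'm" (\<open>_\<dagger>\<index>\<close> [1000] 999)

abbreviation Hom :: "('o, 'm) tensor_cat \<Rightarrow> 'o \<Rightarrow> 'o \<Rightarrow> 'm set" (\<open>Hom\<index>\<close>)
  where "Hom\<^bsub>C\<^esub> \<rho> \<sigma> \<equiv> carrier (homspace C \<rho> \<sigma>)"

locale complex_tensor_category =
  fixes C :: "('o, 'm) tensor_cat" (structure)
  assumes hom_disjoint:
      "\<lbrakk>\<rho> \<in> Obj C; \<sigma> \<in> Obj C; \<rho>' \<in> Obj C; \<sigma>' \<in> Obj C; Hom \<rho> \<sigma> \<inter> Hom \<rho>' \<sigma>' \<noteq> {}\<rbrakk>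
        \<Longrightarrow> \<rho> = \<rho>' \<and> \<sigma> = \<sigma>'"
    and hom_vectorspace:
      "\<lbrakk>\<rho> \<in> Obj C; \<sigma> \<in> Obj C\<rbrakk> \<Longrightarrow> vectorspace class_ring (homspace C \<rho> \<sigma>)"
    and id_closed: "\<rho> \<in> Obj C \<Longrightarrow> \<i>\<d> \<rho> \<in> Hom \<rho> \<rho>"
    and cmp_closed:
      "\<lbrakk>\<rho> \<in> Obj C; \<sigma> \<in> Obj C; \<tau> \<in> Obj C; S \<in> Hom \<rho> \<sigma>; T \<in> Hom \<sigma> \<tau>\<rbrakk>
        \<Longrightarrow> T \<cdot> S \<in> Hom \<rho> \<tau>"
    and cmp_id_right: "\<lbrakk>\<rho> \<in> Obj C; \<sigma> \<in> Obj C; T \<in> Hom \<rho> \<sigma>\<rbrakk> \<Longrightarrow> T \<cdot> \<i>\<d> \<rho> = T"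
    and cmp_id_left: "\<lbrakk>\<rho> \<in> Obj C; \<sigma> \<in> Obj C; T \<in> Hom \<rho> \<sigma>\<rbrakk> \<Longrightarrow> \<i>\<d> \<sigma> \<cdot> T = T"
    and cmp_assoc:
      "\<lbrakk>\<rho> \<in> Obj C; \<sigma> \<in> Obj C; \<tau> \<in> Obj C; \<omega> \<in> Obj C;
        S \<in> Hom \<rho> \<sigma>; T \<in> Hom \<sigma> \<tau>; U \<in> Hom \<tau> \<omega>\<rbrakk>
        \<Longrightarrow> (U \<cdot> T) \<cdot> S = U \<cdot> (T \<cdot> S)"
    and cmp_linear_right:
      "\<lbrakk>\<rho> \<in> Obj C; \<sigma> \<in> Obj C; \<tau> \<in> Obj C; T \<in> Hom \<sigma> \<tau>\<rbrakk>
        \<Longrightarrow> (\<lambda>S. T \<cdot> S) \<in> LinearCombinations.module_hom class_ring (homspace C \<rho> \<sigma>) (homspace C \<rho> \<tau>)"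
    and cmp_linear_left:
      "\<lbrakk>\<rho> \<in> Obj C; \<sigma> \<in> Obj C; \<tau> \<in> Obj C; S \<in> Hom \<rho> \<sigma>\<rbrakk>
        \<Longrightarrow> (\<lambda>T. T \<cdot> S) \<in> LinearCombinations.module_hom class_ring (homspace C \<sigma> \<tau>) (homspace C \<rho> \<tau>)"
    and unit_closed: "\<iota> \<in> Obj C"
    and tobj_closed: "\<lbrakk>\<rho> \<in> Obj C; \<sigma> \<in> Obj C\<rbrakk> \<Longrightarrow> \<rho> \<diamondop> \<sigma> \<in> Obj C"
    and tobj_assoc:
      "\<lbrakk>\<rho> \<in> Obj C; \<sigma> \<in> Obj C; \<tau> \<in> Obj C\<rbrakk> \<Longrightarrow> (\<rho> \<diamondop> \<sigma>) \<diamondop> \<tau> = \<rho> \<diamondop> (\<sigma> \<diamondop> \<tau>)"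
    and tobj_unit_left: "\<rho> \<in> Obj C \<Longrightarrow> \<iota> \<diamondop> \<rho> = \<rho>"
    and tobj_unit_right: "\<rho> \<in> Obj C \<Longrightarrow> \<rho> \<diamondop> \<iota> = \<rho>"
    and tarr_closed:
      "\<lbrakk>\<rho> \<in> Obj C; \<sigma> \<in> Obj C; \<rho>' \<in> Obj C; \<sigma>' \<in> Obj C; S \<in> Hom \<rho> \<sigma>; S' \<in> Hom \<rho>' \<sigma>'\<rbrakk>
        \<Longrightarrow> S \<boxtimes> S' \<in> Hom (\<rho> \<diamondop> \<rho>') (\<sigma> \<diamondop> \<sigma>')"
    and tarr_assoc:
      "\<lbrakk>\<rho> \<in> Obj C; \<sigma> \<in> Obj C; \<rho>' \<in> Obj C; \<sigma>' \<in> Obj C; \<rho>'' \<in> Obj C; \<sigma>'' \<in> Obj C;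
        S \<in> Hom \<rho> \<sigma>; S' \<in> Hom \<rho>' \<sigma>'; S'' \<in> Hom \<rho>'' \<sigma>''\<rbrakk>
        \<Longrightarrow> (S \<boxtimes> S') \<boxtimes> S'' = S \<boxtimes> (S' \<boxtimes> S'')"
    and tarr_unit_left: "\<lbrakk>\<rho> \<in> Obj C; \<sigma> \<in> Obj C; S \<in> Hom \<rho> \<sigma>\<rbrakk> \<Longrightarrow> \<i>\<d> \<iota> \<boxtimes> S = S"
    and tarr_unit_right: "\<lbrakk>\<rho> \<in> Obj C; \<sigma> \<in> Obj C; S \<in> Hom \<rho> \<sigma>\<rbrakk> \<Longrightarrow> S \<boxtimes> \<i>\<d> \<iota> = S"
    and tarr_id: "\<lbrakk>\<rho> \<in> Obj C; \<sigma> \<in> Obj C\<rbrakk> \<Longrightarrow> \<i>\<d> \<rho> \<boxtimes> \<i>\<d> \<sigma> = \<i>\<d> (\<rho> \<diamondop> \<sigma>)"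
    and interchange:
      "\<lbrakk>\<rho> \<in> Obj C; \<sigma> \<in> Obj C; \<tau> \<in> Obj C; \<rho>' \<in> Obj C; \<sigma>' \<in> Obj C; \<tau>' \<in> Obj C;
        S \<in> Hom \<rho> \<sigma>; T \<in> Hom \<sigma> \<tau>; S' \<in> Hom \<rho>' \<sigma>'; T' \<in> Hom \<sigma>' \<tau>'\<rbrakk>
        \<Longrightarrow> (T \<cdot> S) \<boxtimes> (T' \<cdot> S') = (T \<boxtimes> T') \<cdot> (S \<boxtimes> S')"
    and tarr_linear_right:
      "\<lbrakk>\<rho> \<in> Obj C; \<sigma> \<in> Obj C; \<rho>' \<in> Obj C; \<sigma>' \<in> Obj C; S \<in> Hom \<rho> \<sigma>\<rbrakk>
        \<Longrightarrow> (\<lambda>S'. S \<boxtimes> S') \<in> LinearCombinations.module_hom class_ring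
              (homspace C \<rho>' \<sigma>') (homspace C (\<rho> \<diamondop> \<rho>') (\<sigma> \<diamondop> \<sigma>'))"
    and tarr_linear_left:
      "\<lbrakk>\<rho> \<in> Obj C; \<sigma> \<in> Obj C; \<rho>' \<in> Obj C; \<sigma>' \<in> Obj C; S' \<in> Hom \<rho>' \<sigma>'\<rbrakk>
        \<Longrightarrow> (\<lambda>S. S \<boxtimes> S') \<in> LinearCombinations.module_hom class_ring
              (homspace C \<rho> \<sigma>) (homspace C (\<rho> \<diamondop> \<rho>') (\<sigma> \<diamondop> \<sigma>'))"

locale tensor_star_category = complex_tensor_category +
  assumes star_closed:
      "\<lbrakk>\<rho> \<in> Obj C; \<sigma> \<in> Obj C; X \<in> Hom \<rho> \<sigma>\<rbrakk> \<Longrightarrow> X\<dagger> \<in> Hom \<sigma> \<rho>"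
    and star_add:
      "\<lbrakk>\<rho> \<in> Obj C; \<sigma> \<in> Obj C; X \<in> Hom \<rho> \<sigma>; Y \<in> Hom \<rho> \<sigma>\<rbrakk>
        \<Longrightarrow> (X \<oplus>\<^bsub>homspace C \<rho> \<sigma>\<^esub> Y)\<dagger> = X\<dagger> \<oplus>\<^bsub>homspace C \<sigma> \<rho>\<^esub> Y\<dagger>"
    and star_smult:
      "\<lbrakk>\<rho> \<in> Obj C; \<sigma> \<in> Obj C; X \<in> Hom \<rho> \<sigma>\<rbrakk>
        \<Longrightarrow> (c \<odot>\<^bsub>homspace C \<rho> \<sigma>\<^esub> X)\<dagger> = cnj c \<odot>\<^bsub>homspace C \<sigma> \<rho>\<^esub> X\<dagger>"
    and star_star: "\<lbrakk>\<rho> \<in> Obj C; \<sigma> \<in> Obj C; X \<in> Hom \<rho> \<sigma>\<rbrakk> \<Longrightarrow> (X\<dagger>)\<dagger> = X"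
    and star_cmp:
      "\<lbrakk>\<rho> \<in> Obj C; \<sigma> \<in> Obj C; \<tau> \<in> Obj C; S \<in> Hom \<rho> \<sigma>; T \<in> Hom \<sigma> \<tau>\<rbrakk>
        \<Longrightarrow> (T \<cdot> S)\<dagger> = S\<dagger> \<cdot> T\<dagger>"
    and star_tarr:
      "\<lbrakk>\<rho> \<in> Obj C; \<sigma> \<in> Obj C; \<rho>' \<in> Obj C; \<sigma>' \<in> Obj C; S \<in> Hom \<rho> \<sigma>; T \<in> Hom \<rho>' \<sigma>'\<rbrakk>
        \<Longrightarrow> (S \<boxtimes> T)\<dagger> = S\<dagger> \<boxtimes> T\<dagger>"
    and star_positive:
      "\<lbrakk>\<rho> \<in> Obj C; \<sigma> \<in> Obj C; X \<in> Hom \<rho> \<sigma>; X\<dagger> \<cdot> X = \<zero>\<^bsub>homspace C \<rho> \<rho>\<^esub>\<rbrakk>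
        \<Longrightarrow> X = \<zero>\<^bsub>homspace C \<rho> \<sigma>\<^esub>"

text \<open>The condition is taken literally, so a zero object (where the identity is 0) satisfies it.
  Such summands contribute only zero terms to the decompositions below.\<close>

definition irreducible_obj :: "('o, 'm) tensor_cat \<Rightarrow> 'o \<Rightarrow> bool" where
  "irreducible_obj C \<rho> \<longleftrightarrow>
     \<rho> \<in> Obj C \<and> Hom\<^bsub>C\<^esub> \<rho> \<rho> = {c \<odot>\<^bsub>homspace C \<rho> \<rho>\<^esub> \<i>\<d>\<^bsub>C\<^esub> \<rho> | c. True}"

definition isometry_arrow :: "('o, 'm) tensor_cat \<Rightarrow> 'o \<Rightarrow> 'o \<Rightarrow> 'm \<Rightarrow> bool" where
  "isometry_arrow C \<rho> \<sigma> V \<longleftrightarrow> V \<in> Hom\<^bsub>C\<^esub> \<rho> \<sigma> \<and> V\<dagger>\<^bsub>C\<^esub> \<cdot>\<^bsub>C\<^esub> V = \<i>\<d>\<^bsub>C\<^esub> \<rho>"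

definition unitary_arrow :: "('o, 'm) tensor_cat \<Rightarrow> 'o \<Rightarrow> 'o \<Rightarrow> 'm \<Rightarrow> bool" where
  "unitary_arrow C \<rho> \<sigma> U \<longleftrightarrow> U \<in> Hom\<^bsub>C\<^esub> \<rho> \<sigma> \<and>
     U\<dagger>\<^bsub>C\<^esub> \<cdot>\<^bsub>C\<^esub> U = \<i>\<d>\<^bsub>C\<^esub> \<rho> \<and> U \<cdot>\<^bsub>C\<^esub> U\<dagger>\<^bsub>C\<^esub> = \<i>\<d>\<^bsub>C\<^esub> \<sigma>"

definition projection_arrow :: "('o, 'm) tensor_cat \<Rightarrow> 'o \<Rightarrow> 'm \<Rightarrow> bool" where
  "projection_arrow C \<rho> E \<longleftrightarrow> E \<in> Hom\<^bsub>C\<^esub> \<rho> \<rho> \<and> E\<dagger>\<^bsub>C\<^esub> = E \<and> E \<cdot>\<^bsub>C\<^esub> E = E"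

definition has_subobjects :: "('o, 'm) tensor_cat \<Rightarrow> bool" where
  "has_subobjects C \<longleftrightarrow>
     (\<forall>\<rho>\<in>Obj C. \<forall>E. projection_arrow C \<rho> E \<longrightarrow>
        (\<exists>\<sigma>\<in>Obj C. \<exists>V. isometry_arrow C \<sigma> \<rho> V \<and> V \<cdot>\<^bsub>C\<^esub> V\<dagger>\<^bsub>C\<^esub> = E))"

definition has_direct_sums :: "('o, 'm) tensor_cat \<Rightarrow> bool" where
  "has_direct_sums C \<longleftrightarrow>
     (\<forall>\<rho>\<^sub>1\<in>Obj C. \<forall>\<rho>\<^sub>2\<in>Obj C. \<exists>\<tau>\<in>Obj C. \<exists>V\<^sub>1 V\<^sub>2.
        isometry_arrow C \<rho>\<^sub>1 \<tau> V\<^sub>1 \<and> isometry_arrow C \<rho>\<^sub>2 \<tau> V\<^sub>2 \<and>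
        (V\<^sub>1 \<cdot>\<^bsub>C\<^esub> V\<^sub>1\<dagger>\<^bsub>C\<^esub>) \<oplus>\<^bsub>homspace C \<tau> \<tau>\<^esub> (V\<^sub>2 \<cdot>\<^bsub>C\<^esub> V\<^sub>2\<dagger>\<^bsub>C\<^esub>) = \<i>\<d>\<^bsub>C\<^esub> \<tau>)"

definition conjugate_solution ::
  "('o, 'm) tensor_cat \<Rightarrow> 'o \<Rightarrow> 'o \<Rightarrow> 'm \<Rightarrow> 'm \<Rightarrow> bool" where
  "conjugate_solution C \<rho> \<rho>b R Rb \<longleftrightarrow>
     \<rho> \<in> Obj C \<and> \<rho>b \<in> Obj C \<and>
     R \<in> Hom\<^bsub>C\<^esub> \<iota>\<^bsub>C\<^esub> (\<rho>b \<diamondop>\<^bsub>C\<^esub> \<rho>) \<and> Rb \<in> Hom\<^bsub>C\<^esub> \<iota>\<^bsub>C\<^esub> (\<rho> \<diamondop>\<^bsub>C\<^esub> \<rho>b) \<and>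
     (Rb\<dagger>\<^bsub>C\<^esub> \<boxtimes>\<^bsub>C\<^esub> \<i>\<d>\<^bsub>C\<^esub> \<rho>) \<cdot>\<^bsub>C\<^esub> (\<i>\<d>\<^bsub>C\<^esub> \<rho> \<boxtimes>\<^bsub>C\<^esub> R) = \<i>\<d>\<^bsub>C\<^esub> \<rho> \<and>
     (R\<dagger>\<^bsub>C\<^esub> \<boxtimes>\<^bsub>C\<^esub> \<i>\<d>\<^bsub>C\<^esub> \<rho>b) \<cdot>\<^bsub>C\<^esub> (\<i>\<d>\<^bsub>C\<^esub> \<rho>b \<boxtimes>\<^bsub>C\<^esub> Rb) = \<i>\<d>\<^bsub>C\<^esub> \<rho>b"

definition has_conjugates :: "('o, 'm) tensor_cat \<Rightarrow> bool" where
  "has_conjugates C \<longleftrightarrow> (\<forall>\<rho>\<in>Obj C. \<exists>\<rho>b R Rb. conjugate_solution C \<rho> \<rho>b R Rb)"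

definition normalized_solution ::
  "('o, 'm) tensor_cat \<Rightarrow> 'o \<Rightarrow> 'o \<Rightarrow> 'm \<Rightarrow> 'm \<Rightarrow> bool" where
  "normalized_solution C \<rho> \<rho>b R Rb \<longleftrightarrow>
     irreducible_obj C \<rho> \<and> irreducible_obj C \<rho>b \<and> conjugate_solution C \<rho> \<rho>b R Rb \<and>
     R\<dagger>\<^bsub>C\<^esub> \<cdot>\<^bsub>C\<^esub> R = Rb\<dagger>\<^bsub>C\<^esub> \<cdot>\<^bsub>C\<^esub> Rb"

definition irreducible_decomposition ::
  "('o, 'm) tensor_cat \<Rightarrow> 'o \<Rightarrow> nat \<Rightarrow> (nat \<Rightarrow> 'o) \<Rightarrow> (nat \<Rightarrow> 'm) \<Rightarrow> bool" where
  "irreducible_decomposition C \<rho> n r W \<longleftrightarrow>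
     \<rho> \<in> Obj C \<and> (\<forall>i<n. irreducible_obj C (r i) \<and> isometry_arrow C (r i) \<rho> (W i)) \<and>
     (\<Oplus>\<^bsub>homspace C \<rho> \<rho>\<^esub>i\<in>{..<n}. W i \<cdot>\<^bsub>C\<^esub> (W i)\<dagger>\<^bsub>C\<^esub>) = \<i>\<d>\<^bsub>C\<^esub> \<rho>"

text \<open>For irreducible \<open>\<rho>\<close>, the standard solutions are exactly the normalized ones.\<close>

definition standard_solution ::
  "('o, 'm) tensor_cat \<Rightarrow> 'o \<Rightarrow> 'o \<Rightarrow> 'm \<Rightarrow> 'm \<Rightarrow> bool" where
  "standard_solution C \<rho> \<rho>b R Rb \<longleftrightarrow>
     conjugate_solution C \<rho> \<rho>b R Rb \<and>
     (\<exists>n r rb W Wb S Sb.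
        irreducible_decomposition C \<rho> n r W \<and>
        irreducible_decomposition C \<rho>b n rb Wb \<and>
        (\<forall>i<n. normalized_solution C (r i) (rb i) (S i) (Sb i)) \<and>
        R = (\<Oplus>\<^bsub>homspace C \<iota>\<^bsub>C\<^esub> (\<rho>b \<diamondop>\<^bsub>C\<^esub> \<rho>)\<^esub>i\<in>{..<n}.
               (Wb i \<boxtimes>\<^bsub>C\<^esub> W i) \<cdot>\<^bsub>C\<^esub> S i) \<and>
        Rb = (\<Oplus>\<^bsub>homspace C \<iota>\<^bsub>C\<^esub> (\<rho> \<diamondop>\<^bsub>C\<^esub> \<rho>b)\<^esub>i\<in>{..<n}.
               (W i \<boxtimes>\<^bsub>C\<^esub> Wb i) \<cdot>\<^bsub>C\<^esub> Sb i))"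

locale TC_star = tensor_star_category +
  assumes conjugates: "has_conjugates C"
    and direct_sums: "has_direct_sums C"
    and subobjects: "has_subobjects C"
    and hom_fin_dim:
      "\<lbrakk>\<rho> \<in> Obj C; \<sigma> \<in> Obj C\<rbrakk> \<Longrightarrow> vectorspace.fin_dim class_ring (homspace C \<rho> \<sigma>)"
    and unit_irreducible: "irreducible_obj C \<iota>"

locale BTC_star = TC_star +
  fixes \<epsilon> :: "'a \<Rightarrow> 'a \<Rightarrow> 'b"
  assumes braiding_unitary:
      "\<lbrakk>\<rho> \<in> Obj C; \<sigma> \<in> Obj C\<rbrakk> \<Longrightarrow> unitary_arrow C (\<rho> \<diamondop> \<sigma>) (\<sigma> \<diamondop> \<rho>) (\<epsilon> \<rho> \<sigma>)"
    and braiding_natural: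
      "\<lbrakk>\<rho> \<in> Obj C; \<sigma> \<in> Obj C; \<rho>' \<in> Obj C; \<sigma>' \<in> Obj C; S \<in> Hom \<rho> \<rho>'; T \<in> Hom \<sigma> \<sigma>'\<rbrakk>
        \<Longrightarrow> \<epsilon> \<rho>' \<sigma>' \<cdot> (S \<boxtimes> T) = (T \<boxtimes> S) \<cdot> \<epsilon> \<rho> \<sigma>"
    and hexagon_left:
      "\<lbrakk>\<rho> \<in> Obj C; \<sigma> \<in> Obj C; \<tau> \<in> Obj C\<rbrakk>
        \<Longrightarrow> \<epsilon> (\<rho> \<diamondop> \<sigma>) \<tau> = (\<epsilon> \<rho> \<tau> \<boxtimes> \<i>\<d> \<sigma>) \<cdot> (\<i>\<d> \<rho> \<boxtimes> \<epsilon> \<sigma> \<tau>)"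
    and hexagon_right:
      "\<lbrakk>\<rho> \<in> Obj C; \<sigma> \<in> Obj C; \<tau> \<in> Obj C\<rbrakk>
        \<Longrightarrow> \<epsilon> \<rho> (\<sigma> \<diamondop> \<tau>) = (\<i>\<d> \<sigma> \<boxtimes> \<epsilon> \<rho> \<tau>) \<cdot> (\<epsilon> \<rho> \<sigma> \<boxtimes> \<i>\<d> \<tau>)"

end

theory Submission
  imports Defs "HOL-Computational_Algebra.Fundamental_Theorem_Algebra"
begin

text \<open>
  Let \<open>(R, Rb)\<close> solve the conjugate equations for \<open>\<rho>\<close> and \<open>\<rho>b\<close>. The twist of \<open>\<rho>\<close> is the curl
  \<open>K = (R\<dagger> \<boxtimes> 1) \<cdot> (1 \<boxtimes> \<epsilon> \<rho> \<rho>) \<cdot> (R \<boxtimes> 1)\<close>. Bending the free strand turns this formula into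
  \<open>(K \<boxtimes> 1) \<cdot> Rb = (\<epsilon> \<rho> \<rho>b)\<dagger> \<cdot> R\<close>, an equation that determines \<open>K\<close> and that is much easier to
  calculate with, because both cups can be slid through the braiding.

  For an arbitrary solution \<open>K\<close> depends on the choices and need not be unitary. What is needed is that the
  left and the right closure of an arrow agree, \<open>R\<dagger> \<cdot> (1 \<boxtimes> X) \<cdot> R = Rb\<dagger> \<cdot> (X \<boxtimes> 1) \<cdot> Rb\<close>; such a
  solution is called spherical here. Standard solutions are spherical, since both closures of \<open>X\<close> are sums
  over irreducible summands, on which \<open>X\<close> acts by a scalar and the normalization applies
  (\<open>standard_imp_spherical\<close>). Unlike the definition of standardness, sphericity is visibly inherited by the
  conjugate object (\<open>spherical_swap\<close>) and by tensor products (\<open>spherical_tensor\<close>).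

  The decisive fact is \<open>transpose_spherical\<close>: for spherical solutions, transposing \<open>T\<close> around the
  cups \<open>R\<close>
    and transposing it around the cups \<open>Rb\<close> give the same arrow. The squared norm of the difference of
  the two transposes is \<open>2 (tr (T\<dagger>T) - tr (TT\<dagger>))\<close>, and for \<open>T\<dagger>\<close> it has the opposite sign; by
  positivity both differences vanish. Now the four properties follow.
  Naturality, and with it independence of the choices, is the calculation that moves \<open>T\<close> once around the
  defining equation (\<open>twist_natural\<close>). For unitarity, \<open>\<epsilon> \<rho> \<rho>b \<cdot> Rb = (1 \<boxtimes> L) \<cdot> R\<close> for some \<open>L\<close>; the
  trace pairs \<open>L\<close> and \<open>K\<dagger>\<close> equally with every arrow, so \<open>L = K\<dagger>\<close>, and undoing the braiding gives
  \<open>K \<cdot> K\<dagger> = 1\<close> (\<open>twist_unitary\<close>). Comparing this with the twist \<open>M\<close> of \<open>\<rho>b\<close> gives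
  \<open>(M\<dagger> \<boxtimes> 1) \<cdot> R = (1 \<boxtimes> K\<dagger>) \<cdot> R\<close>, which is the compatibility with conjugates
  (\<open>twist_conjugate\<close>). For a tensor product, the nested cups and the hexagon identities show that the
  right-hand side of the product formula solves the defining equation (\<open>twist_for_tensor\<close>).

  It remains to find a spherical solution for every object. For an irreducible object one rescales an
  arbitrary solution. Otherwise the finite dimensional algebra of endomorphisms contains a spectral projection
  of a self-adjoint arrow; the object splits, the endomorphism algebras of the two parts are smaller,
    and the
  solutions of the parts are added up (\<open>spherical_exists_bounded\<close>).
\<close>

section \<open>Arrows, whiskering and the exchange law\<close>

context complex_tensor_category
begin

text \<open>Distinct spaces of arrows are disjoint, so an arrow determines its source and its target. Reading them
  off the arrow turns every typing condition into an equation that rewriting can discharge.\<close>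

definition arr :: "'m \<Rightarrow> bool" where
  "arr X \<longleftrightarrow> (\<exists>\<rho>\<in>Obj C. \<exists>\<sigma>\<in>Obj C. X \<in> Hom \<rho> \<sigma>)"
definition src :: "'m \<Rightarrow> 'o" where
  "src X = (THE \<rho>. \<rho> \<in> Obj C \<and> (\<exists>\<sigma>\<in>Obj C. X \<in> Hom \<rho> \<sigma>))"
definition tgt :: "'m \<Rightarrow> 'o" where
  "tgt X = (THE \<sigma>. \<sigma> \<in> Obj C \<and> (\<exists>\<rho>\<in>Obj C. X \<in> Hom \<rho> \<sigma>))"

lemma src_tgt_eq:
  assumes "\<rho> \<in> Obj C" "\<sigma> \<in> Obj C" "X \<in> Hom \<rho> \<sigma>"
  shows "src X = \<rho>" "tgt X = \<sigma>"
  unfolding src_def tgt_def using assms hom_disjoint by (intro the_equality; blast)+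

lemma hom_iff:
  assumes "\<rho> \<in> Obj C" "\<sigma> \<in> Obj C"
  shows "X \<in> Hom \<rho> \<sigma> \<longleftrightarrow> arr X \<and> src X = \<rho> \<and> tgt X = \<sigma>"
  using assms src_tgt_eq unfolding arr_def by metis

lemma arr_src [simp]: "arr X \<Longrightarrow> src X \<in> Obj C"
  and arr_tgt [simp]: "arr X \<Longrightarrow> tgt X \<in> Obj C"
  and arr_hom: "arr X \<Longrightarrow> X \<in> Hom (src X) (tgt X)"
  unfolding arr_def by (auto simp: src_tgt_eq)

lemma homD:
  assumes "X \<in> Hom \<rho> \<sigma>" "\<rho> \<in> Obj C" "\<sigma> \<in> Obj C"
  shows "arr X" "src X = \<rho>" "tgt X = \<sigma>"
  using assms hom_iff by auto

declare unit_closed [simp] tobj_closed [simp] tobj_assoc [simp] tobj_unit_left [simp] tobj_unit_right [simp]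

lemma id_arr [simp]:
  assumes "\<rho> \<in> Obj C"
  shows "arr (\<i>\<d> \<rho>)" "src (\<i>\<d> \<rho>) = \<rho>" "tgt (\<i>\<d> \<rho>) = \<rho>"
  using homD[OF id_closed] assms by auto

lemma cmp_arr [simp]:
  assumes "arr S" "arr T" "tgt S = src T"
  shows "arr (T \<cdot> S)" "src (T \<cdot> S) = src S" "tgt (T \<cdot> S) = tgt T"
  using homD[OF cmp_closed[of "src S" "tgt S" "tgt T" S T]] assms arr_hom[of S] arr_hom[of T] by auto

lemma tensor_arr [simp]:
  assumes "arr S" "arr T"
  shows "arr (S \<boxtimes> T)" "src (S \<boxtimes> T) = src S \<diamondop> src T" "tgt (S \<boxtimes> T) = tgt S \<diamondop> tgt T"
  using homD[OF tarr_closed[of "src S" "tgt S" "src T" "tgt T" S T]] assms arr_hom[of S] arr_hom[of T]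
    by auto

lemma cmp_id [simp]:
  assumes "arr T"
  shows "src T = a \<Longrightarrow> T \<cdot> \<i>\<d> a = T" "tgt T = a \<Longrightarrow> \<i>\<d> a \<cdot> T = T"
  using cmp_id_right[OF _ _ arr_hom[of T]] cmp_id_left[OF _ _ arr_hom[of T]] assms by auto

lemma comp_assoc [simp]:
  assumes "arr S" "arr T" "arr U" "tgt S = src T" "tgt T = src U"
  shows "(U \<cdot> T) \<cdot> S = U \<cdot> T \<cdot> S"
  using assms cmp_assoc[of "src S" "tgt S" "tgt T" "tgt U" S T U] arr_hom[of S] arr_hom[of T] arr_hom[of U]
    by simp

lemma comp_tensor:
  assumes "arr S" "arr T" "arr S'" "arr T'" "tgt S = src T" "tgt S' = src T'"
  shows "(T \<boxtimes> T') \<cdot> (S \<boxtimes> S') = (T \<cdot> S) \<boxtimes> (T' \<cdot> S')"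
  using assms interchange[of "src S" "tgt S" "tgt T" "src S'" "tgt S'" "tgt T'" S T S' T']
  arr_hom[of S] arr_hom[of T] arr_hom[of S'] arr_hom[of T'] by simp

lemma tensor_assoc:
  assumes "arr S" "arr T" "arr U"
  shows "(S \<boxtimes> T) \<boxtimes> U = S \<boxtimes> (T \<boxtimes> U)"
  using assms tarr_assoc[of "src S" "tgt S" "src T" "tgt T" "src U" "tgt U" S T U]
  arr_hom[of S] arr_hom[of T] arr_hom[of U] by simp

text \<open>Tensor products with identities suffice: every product of arrows is a composite of two whiskered ones,
  and whiskering is functorial, so that rewriting brings a composite into a normal form. The interchange law
  then survives only as the exchange of two arrows acting on different strands.\<close>

definition left_whisker :: "'o \<Rightarrow> 'm \<Rightarrow> 'm" (infixr \<open>\<triangleleft>\<close> 70) where "a \<triangleleft> X = \<i>\<d> a \<boxtimes> X"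
definition right_whisker :: "'m \<Rightarrow> 'o \<Rightarrow> 'm" (infixl \<open>\<triangleright>\<close> 72) where "X \<triangleright> a = X \<boxtimes> \<i>\<d> a"

lemma left_whisker_arr [simp]:
  assumes "arr X" "a \<in> Obj C"
  shows "arr (a \<triangleleft> X)" "src (a \<triangleleft> X) = a \<diamondop> src X" "tgt (a \<triangleleft> X) = a \<diamondop> tgt X"
  using assms by (auto simp: left_whisker_def)

lemma right_whisker_arr [simp]:
  assumes "arr X" "a \<in> Obj C"
  shows "arr (X \<triangleright> a)" "src (X \<triangleright> a) = src X \<diamondop> a" "tgt (X \<triangleright> a) = tgt X \<diamondop> a"
  using assms by (auto simp: right_whisker_def)

lemma whisker_cmp [simp]:
  assumes "arr S" "arr T" "tgt S = src T" "a \<in> Obj C"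
  shows "a \<triangleleft> (T \<cdot> S) = (a \<triangleleft> T) \<cdot> (a \<triangleleft> S)" "(T \<cdot> S) \<triangleright> a = (T \<triangleright> a) \<cdot> (S \<triangleright> a)"
  using assms by (auto simp: left_whisker_def right_whisker_def comp_tensor)

lemma whisker_whisker [simp]:
  assumes "arr X" "a \<in> Obj C" "b \<in> Obj C"
  shows "a \<triangleleft> b \<triangleleft> X = (a \<diamondop> b) \<triangleleft> X" "X \<triangleright> a \<triangleright> b = X \<triangleright> (a \<diamondop> b)" "(a \<triangleleft> X) \<triangleright> b = a \<triangleleft> (X \<triangleright> b)"
  using assms by (auto simp: left_whisker_def right_whisker_def tensor_assoc tarr_id[symmetric])

lemma whisker_id [simp]:
  assumes "a \<in> Obj C" "b \<in> Obj C"
  shows "a \<triangleleft> \<i>\<d> b = \<i>\<d> (a \<diamondop> b)" "\<i>\<d> a \<triangleright> b = \<i>\<d> (a \<diamondop> b)"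
  using assms by (auto simp: left_whisker_def right_whisker_def tarr_id)

lemma whisker_unit [simp]:
  assumes "arr X"
  shows "\<iota> \<triangleleft> X = X" "X \<triangleright> \<iota> = X"
  using tarr_unit_left[OF _ _ arr_hom[of X]] tarr_unit_right[OF _ _ arr_hom[of X]] assms
  by (auto simp: left_whisker_def right_whisker_def)

lemma tensor_whisker:
  assumes "arr S" "arr T"
  shows "S \<boxtimes> T = (S \<triangleright> tgt T) \<cdot> (src S \<triangleleft> T)"
  using assms by (auto simp: left_whisker_def right_whisker_def comp_tensor)

lemma exchange:
  assumes "arr S" "arr T"
  shows "(S \<triangleright> tgt T) \<cdot> (src S \<triangleleft> T) = (tgt S \<triangleleft> T) \<cdot> (S \<triangleright> src T)"
  using assms by (auto simp: left_whisker_def right_whisker_def comp_tensor)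

text \<open>The form of the exchange law for a cup, which has no strands below it.\<close>

lemma exchange_unit:
  assumes "arr S" "arr T"
  shows "src S = \<iota> \<Longrightarrow> tgt T = a \<Longrightarrow> (S \<triangleright> a) \<cdot> T = (tgt S \<triangleleft> T) \<cdot> (S \<triangleright> src T)"
    "src T = \<iota> \<Longrightarrow> tgt S = a \<Longrightarrow> (a \<triangleleft> T) \<cdot> S = (S \<triangleright> tgt T) \<cdot> (src S \<triangleleft> T)"
  using exchange[OF assms] assms by auto

section \<open>Linear structure\<close>

text \<open>An arrow determines the space of arrows that it belongs to, so the linear operations need no index.\<close>

definition add :: "'m \<Rightarrow> 'm \<Rightarrow> 'm" (infixl \<open>\<boxplus>\<close> 55) where
  "X \<boxplus> Y = X \<oplus>\<^bsub>homspace C (src X) (tgt X)\<^esub> Y"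
definition scale :: "complex \<Rightarrow> 'm \<Rightarrow> 'm" (infixr \<open>\<star>\<close> 58) where
  "c \<star> X = c \<odot>\<^bsub>homspace C (src X) (tgt X)\<^esub> X"
abbreviation zero_arr :: "'o \<Rightarrow> 'o \<Rightarrow> 'm" where
  "zero_arr a b \<equiv> \<zero>\<^bsub>homspace C a b\<^esub>"

lemma hom_add: "\<lbrakk>X \<in> Hom a b; a \<in> Obj C; b \<in> Obj C\<rbrakk> \<Longrightarrow> X \<oplus>\<^bsub>homspace C a b\<^esub> Y = X \<boxplus> Y"
  by (simp add: add_def src_tgt_eq)

lemma hom_scale: "\<lbrakk>X \<in> Hom a b; a \<in> Obj C; b \<in> Obj C\<rbrakk> \<Longrightarrow> c \<odot>\<^bsub>homspace C a b\<^esub> X = c \<star> X"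
  by (simp add: scale_def src_tgt_eq)

lemma zer_arr [simp]:
  assumes "a \<in> Obj C" "b \<in> Obj C"
  shows "arr (zero_arr a b)" "src (zero_arr a b) = a" "tgt (zero_arr a b) = b"
proof -
  interpret V: vectorspace class_ring "homspace C a b" using hom_vectorspace assms .
  have "zero_arr a b \<in> Hom a b" by simp
  from homD[OF this assms] show "arr (zero_arr a b)" "src (zero_arr a b) = a" "tgt (zero_arr a b) = b" .
qed

lemma add_arr [simp]:
  assumes "arr X" "arr Y" "src X = src Y" "tgt X = tgt Y"
  shows "arr (X \<boxplus> Y)" "src (X \<boxplus> Y) = src Y" "tgt (X \<boxplus> Y) = tgt Y"
proof -
  interpret V: vectorspace class_ring "homspace C (src Y) (tgt Y)"
    by (rule hom_vectorspace) (use assms in auto)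
  have "X \<boxplus> Y \<in> Hom (src X) (tgt X)" unfolding add_def
    using assms arr_hom[of X] arr_hom[of Y] by simp
  from homD[OF this] assms show "arr (X \<boxplus> Y)" "src (X \<boxplus> Y) = src Y" "tgt (X \<boxplus> Y) = tgt Y" by auto
qed

lemma scale_arr [simp]:
  assumes "arr X"
  shows "arr (c \<star> X)" "src (c \<star> X) = src X" "tgt (c \<star> X) = tgt X"
proof -
  interpret V: vectorspace class_ring "homspace C (src X) (tgt X)"
    by (rule hom_vectorspace) (use assms in auto)
  have "c \<star> X \<in> Hom (src X) (tgt X)" unfolding scale_def
    using assms arr_hom[of X] by simp
  from homD[OF this] assms show "arr (c \<star> X)" "src (c \<star> X) = src X" "tgt (c \<star> X) = tgt X" by auto
qed

lemma add_ac:
  assumes "arr X" "arr Y" "src X = src Y" "tgt X = tgt Y"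
  shows add_comm: "X \<boxplus> Y = Y \<boxplus> X"
    and add_assoc: "arr Z \<Longrightarrow> src Z = src Y \<Longrightarrow> tgt Z = tgt Y \<Longrightarrow> (X \<boxplus> Y) \<boxplus> Z = X \<boxplus> (Y \<boxplus> Z)"
    and add_left_comm: "arr Z \<Longrightarrow> src Z = src Y \<Longrightarrow> tgt Z = tgt Y \<Longrightarrow> X \<boxplus> (Y \<boxplus> Z) = Y \<boxplus> (X \<boxplus> Z)"
    and add_cancel: "arr Z \<Longrightarrow> src Z = src Y \<Longrightarrow> tgt Z = tgt Y \<Longrightarrow> X \<boxplus> Y = X \<boxplus> Z \<longleftrightarrow> Y = Z"
proof -
  interpret V: vectorspace class_ring "homspace C (src Y) (tgt Y)"
    by (rule hom_vectorspace) (use assms in auto)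
  note h = assms arr_hom[of X] arr_hom[of Y]
  show "X \<boxplus> Y = Y \<boxplus> X" using h by (simp add: add_def V.M.a_comm)
  assume Z: "arr Z" "src Z = src Y" "tgt Z = tgt Y"
  note h = h Z arr_hom[of Z]
  show "(X \<boxplus> Y) \<boxplus> Z = X \<boxplus> (Y \<boxplus> Z)" unfolding add_def[of "X \<boxplus> Y"] add_def[of X "Y \<boxplus> Z"]
    using h by (simp, simp add: add_def V.M.a_assoc)
  show "X \<boxplus> (Y \<boxplus> Z) = Y \<boxplus> (X \<boxplus> Z)"
    using h by (simp add: add_def V.M.a_lcomm)
  show "X \<boxplus> Y = X \<boxplus> Z \<longleftrightarrow> Y = Z"
    using h by (simp add: add_def)
qed

lemma scale_rules [simp]:
  assumes "arr X"
  shows "1 \<star> X = X" "0 \<star> X = zero_arr (src X) (tgt X)"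
    "c \<star> d \<star> X = (c * d) \<star> X"
    "src X = a \<Longrightarrow> tgt X = b \<Longrightarrow> X \<boxplus> zero_arr a b = X" "src X = a \<Longrightarrow> tgt X = b \<Longrightarrow> zero_arr a b \<boxplus> X = X"
proof -
  interpret V: vectorspace class_ring "homspace C (src X) (tgt X)"
    by (rule hom_vectorspace) (use assms in auto)
  note h = assms arr_hom[of X]
  show "1 \<star> X = X" "0 \<star> X = zero_arr (src X) (tgt X)"
    using h V.smult_one[of X] V.lmult_0[of X] by (auto simp: scale_def)
  show "c \<star> d \<star> X = (c * d) \<star> X"
    using h V.smult_assoc1[of c d X] by (simp add: scale_def[of c "d \<star> X"], simp add: scale_def)
  show "src X = a \<Longrightarrow> tgt X = b \<Longrightarrow> X \<boxplus> zero_arr a b = X" "src X = a \<Longrightarrow> tgt X = b \<Longrightarrow> zero_arr a b \<boxplus> X = X"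
    using h by (auto simp: add_def)
qed

lemma scale_add:
  assumes "arr X"
  shows scale_add_left: "(c + d) \<star> X = c \<star> X \<boxplus> d \<star> X"
    and scale_add_right: "arr Y \<Longrightarrow> src X = src Y \<Longrightarrow> tgt X = tgt Y \<Longrightarrow> c \<star> (X \<boxplus> Y) = c \<star> X \<boxplus> c \<star> Y"
proof -
  interpret V: vectorspace class_ring "homspace C (src X) (tgt X)"
    by (rule hom_vectorspace) (use assms in auto)
  note h = assms arr_hom[of X]
  show "(c + d) \<star> X = c \<star> X \<boxplus> d \<star> X" using V.smult_l_distr[of c d X] h
    by (simp add: add_def[of "c \<star> X"], simp add: scale_def)
  assume Y: "arr Y" "src X = src Y" "tgt X = tgt Y"
  then show "c \<star> (X \<boxplus> Y) = c \<star> X \<boxplus> c \<star> Y"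
    using V.smult_r_distr[of c X Y] h arr_hom[of Y]
    by (simp add: scale_def[of c "X \<boxplus> Y"] add_def[of "c \<star> X"], simp add: scale_def add_def)
qed

lemma scale_zero [simp]:
  assumes "a \<in> Obj C" "b \<in> Obj C" shows "c \<star> zero_arr a b = zero_arr a b"
proof -
  interpret V: vectorspace class_ring "homspace C a b" by (rule hom_vectorspace) (use assms in auto)
  show ?thesis using assms by (simp add: scale_def V.rmult_0)
qed

lemma scale_cancel:
  assumes "arr X" "c \<star> X = zero_arr (src X) (tgt X)" "c \<noteq> 0" shows "X = zero_arr (src X) (tgt X)"
proof -
  have "X = (inverse c * c) \<star> X" using assms by simp
  also have "\<dots> = inverse c \<star> (c \<star> X)" using assms(1) by simp
  also have "\<dots> = zero_arr (src X) (tgt X)" unfolding assms(2) using assms(1) by simp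
  finally show ?thesis .
qed

lemma add_zero_cancel:
  assumes "arr X" "arr Y" "src X = src Y" "tgt X = tgt Y" "X \<boxplus> Y = X"
  shows "Y = zero_arr (src Y) (tgt Y)"
  using add_cancel[of X Y "zero_arr (src Y) (tgt Y)"] assms by simp

lemma add_neg [simp]:
  assumes "arr X" shows "X \<boxplus> (-1) \<star> X = zero_arr (src X) (tgt X)" "(-1) \<star> X \<boxplus> X = zero_arr (src X) (tgt X)"
  using scale_add_left[OF assms, of 1 "-1"] scale_add_left[OF assms, of "-1" 1] assms by simp_all

lemma diff_zero_eq:
  assumes "arr X" "arr Y" "src X = src Y" "tgt X = tgt Y" "X \<boxplus> (-1) \<star> Y = zero_arr (src Y) (tgt Y)"
  shows "X = Y"
proof -
  have "(-1) \<star> Y \<boxplus> X = (-1) \<star> Y \<boxplus> Y" using assms add_comm[of X "(-1) \<star> Y"] by simp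
  with assms show ?thesis by (subst (asm) add_cancel) simp_all
qed

text \<open>Linearity of composition and tensor product is given by membership in a set of module
  homomorphisms; this extracts the two equations.\<close>

lemma module_homD:
  assumes "f \<in> LinearCombinations.module_hom class_ring M N" "x \<in> carrier M"
  shows "y \<in> carrier M \<Longrightarrow> f (x \<oplus>\<^bsub>M\<^esub> y) = f x \<oplus>\<^bsub>N\<^esub> f y" "f (c \<odot>\<^bsub>M\<^esub> x) = c \<odot>\<^bsub>N\<^esub> f x"
  using assms by (auto simp: LinearCombinations.module_hom_def)

lemma cmp_add_right [simp]:
  assumes "arr X" "arr T" "tgt X = src T"
  shows "arr Y \<Longrightarrow> src X = src Y \<Longrightarrow> tgt X = tgt Y \<Longrightarrow> T \<cdot> (X \<boxplus> Y) = T \<cdot> X \<boxplus> T \<cdot> Y"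
    and "T \<cdot> (c \<star> X) = c \<star> (T \<cdot> X)"
  using module_homD[OF cmp_linear_right[of "src X" "src T" "tgt T" T], of X]
    arr_hom[of X] arr_hom[of Y] arr_hom[of T] assms by (simp_all add: add_def scale_def)

lemma cmp_add_left [simp]:
  assumes "arr X" "arr T" "src X = tgt T"
  shows "arr Y \<Longrightarrow> src X = src Y \<Longrightarrow> tgt X = tgt Y \<Longrightarrow> (X \<boxplus> Y) \<cdot> T = X \<cdot> T \<boxplus> Y \<cdot> T"
    and "(c \<star> X) \<cdot> T = c \<star> (X \<cdot> T)"
  using module_homD[OF cmp_linear_left[of "src T" "tgt T" "tgt X" T], of X]
    arr_hom[of X] arr_hom[of Y] arr_hom[of T] assms by (simp_all add: add_def scale_def)

lemma tensor_add_right [simp]: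
  assumes "arr X" "arr T"
  shows "arr Y \<Longrightarrow> src X = src Y \<Longrightarrow> tgt X = tgt Y \<Longrightarrow> T \<boxtimes> (X \<boxplus> Y) = T \<boxtimes> X \<boxplus> T \<boxtimes> Y"
    and "T \<boxtimes> (c \<star> X) = c \<star> (T \<boxtimes> X)"
  using module_homD[OF tarr_linear_right[of "src T" "tgt T" "src X" "tgt X" T], of X]
    arr_hom[of X] arr_hom[of Y] arr_hom[of T] assms by (simp_all add: add_def scale_def)

lemma tensor_add_left [simp]:
  assumes "arr X" "arr T"
  shows "arr Y \<Longrightarrow> src X = src Y \<Longrightarrow> tgt X = tgt Y \<Longrightarrow> (X \<boxplus> Y) \<boxtimes> T = X \<boxtimes> T \<boxplus> Y \<boxtimes> T"
    and "(c \<star> X) \<boxtimes> T = c \<star> (X \<boxtimes> T)"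
  using module_homD[OF tarr_linear_left[of "src X" "tgt X" "src T" "tgt T" T], of X]
    arr_hom[of X] arr_hom[of Y] arr_hom[of T] assms by (simp_all add: add_def scale_def)

lemma whisker_linear [simp]:
  assumes "arr X" "a \<in> Obj C"
  shows "arr Y \<Longrightarrow> src X = src Y \<Longrightarrow> tgt X = tgt Y \<Longrightarrow> a \<triangleleft> (X \<boxplus> Y) = a \<triangleleft> X \<boxplus> a \<triangleleft> Y"
    "arr Y \<Longrightarrow> src X = src Y \<Longrightarrow> tgt X = tgt Y \<Longrightarrow> (X \<boxplus> Y) \<triangleright> a = X \<triangleright> a \<boxplus> Y \<triangleright> a"
    and "a \<triangleleft> (c \<star> X) = c \<star> (a \<triangleleft> X)" "(c \<star> X) \<triangleright> a = c \<star> (X \<triangleright> a)"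
  using assms by (simp_all add: left_whisker_def right_whisker_def)

lemma cmp_zero [simp]:
  assumes "arr T" "a \<in> Obj C"
  shows "b = src T \<Longrightarrow> T \<cdot> zero_arr a b = zero_arr a (tgt T)"
    "b = tgt T \<Longrightarrow> zero_arr b a \<cdot> T = zero_arr (src T) a"
  using cmp_add_right(2)[of "zero_arr a b" T 0] cmp_add_left(2)[of "zero_arr b a" T 0] assms by auto

lemma whisker_zero [simp]:
  assumes "a \<in> Obj C" "b \<in> Obj C" "c \<in> Obj C"
  shows "c \<triangleleft> zero_arr a b = zero_arr (c \<diamondop> a) (c \<diamondop> b)" "zero_arr a b \<triangleright> c = zero_arr (a \<diamondop> c) (b \<diamondop> c)"
  using whisker_linear(3,4)[of "zero_arr a b" c 0] assms by auto

lemma scale_eq_zero: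
  assumes "arr X" "X \<noteq> zero_arr (src X) (tgt X)" "c \<star> X = zero_arr (src X) (tgt X)" shows "c = 0"
  using scale_cancel[OF assms(1,3)] assms(2) by blast

lemma scale_inject:
  assumes "arr X" "X \<noteq> zero_arr (src X) (tgt X)" "c \<star> X = d \<star> X" shows "c = d"
proof -
  have "(c - d) \<star> X = c \<star> X \<boxplus> (- d) \<star> X" using scale_add_left[OF assms(1), of c "-d"] by simp
  also have "\<dots> = zero_arr (src X) (tgt X)" unfolding assms(3)
    using scale_add_left[OF assms(1), of d "-d"] assms(1) by simp
  finally show ?thesis using scale_eq_zero[OF assms(1,2), of "c - d"] by simp
qed

text \<open>The two brackets are the expansions of two squared norms that turn out to be opposite, see
  \<open>equal_by_gram\<close> below.\<close>

lemma alternating_sum_zero: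
  assumes "arr x" "arr y" "src x = src y" "tgt x = tgt y"
  shows "(x \<boxplus> (-1) \<star> y \<boxplus> ((-1) \<star> y \<boxplus> x)) \<boxplus> (y \<boxplus> (-1) \<star> x \<boxplus> ((-1) \<star> x \<boxplus> y)) = zero_arr (src y) (tgt y)"
    (is "?l = _")
proof -
  have "?l = ((x \<boxplus> (-1) \<star> x) \<boxplus> (x \<boxplus> (-1) \<star> x)) \<boxplus> ((y \<boxplus> (-1) \<star> y) \<boxplus> (y \<boxplus> (-1) \<star> y))"
    using assms by (simp del: add_neg add: add_ac)
  also have "\<dots> = zero_arr (src y) (tgt y)" using assms by simp
  finally show ?thesis .
qed

end

section \<open>The star operation\<close>

context tensor_star_category
begin

lemma star_arr [simp]:
  assumes "arr X" shows "arr (X\<dagger>)" "src (X\<dagger>) = tgt X" "tgt (X\<dagger>) = src X"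
  using homD[OF star_closed[of "src X" "tgt X" X]] assms arr_hom[of X] by auto

lemma star_simps [simp]:
  assumes "arr X"
  shows "(X\<dagger>)\<dagger> = X" "arr Y \<Longrightarrow> tgt X = src Y \<Longrightarrow> (Y \<cdot> X)\<dagger> = X\<dagger> \<cdot> Y\<dagger>"
    "arr Y \<Longrightarrow> (X \<boxtimes> Y)\<dagger> = X\<dagger> \<boxtimes> Y\<dagger>"
    "arr Y \<Longrightarrow> src X = src Y \<Longrightarrow> tgt X = tgt Y \<Longrightarrow> (X \<boxplus> Y)\<dagger> = X\<dagger> \<boxplus> Y\<dagger>"
    "(c \<star> X)\<dagger> = cnj c \<star> X\<dagger>"
  using assms star_star[of "src X" "tgt X" X] star_cmp[of "src X" "tgt X" "tgt Y" X Y]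
    star_tarr[of "src X" "tgt X" "src Y" "tgt Y" X Y]
    star_add[of "src X" "tgt X" X Y] star_smult[of "src X" "tgt X" X c]
    arr_hom[of X] arr_hom[of Y]
  by (auto simp: add_def scale_def)

lemma star_id [simp]: assumes "a \<in> Obj C" shows "(\<i>\<d> a)\<dagger> = \<i>\<d> a"
proof -
  have "(\<i>\<d> a)\<dagger> = \<i>\<d> a \<cdot> (\<i>\<d> a)\<dagger>" using assms by simp
  also have "\<dots> = (\<i>\<d> a \<cdot> (\<i>\<d> a)\<dagger>)\<dagger>" using assms by (subst star_simps(2)) auto
  also have "\<dots> = \<i>\<d> a" using assms by simp
  finally show ?thesis .
qed

lemma star_zero [simp]: assumes "a \<in> Obj C" "b \<in> Obj C" shows "(zero_arr a b)\<dagger> = zero_arr b a"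
  using star_simps(5)[of "zero_arr a b" 0] assms by simp

lemma star_whisker [simp]:
  assumes "arr X" "a \<in> Obj C" shows "(a \<triangleleft> X)\<dagger> = a \<triangleleft> X\<dagger>" "(X \<triangleright> a)\<dagger> = X\<dagger> \<triangleright> a"
  using assms by (auto simp: left_whisker_def right_whisker_def)

lemma star_pos: "arr X \<Longrightarrow> X\<dagger> \<cdot> X = zero_arr (src X) (src X) \<Longrightarrow> X = zero_arr (src X) (tgt X)"
  by (rule star_positive) (auto intro: arr_hom)

end

section \<open>Finite sums of arrows\<close>

context complex_tensor_category begin

definition hom_sum :: "'o \<Rightarrow> 'o \<Rightarrow> 'i set \<Rightarrow> ('i \<Rightarrow> 'm) \<Rightarrow> 'm" where
  "hom_sum a b I f = (\<Oplus>\<^bsub>homspace C a b\<^esub>i\<in>I. f i)"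

lemma hom_sum_empty [simp]:
  assumes "a \<in> Obj C" "b \<in> Obj C" shows "hom_sum a b {} f = zero_arr a b"
proof -
  interpret V: vectorspace class_ring "homspace C a b" by (rule hom_vectorspace) (use assms in auto)
  show ?thesis by (simp add: hom_sum_def)
qed

lemma hom_sum_insert:
  assumes "a \<in> Obj C" "b \<in> Obj C" "finite I" "k \<notin> I" "\<And>i. i \<in> insert k I \<Longrightarrow> f i \<in> Hom a b"
  shows "hom_sum a b (insert k I) f = f k \<boxplus> hom_sum a b I f"
proof -
  interpret V: vectorspace class_ring "homspace C a b" by (rule hom_vectorspace) (use assms in auto)
  have "hom_sum a b (insert k I) f = f k \<oplus>\<^bsub>homspace C a b\<^esub> hom_sum a b I f"
    unfolding hom_sum_def by (subst V.M.finsum_insert) (use assms in auto)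
  then show ?thesis using assms by (simp add: hom_add)
qed

lemma hom_sum_hom:
  assumes "a \<in> Obj C" "b \<in> Obj C" "\<And>i. i \<in> I \<Longrightarrow> f i \<in> Hom a b"
  shows "hom_sum a b I f \<in> Hom a b"
proof -
  interpret V: vectorspace class_ring "homspace C a b" by (rule hom_vectorspace) (use assms in auto)
  show ?thesis unfolding hom_sum_def by (rule V.M.finsum_closed) (use assms in auto)
qed

lemma hom_sum_arr:
  assumes "a \<in> Obj C" "b \<in> Obj C" "\<And>i. i \<in> I \<Longrightarrow> f i \<in> Hom a b"
  shows "arr (hom_sum a b I f)" "src (hom_sum a b I f) = a" "tgt (hom_sum a b I f) = b"
  using homD[OF hom_sum_hom[of a b I f, OF assms] assms(1,2)] by blast+

lemma hom_sum_cong: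
  assumes "\<And>i. i \<in> I \<Longrightarrow> f i = g i" "\<And>i. i \<in> I \<Longrightarrow> g i \<in> Hom a b" "a \<in> Obj C" "b \<in> Obj C"
  shows "hom_sum a b I f = hom_sum a b I g"
proof -
  interpret V: vectorspace class_ring "homspace C a b" by (rule hom_vectorspace) (use assms in auto)
  show ?thesis unfolding hom_sum_def by (rule V.M.finsum_cong') (use assms in auto)
qed

lemma hom_sum_single:
  assumes "a \<in> Obj C" "b \<in> Obj C" "finite I" "i \<in> I" "X \<in> Hom a b" "f i = X"
    "\<And>j. j \<in> I \<Longrightarrow> j \<noteq> i \<Longrightarrow> f j = zero_arr a b"
  shows "hom_sum a b I f = X"
proof -
  interpret V: vectorspace class_ring "homspace C a b" by (rule hom_vectorspace) (use assms in auto)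
  have "hom_sum a b I f = (\<Oplus>\<^bsub>homspace C a b\<^esub>j\<in>I. if i = j then X else zero_arr a b)"
    unfolding hom_sum_def by (rule V.M.finsum_cong') (use assms in auto)
  also have "\<dots> = X" using V.M.finsum_singleton[of i I "\<lambda>_. X"] assms by auto
  finally show ?thesis .
qed

text \<open>All rules for moving finite sums through composition, whiskering and the star are instances of this one.
  It is stated for additive rather than linear maps because the star is antilinear.\<close>

lemma hom_sum_additive:
  assumes "a \<in> Obj C" "b \<in> Obj C" "a' \<in> Obj C" "b' \<in> Obj C" "finite I" "\<And>i. i \<in> I \<Longrightarrow> f i \<in> Hom a b"
    and add: "\<And>X Y. X \<in> Hom a b \<Longrightarrow> Y \<in> Hom a b \<Longrightarrow> F (X \<boxplus> Y) = F X \<boxplus> F Y"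
    and zero: "F (zero_arr a b) = zero_arr a' b'" and F: "\<And>X. X \<in> Hom a b \<Longrightarrow> F X \<in> Hom a' b'"
  shows "F (hom_sum a b I f) = hom_sum a' b' I (\<lambda>i. F (f i))"
  using assms(5,6)
proof (induction I)
  case empty then show ?case using assms by simp
next
  case (insert k I)
  have "hom_sum a b (insert k I) f = f k \<boxplus> hom_sum a b I f"
    by (rule hom_sum_insert) (use assms insert in auto)
  moreover have "hom_sum a' b' (insert k I) (\<lambda>i. F (f i)) = F (f k) \<boxplus> hom_sum a' b' I (\<lambda>i. F (f i))"
    by (rule hom_sum_insert) (use assms insert in auto)
  moreover have "hom_sum a b I f \<in> Hom a b" by (rule hom_sum_hom) (use assms insert in auto)
  ultimately show ?case using insert by (simp add: add)
qed

lemma hom_sum_linear: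
  assumes "a \<in> Obj C" "b \<in> Obj C" "finite I" "\<And>i. i \<in> I \<Longrightarrow> f i \<in> Hom a b"
  shows "arr T \<Longrightarrow> src T = b \<Longrightarrow> T \<cdot> hom_sum a b I f = hom_sum a (tgt T) I (\<lambda>i. T \<cdot> f i)"
    "arr T \<Longrightarrow> tgt T = a \<Longrightarrow> hom_sum a b I f \<cdot> T = hom_sum (src T) b I (\<lambda>i. f i \<cdot> T)"
    "c \<in> Obj C \<Longrightarrow> hom_sum a b I f \<triangleright> c = hom_sum (a \<diamondop> c) (b \<diamondop> c) I (\<lambda>i. f i \<triangleright> c)"
proof -
  show "T \<cdot> hom_sum a b I f = hom_sum a (tgt T) I (\<lambda>i. T \<cdot> f i)" if "arr T" "src T = b"
    by (rule hom_sum_additive) (use assms that in \<open>auto simp: hom_iff\<close>)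
  show "hom_sum a b I f \<cdot> T = hom_sum (src T) b I (\<lambda>i. f i \<cdot> T)" if "arr T" "tgt T = a"
    by (rule hom_sum_additive[where F="\<lambda>X. X \<cdot> T"]) (use assms that in \<open>auto simp: hom_iff\<close>)
  show "hom_sum a b I f \<triangleright> c = hom_sum (a \<diamondop> c) (b \<diamondop> c) I (\<lambda>i. f i \<triangleright> c)" if "c \<in> Obj C"
    by (rule hom_sum_additive[where F="\<lambda>X. X \<triangleright> c"]) (use assms that in \<open>auto simp: hom_iff\<close>)
qed

lemma hom_sum_zero:
  assumes "a \<in> Obj C" "b \<in> Obj C" "\<And>i. i \<in> I \<Longrightarrow> f i = zero_arr a b"
  shows "hom_sum a b I f = zero_arr a b"
proof -
  interpret V: vectorspace class_ring "homspace C a b" by (rule hom_vectorspace) (use assms in auto)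
  have "hom_sum a b I f = hom_sum a b I (\<lambda>_. zero_arr a b)" by (rule hom_sum_cong) (use assms in auto)
  then show ?thesis unfolding hom_sum_def by simp
qed

end

lemma (in tensor_star_category) hom_sum_star:
  assumes "a \<in> Obj C" "b \<in> Obj C" "finite I" "\<And>i. i \<in> I \<Longrightarrow> f i \<in> Hom a b"
  shows "(hom_sum a b I f)\<dagger> = hom_sum b a I (\<lambda>i. (f i)\<dagger>)"
  by (rule hom_sum_additive) (use assms in \<open>auto simp: hom_iff\<close>)

section \<open>Bending arrows along solutions of the conjugate equations\<close>

context tensor_star_category begin

lemma solutionD:
  assumes "conjugate_solution C \<rho> \<rho>b R Rb"
  shows "\<rho> \<in> Obj C" "\<rho>b \<in> Obj C" "arr R" "src R = \<iota>" "tgt R = \<rho>b \<diamondop> \<rho>"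
    "arr Rb" "src Rb = \<iota>" "tgt Rb = \<rho> \<diamondop> \<rho>b"
    "(Rb\<dagger> \<triangleright> \<rho>) \<cdot> (\<rho> \<triangleleft> R) = \<i>\<d> \<rho>" "(R\<dagger> \<triangleright> \<rho>b) \<cdot> (\<rho>b \<triangleleft> Rb) = \<i>\<d> \<rho>b"
  using assms homD[of R \<iota> "\<rho>b \<diamondop> \<rho>"] homD[of Rb \<iota> "\<rho> \<diamondop> \<rho>b"]
  unfolding conjugate_solution_def left_whisker_def right_whisker_def by auto

lemma solutionI:
  assumes "\<rho> \<in> Obj C" "\<rho>b \<in> Obj C" "arr R" "src R = \<iota>" "tgt R = \<rho>b \<diamondop> \<rho>"
    "arr Rb" "src Rb = \<iota>" "tgt Rb = \<rho> \<diamondop> \<rho>b"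
    "(Rb\<dagger> \<triangleright> \<rho>) \<cdot> (\<rho> \<triangleleft> R) = \<i>\<d> \<rho>" "(R\<dagger> \<triangleright> \<rho>b) \<cdot> (\<rho>b \<triangleleft> Rb) = \<i>\<d> \<rho>b"
  shows "conjugate_solution C \<rho> \<rho>b R Rb"
  using assms unfolding conjugate_solution_def left_whisker_def right_whisker_def by (simp add: hom_iff)

lemma solution_swap: "conjugate_solution C \<rho> \<rho>b R Rb \<Longrightarrow> conjugate_solution C \<rho>b \<rho> Rb R"
  unfolding conjugate_solution_def by auto

lemma solution_star_eqs:
  assumes "conjugate_solution C \<rho> \<rho>b R Rb"
  shows "(\<rho> \<triangleleft> R\<dagger>) \<cdot> (Rb \<triangleright> \<rho>) = \<i>\<d> \<rho>" "(\<rho>b \<triangleleft> Rb\<dagger>) \<cdot> (R \<triangleright> \<rho>b) = \<i>\<d> \<rho>b"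
proof -
  note s [simp] = solutionD[OF assms]
  have "((Rb\<dagger> \<triangleright> \<rho>) \<cdot> (\<rho> \<triangleleft> R))\<dagger> = \<i>\<d> \<rho>" "((R\<dagger> \<triangleright> \<rho>b) \<cdot> (\<rho>b \<triangleleft> Rb))\<dagger> = \<i>\<d> \<rho>b"
    unfolding s(9,10) by simp_all
  then show "(\<rho> \<triangleleft> R\<dagger>) \<cdot> (Rb \<triangleright> \<rho>) = \<i>\<d> \<rho>" "(\<rho>b \<triangleleft> Rb\<dagger>) \<cdot> (R \<triangleright> \<rho>b) = \<i>\<d> \<rho>b"
    by (simp_all del: s(9,10))
qed

text \<open>Frobenius reciprocity: an arrow out of \<open>\<iota>\<close> is a cup with an arrow on its left leg. The
  witness straightens the right leg of \<open>G\<close> with the cap \<open>Rb\<dagger>\<close>.\<close>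

lemma bend_left:
  assumes "conjugate_solution C \<rho> \<rho>b R Rb" and G: "arr G" "src G = \<iota>" "tgt G = \<alpha> \<diamondop> \<rho>" and \<alpha>: "\<alpha> \<in> Obj C"
  defines "X \<equiv> (\<alpha> \<triangleleft> Rb\<dagger>) \<cdot> (G \<triangleright> \<rho>b)"
  shows "arr X" "src X = \<rho>b" "tgt X = \<alpha>" "(X \<triangleright> \<rho>) \<cdot> R = G"
proof -
  note s [simp] = solutionD[OF assms(1)]
  note [simp] = G \<alpha>
  show X: "arr X" "src X = \<rho>b" "tgt X = \<alpha>" by (simp_all add: X_def)
  have "(X \<triangleright> \<rho>) \<cdot> R = (\<alpha> \<triangleleft> Rb\<dagger> \<triangleright> \<rho>) \<cdot> (G \<triangleright> (\<rho>b \<diamondop> \<rho>)) \<cdot> R" by (simp add: X_def)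
  also have "\<dots> = (\<alpha> \<triangleleft> Rb\<dagger> \<triangleright> \<rho>) \<cdot> (\<alpha> \<triangleleft> \<rho> \<triangleleft> R) \<cdot> G" by (subst exchange_unit) simp_all
  also have "\<dots> = (\<alpha> \<triangleleft> ((Rb\<dagger> \<triangleright> \<rho>) \<cdot> (\<rho> \<triangleleft> R))) \<cdot> G" by (simp del: s(9,10))
  also have "\<dots> = G" by (simp del: whisker_cmp)
  finally show "(X \<triangleright> \<rho>) \<cdot> R = G" .
qed

lemma bend_right:
  assumes "conjugate_solution C \<rho> \<rho>b R Rb" and G: "arr G" "src G = \<iota>" "tgt G = \<rho>b \<diamondop> \<alpha>" and \<alpha>: "\<alpha> \<in> Obj C"
  defines "X \<equiv> (Rb\<dagger> \<triangleright> \<alpha>) \<cdot> (\<rho> \<triangleleft> G)"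
  shows "arr X" "src X = \<rho>" "tgt X = \<alpha>" "(\<rho>b \<triangleleft> X) \<cdot> R = G"
proof -
  note s [simp] = solutionD[OF assms(1)]
  note [simp] = G \<alpha>
  show X: "arr X" "src X = \<rho>" "tgt X = \<alpha>" by (simp_all add: X_def)
  have "(\<rho>b \<triangleleft> X) \<cdot> R = (\<rho>b \<triangleleft> Rb\<dagger> \<triangleright> \<alpha>) \<cdot> ((\<rho>b \<diamondop> \<rho>) \<triangleleft> G) \<cdot> R" by (simp add: X_def)
  also have "\<dots> = (\<rho>b \<triangleleft> Rb\<dagger> \<triangleright> \<alpha>) \<cdot> (R \<triangleright> (\<rho>b \<diamondop> \<alpha>)) \<cdot> G" by (subst exchange_unit(2)) simp_all
  also have "\<dots> = (((\<rho>b \<triangleleft> Rb\<dagger>) \<cdot> (R \<triangleright> \<rho>b)) \<triangleright> \<alpha>) \<cdot> G" by simp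
  also have "\<dots> = G" unfolding solution_star_eqs[OF assms(1)] by simp
  finally show "(\<rho>b \<triangleleft> X) \<cdot> R = G" .
qed

text \<open>The arrow on the leg of a cup is recovered by straightening the cup, hence is unique.\<close>

lemma bend_left_unique:
  assumes "conjugate_solution C \<rho> \<rho>b R Rb" and X: "arr X" "src X = \<rho>b"
  shows "X = (tgt X \<triangleleft> Rb\<dagger>) \<cdot> (((X \<triangleright> \<rho>) \<cdot> R) \<triangleright> \<rho>b)"
proof -
  note s [simp] = solutionD[OF assms(1)] solution_star_eqs[OF assms(1)]
  note [simp] = X
  have "(tgt X \<triangleleft> Rb\<dagger>) \<cdot> (((X \<triangleright> \<rho>) \<cdot> R) \<triangleright> \<rho>b) = ((tgt X \<triangleleft> Rb\<dagger>) \<cdot> (X \<triangleright> (\<rho> \<diamondop> \<rho>b))) \<cdot> (R \<triangleright> \<rho>b)"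
    by simp
  also have "(tgt X \<triangleleft> Rb\<dagger>) \<cdot> (X \<triangleright> (\<rho> \<diamondop> \<rho>b)) = X \<cdot> (\<rho>b \<triangleleft> Rb\<dagger>)"
    using exchange[of X "Rb\<dagger>"] by simp
  also have "(X \<cdot> (\<rho>b \<triangleleft> Rb\<dagger>)) \<cdot> (R \<triangleright> \<rho>b) = X" by simp
  finally show ?thesis by simp
qed

lemma left_cancel:
  assumes "conjugate_solution C \<rho> \<rho>b R Rb" "arr X" "src X = \<rho>b" "arr Y" "src Y = \<rho>b" "tgt X = tgt Y"
    "(X \<triangleright> \<rho>) \<cdot> R = (Y \<triangleright> \<rho>) \<cdot> R"
  shows "X = Y"
  using bend_left_unique[OF assms(1-3)] bend_left_unique[OF assms(1,4,5)] assms(6,7) by simp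

lemma right_cancel:
  assumes "conjugate_solution C \<rho> \<rho>b R Rb" "arr X" "src X = \<rho>" "arr Y" "src Y = \<rho>" "tgt X = tgt Y"
    "(\<rho>b \<triangleleft> X) \<cdot> R = (\<rho>b \<triangleleft> Y) \<cdot> R"
  shows "X = Y"
proof -
  note s [simp] = solutionD[OF assms(1)]
  have e: "Z = (Rb\<dagger> \<triangleright> tgt Z) \<cdot> (\<rho> \<triangleleft> ((\<rho>b \<triangleleft> Z) \<cdot> R))" if [simp]: "arr Z" "src Z = \<rho>" for Z
  proof -
    have "(Rb\<dagger> \<triangleright> tgt Z) \<cdot> (\<rho> \<triangleleft> ((\<rho>b \<triangleleft> Z) \<cdot> R)) = ((Rb\<dagger> \<triangleright> tgt Z) \<cdot> ((\<rho> \<diamondop> \<rho>b) \<triangleleft> Z)) \<cdot> (\<rho> \<triangleleft> R)" by simp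
    also have "(Rb\<dagger> \<triangleright> tgt Z) \<cdot> ((\<rho> \<diamondop> \<rho>b) \<triangleleft> Z) = Z \<cdot> (Rb\<dagger> \<triangleright> \<rho>)"
      using exchange[of "Rb\<dagger>" Z] by simp
    also have "(Z \<cdot> (Rb\<dagger> \<triangleright> \<rho>)) \<cdot> (\<rho> \<triangleleft> R) = Z" by simp
    finally show ?thesis by simp
  qed
  show ?thesis using e[of X] e[of Y] assms by simp
qed

text \<open>One arrow \<open>A\<close> serves both equations, because the first one defines it by bending and the second one
  is the same string diagram read from below. The first equation slides \<open>T\<close> around cups, the second one
  around the caps \<open>Rb\<dagger>\<close> and \<open>Sb\<dagger>\<close>.\<close>

lemma transpose_exists:
  assumes "conjugate_solution C \<rho> \<rho>b R Rb" "conjugate_solution C \<sigma> \<sigma>b S Sb"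
    and T: "arr T" "src T = \<rho>" "tgt T = \<sigma>"
  obtains A where "arr A" "src A = \<sigma>b" "tgt A = \<rho>b" "(A \<triangleright> \<sigma>) \<cdot> S = (\<rho>b \<triangleleft> T) \<cdot> R"
    "Rb\<dagger> \<cdot> (\<rho> \<triangleleft> A) = Sb\<dagger> \<cdot> (T \<triangleright> \<sigma>b)"
proof -
  note s = solutionD[OF assms(1)] and t = solutionD[OF assms(2)]
  note [simp] = s t T
  define A where "A = (\<rho>b \<triangleleft> Sb\<dagger>) \<cdot> (((\<rho>b \<triangleleft> T) \<cdot> R) \<triangleright> \<sigma>b)"
  have A: "arr A" "src A = \<sigma>b" "tgt A = \<rho>b" "(A \<triangleright> \<sigma>) \<cdot> S = (\<rho>b \<triangleleft> T) \<cdot> R"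
    unfolding A_def by (rule bend_left[OF assms(2)]; simp)+
  have "Rb\<dagger> \<cdot> (\<rho> \<triangleleft> A) = (Rb\<dagger> \<cdot> ((\<rho> \<diamondop> \<rho>b) \<triangleleft> Sb\<dagger>)) \<cdot> ((\<rho> \<diamondop> \<rho>b) \<triangleleft> T \<triangleright> \<sigma>b) \<cdot> (\<rho> \<triangleleft> R \<triangleright> \<sigma>b)"
    by (simp add: A_def del: s(9,10))
  also have "Rb\<dagger> \<cdot> ((\<rho> \<diamondop> \<rho>b) \<triangleleft> Sb\<dagger>) = Sb\<dagger> \<cdot> (Rb\<dagger> \<triangleright> (\<sigma> \<diamondop> \<sigma>b))"
    using exchange[of "Rb\<dagger>" "Sb\<dagger>"] by simp
  also have "(Sb\<dagger> \<cdot> (Rb\<dagger> \<triangleright> (\<sigma> \<diamondop> \<sigma>b))) \<cdot> ((\<rho> \<diamondop> \<rho>b) \<triangleleft> T \<triangleright> \<sigma>b) \<cdot> (\<rho> \<triangleleft> R \<triangleright> \<sigma>b)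
    = Sb\<dagger> \<cdot> ((Rb\<dagger> \<triangleright> (\<sigma> \<diamondop> \<sigma>b)) \<cdot> ((\<rho> \<diamondop> \<rho>b) \<triangleleft> T \<triangleright> \<sigma>b)) \<cdot> (\<rho> \<triangleleft> R \<triangleright> \<sigma>b)" by simp
  also have "(Rb\<dagger> \<triangleright> (\<sigma> \<diamondop> \<sigma>b)) \<cdot> ((\<rho> \<diamondop> \<rho>b) \<triangleleft> T \<triangleright> \<sigma>b) = (T \<triangleright> \<sigma>b) \<cdot> (Rb\<dagger> \<triangleright> (\<rho> \<diamondop> \<sigma>b))"
    using exchange[of "Rb\<dagger>" "T \<triangleright> \<sigma>b"] by simp
  also have "Sb\<dagger> \<cdot> ((T \<triangleright> \<sigma>b) \<cdot> (Rb\<dagger> \<triangleright> (\<rho> \<diamondop> \<sigma>b))) \<cdot> (\<rho> \<triangleleft> R \<triangleright> \<sigma>b)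
    = Sb\<dagger> \<cdot> (T \<triangleright> \<sigma>b) \<cdot> (((Rb\<dagger> \<triangleright> \<rho>) \<cdot> (\<rho> \<triangleleft> R)) \<triangleright> \<sigma>b)" by (simp del: s(9,10))
  also have "\<dots> = Sb\<dagger> \<cdot> (T \<triangleright> \<sigma>b)" by (simp del: whisker_cmp)
  finally show ?thesis using that A by blast
qed

end

section \<open>Positivity\<close>

context TC_star begin

lemma isometryD:
  assumes "isometry_arrow C a b V" "a \<in> Obj C" "b \<in> Obj C"
  shows "arr V" "src V = a" "tgt V = b" "V\<dagger> \<cdot> V = \<i>\<d> a"
  using assms homD[of V a b] unfolding isometry_arrow_def by auto

text \<open>The completeness relation, composed with \<open>V1\<close>, leaves \<open>V2 \<cdot> V2\<dagger> \<cdot> V1 = 0\<close>.\<close>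

lemma complement_orthogonal:
  assumes V: "arr V1" "src V1 = a" "tgt V1 = t" "arr V2" "src V2 = b" "tgt V2 = t"
    and e: "V1\<dagger> \<cdot> V1 = \<i>\<d> a" "V2\<dagger> \<cdot> V2 = \<i>\<d> b" "V1 \<cdot> V1\<dagger> \<boxplus> V2 \<cdot> V2\<dagger> = \<i>\<d> t"
  shows "V2\<dagger> \<cdot> V1 = zero_arr a b" "V1\<dagger> \<cdot> V2 = zero_arr b a"
proof -
  have o [simp]: "a \<in> Obj C" "b \<in> Obj C" using V arr_src by blast+
  note [simp] = V
  have "(V1 \<cdot> V1\<dagger> \<boxplus> V2 \<cdot> V2\<dagger>) \<cdot> V1 = V1" unfolding e(3) by simp
  moreover have "(V1 \<cdot> V1\<dagger> \<boxplus> V2 \<cdot> V2\<dagger>) \<cdot> V1 = V1 \<boxplus> V2 \<cdot> V2\<dagger> \<cdot> V1" by (simp add: e(1))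
  ultimately have z: "V2 \<cdot> V2\<dagger> \<cdot> V1 = zero_arr a t" using add_zero_cancel[of V1 "V2 \<cdot> V2\<dagger> \<cdot> V1"] by simp
  have "V2\<dagger> \<cdot> V1 = (V2\<dagger> \<cdot> V2) \<cdot> V2\<dagger> \<cdot> V1" unfolding e by simp
  also have "\<dots> = V2\<dagger> \<cdot> V2 \<cdot> V2\<dagger> \<cdot> V1" by simp
  also have "\<dots> = zero_arr a b" unfolding z using V arr_tgt by auto
  finally show *: "V2\<dagger> \<cdot> V1 = zero_arr a b" .
  have "V1\<dagger> \<cdot> V2 = (V2\<dagger> \<cdot> V1)\<dagger>" by simp
  also have "\<dots> = zero_arr b a" unfolding * by simp
  finally show "V1\<dagger> \<cdot> V2 = zero_arr b a" .
qed

lemma direct_sum: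
  assumes "a \<in> Obj C" "b \<in> Obj C"
  obtains t V1 V2 where "t \<in> Obj C" "arr V1" "src V1 = a" "tgt V1 = t" "arr V2" "src V2 = b" "tgt V2 = t"
    "V1\<dagger> \<cdot> V1 = \<i>\<d> a" "V2\<dagger> \<cdot> V2 = \<i>\<d> b" "V1 \<cdot> V1\<dagger> \<boxplus> V2 \<cdot> V2\<dagger> = \<i>\<d> t"
    "V2\<dagger> \<cdot> V1 = zero_arr a b" "V1\<dagger> \<cdot> V2 = zero_arr b a"
proof -
  from direct_sums assms obtain t V1 V2 where t: "t \<in> Obj C"
    and i: "isometry_arrow C a t V1" "isometry_arrow C b t V2"
    and s: "(V1 \<cdot> V1\<dagger>) \<oplus>\<^bsub>homspace C t t\<^esub> (V2 \<cdot> V2\<dagger>) = \<i>\<d> t"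
    unfolding has_direct_sums_def by blast
  note V = isometryD[OF i(1) assms(1) t] isometryD[OF i(2) assms(2) t]
  have "V1 \<cdot> V1\<dagger> \<boxplus> V2 \<cdot> V2\<dagger> = \<i>\<d> t" using s V t by (simp add: add_def)
  with that t V complement_orthogonal[OF V(1-3) V(5-7) V(4,8)] show ?thesis by blast
qed

text \<open>The column with entries \<open>X\<close> and \<open>Y\<close>, an arrow into a direct sum, has the sum of the squares as its
  square. This is how definiteness for one arrow becomes definiteness for sums.\<close>

lemma square_root_of_sum:
  assumes "arr X" "arr Y" "src X = c" "src Y = c"
  obtains Z where "arr Z" "src Z = c" "Z\<dagger> \<cdot> Z = X\<dagger> \<cdot> X \<boxplus> Y\<dagger> \<cdot> Y"
    "Z = zero_arr c (tgt Z) \<Longrightarrow> X = zero_arr c (tgt X) \<and> Y = zero_arr c (tgt Y)"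
proof -
  obtain t V1 V2
    where V [simp]: "t \<in> Obj C" "arr V1" "src V1 = tgt X" "tgt V1 = t" "arr V2" "src V2 = tgt Y"
      "tgt V2 = t"
    and e [simp]: "V1\<dagger> \<cdot> V1 = \<i>\<d> (tgt X)" "V2\<dagger> \<cdot> V2 = \<i>\<d> (tgt Y)"
    "V2\<dagger> \<cdot> V1 = zero_arr (tgt X) (tgt Y)" "V1\<dagger> \<cdot> V2 = zero_arr (tgt Y) (tgt X)"
    using direct_sum[of "tgt X" "tgt Y"] assms arr_tgt by metis
  have c [simp]: "c \<in> Obj C" using assms by auto
  note [simp] = assms
  \<comment> \<open>Rewriting associates to the right, so the isometry relations are needed in this extended form as well.\<close>
  have k: "V1\<dagger> \<cdot> V1 \<cdot> X = X" "V2\<dagger> \<cdot> V2 \<cdot> Y = Y" "V2\<dagger> \<cdot> V1 \<cdot> X = zero_arr c (tgt Y)"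
    "V1\<dagger> \<cdot> V2 \<cdot> Y = zero_arr c (tgt X)"
    using comp_assoc[of X V1 "V1\<dagger>"] comp_assoc[of Y V2 "V2\<dagger>"] comp_assoc[of X V1 "V2\<dagger>"] comp_assoc[of Y V2 "V1\<dagger>"]
    by (simp_all del: comp_assoc)
  define Z where "Z = V1 \<cdot> X \<boxplus> V2 \<cdot> Y"
  have Z: "arr Z" "src Z = c" "tgt Z = t" by (simp_all add: Z_def)
  have *: "V1\<dagger> \<cdot> Z = X" "V2\<dagger> \<cdot> Z = Y" by (simp_all add: Z_def k)
  have "Z\<dagger> \<cdot> Z = X\<dagger> \<cdot> (V1\<dagger> \<cdot> Z) \<boxplus> Y\<dagger> \<cdot> (V2\<dagger> \<cdot> Z)"
    by (subst Z_def) (simp add: Z)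
  then have "Z\<dagger> \<cdot> Z = X\<dagger> \<cdot> X \<boxplus> Y\<dagger> \<cdot> Y" unfolding * .
  moreover have "X = zero_arr c (tgt X) \<and> Y = zero_arr c (tgt Y)" if "Z = zero_arr c (tgt Z)"
    using * that unfolding Z(3) by simp
  ultimately show ?thesis using that[of Z] Z by blast
qed

lemma sum_of_squares_zero:
  assumes "arr X" "arr Y" "src X = c" "src Y = c" "X\<dagger> \<cdot> X \<boxplus> Y\<dagger> \<cdot> Y = zero_arr c c"
  shows "X = zero_arr c (tgt X)"
  using square_root_of_sum[OF assms(1-4)] star_pos assms(5) by metis

text \<open>With the stated inner products, \<open>P - Q\<close> has squared norm \<open>2x - 2y\<close> and \<open>P' - Q'\<close> has
  squared norm \<open>2y - 2x\<close>. The two squares add up to zero, so both differences vanish.\<close>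

lemma equal_by_gram:
  assumes "arr P" "arr Q" "src P = c" "src Q = c" "tgt P = tgt Q"
    and "arr P'" "arr Q'" "src P' = c" "src Q' = c" "tgt P' = tgt Q'"
    and x: "P\<dagger> \<cdot> P = x" "Q\<dagger> \<cdot> Q = x" "P'\<dagger> \<cdot> Q' = x" "Q'\<dagger> \<cdot> P' = x"
    and y: "P\<dagger> \<cdot> Q = y" "Q\<dagger> \<cdot> P = y" "P'\<dagger> \<cdot> P' = y" "Q'\<dagger> \<cdot> Q' = y"
  shows "P = Q"
proof -
  note [simp] = assms(1-10)
  define D D' where "D = P \<boxplus> (-1) \<star> Q" and "D' = P' \<boxplus> (-1) \<star> Q'"
  have a: "arr x" "arr y" "src x = c" "tgt x = c" "src y = c" "tgt y = c"
    unfolding x(1)[symmetric] y(1)[symmetric] by simp_all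
  have "D\<dagger> \<cdot> D = x \<boxplus> (-1) \<star> y \<boxplus> ((-1) \<star> y \<boxplus> x)" "D'\<dagger> \<cdot> D' = y \<boxplus> (-1) \<star> x \<boxplus> ((-1) \<star> x \<boxplus> y)"
    by (simp_all add: D_def D'_def x y scale_add_right a)
  with alternating_sum_zero[of x y] a have "D\<dagger> \<cdot> D \<boxplus> D'\<dagger> \<cdot> D' = zero_arr c c" by simp
  moreover have "arr D" "arr D'" "src D = c" "src D' = c" "tgt D = tgt Q" by (simp_all add: D_def D'_def)
  ultimately have "D = zero_arr c (tgt Q)" using sum_of_squares_zero[of D D' c] by simp
  then show ?thesis using diff_zero_eq[of P Q] by (simp add: D_def)
qed

end

section \<open>Spherical solutions\<close>

context TC_star begin

text \<open>The loop closed on the left equals the loop closed on the right, so that the solution defines one trace on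
  the endomorphisms of \<open>\<rho>\<close>.\<close>

definition spherical :: "'a \<Rightarrow> 'a \<Rightarrow> 'b \<Rightarrow> 'b \<Rightarrow> bool" where
  "spherical \<rho> \<rho>b R Rb \<longleftrightarrow> conjugate_solution C \<rho> \<rho>b R Rb \<and>
     (\<forall>X. arr X \<and> src X = \<rho> \<and> tgt X = \<rho> \<longrightarrow> R\<dagger> \<cdot> (\<rho>b \<triangleleft> X) \<cdot> R = Rb\<dagger> \<cdot> (X \<triangleright> \<rho>b) \<cdot> Rb)"

lemma sphericalD:
  assumes "spherical \<rho> \<rho>b R Rb"
  shows "conjugate_solution C \<rho> \<rho>b R Rb"
    "\<And>X. arr X \<Longrightarrow> src X = \<rho> \<Longrightarrow> tgt X = \<rho> \<Longrightarrow> R\<dagger> \<cdot> (\<rho>b \<triangleleft> X) \<cdot> R = Rb\<dagger> \<cdot> (X \<triangleright> \<rho>b) \<cdot> Rb"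
  using assms unfolding spherical_def by auto

text \<open>The endomorphisms of \<open>\<rho>b\<close> are the transposes of those of \<open>\<rho>\<close>, and a closed loop does not change when
  the arrow on it is slid to the other side.\<close>

lemma spherical_swap:
  assumes "spherical \<rho> \<rho>b R Rb"
  shows "spherical \<rho>b \<rho> Rb R"
  unfolding spherical_def
proof (intro conjI allI impI)
  note c = sphericalD(1)[OF assms]
  note [simp] = solutionD[OF c]
  show c': "conjugate_solution C \<rho>b \<rho> Rb R" using solution_swap[OF c] .
  fix M assume "arr M \<and> src M = \<rho>b \<and> tgt M = \<rho>b"
  then have [simp]: "arr M" "src M = \<rho>b" "tgt M = \<rho>b" by auto
  obtain A where A [simp]: "arr A" "src A = \<rho>" "tgt A = \<rho>" and e: "(A \<triangleright> \<rho>b) \<cdot> Rb = (\<rho> \<triangleleft> M) \<cdot> Rb"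
    "R\<dagger> \<cdot> (\<rho>b \<triangleleft> A) = R\<dagger> \<cdot> (M \<triangleright> \<rho>)" using transpose_exists[OF c' c', of M] by auto
  have "Rb\<dagger> \<cdot> (\<rho> \<triangleleft> M) \<cdot> Rb = Rb\<dagger> \<cdot> (A \<triangleright> \<rho>b) \<cdot> Rb" unfolding e ..
  also have "\<dots> = R\<dagger> \<cdot> (\<rho>b \<triangleleft> A) \<cdot> R" using sphericalD(2)[OF assms, of A] by simp
  also have "\<dots> = (R\<dagger> \<cdot> (\<rho>b \<triangleleft> A)) \<cdot> R" by simp
  also have "\<dots> = R\<dagger> \<cdot> (M \<triangleright> \<rho>) \<cdot> R" unfolding e by simp
  finally show "Rb\<dagger> \<cdot> (\<rho> \<triangleleft> M) \<cdot> Rb = R\<dagger> \<cdot> (M \<triangleright> \<rho>) \<cdot> R" .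
qed

text \<open>Here \<open>A\<close> is the transpose of \<open>T\<close> around \<open>R\<close> and \<open>S\<close>, and \<open>B\<dagger>\<close> is the one around
  \<open>Rb\<close> and \<open>Sb\<close>. Writing \<open>x\<close> for the trace of \<open>T\<dagger> \<cdot> T\<close> and \<open>y\<close> for the trace of \<open>T \<cdot> T\<dagger>\<close>, the inner
  products of the two transposes and those of their adjoints satisfy the hypotheses of
  \<open>equal_by_gram\<close>: mixed products exchange \<open>T\<close> and \<open>T\<dagger>\<close>, whereas the squares of \<open>B\<dagger>\<close> and of
  \<open>A\<dagger>\<close> are brought to the required form by sphericity.\<close>

lemma transpose_spherical:
  assumes "spherical \<rho> \<rho>b R Rb" "spherical \<sigma> \<sigma>b S Sb"
    and T [simp]: "arr T" "src T = \<rho>" "tgt T = \<sigma>"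
  obtains A where "arr A" "src A = \<sigma>b" "tgt A = \<rho>b" "(A \<triangleright> \<sigma>) \<cdot> S = (\<rho>b \<triangleleft> T) \<cdot> R"
    "(\<sigma> \<triangleleft> A) \<cdot> Sb = (T \<triangleright> \<rho>b) \<cdot> Rb"
proof -
  note c = sphericalD(1)[OF assms(1)] and d = sphericalD(1)[OF assms(2)]
  note [simp] = solutionD[OF c] solutionD[OF d]
  obtain A where A [simp]: "arr A" "src A = \<sigma>b" "tgt A = \<rho>b" and e: "(A \<triangleright> \<sigma>) \<cdot> S = (\<rho>b \<triangleleft> T) \<cdot> R"
    "Rb\<dagger> \<cdot> (\<rho> \<triangleleft> A) = Sb\<dagger> \<cdot> (T \<triangleright> \<sigma>b)" using transpose_exists[OF c d T] by auto
  obtain B where B [simp]: "arr B" "src B = \<rho>b" "tgt B = \<sigma>b" and f: "(B \<triangleright> \<rho>) \<cdot> R = (\<sigma>b \<triangleleft> T\<dagger>) \<cdot> S"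
    "Sb\<dagger> \<cdot> (\<sigma> \<triangleleft> B) = Rb\<dagger> \<cdot> (T\<dagger> \<triangleright> \<rho>b)" using transpose_exists[OF d c, of "T\<dagger>"] by auto
  define P Q P' Q' where PQ: "P = (A \<triangleright> \<sigma>) \<cdot> S" "Q = (B\<dagger> \<triangleright> \<sigma>) \<cdot> S" "P' = (B \<triangleright> \<rho>) \<cdot> R" "Q' = (A\<dagger> \<triangleright> \<rho>) \<cdot> R"
  define x y where xy: "x = R\<dagger> \<cdot> (\<rho>b \<triangleleft> T\<dagger>) \<cdot> (\<rho>b \<triangleleft> T) \<cdot> R" "y = S\<dagger> \<cdot> (\<sigma>b \<triangleleft> T) \<cdot> (\<sigma>b \<triangleleft> T\<dagger>) \<cdot> S"
  have a [simp]: "arr P" "arr Q" "arr P'" "arr Q'" by (simp_all add: PQ)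
  have st: "src P = \<iota>" "src Q = \<iota>" "src P' = \<iota>" "src Q' = \<iota>" "tgt P = tgt Q" "tgt P' = tgt Q'"
    by (simp_all add: PQ)
  have xs: "x\<dagger> = x" and ys: "y\<dagger> = y" by (simp_all add: xy)
  have PP: "P\<dagger> \<cdot> P = x" unfolding PQ e by (simp add: xy)
  have PP': "P'\<dagger> \<cdot> P' = y" unfolding PQ f by (simp add: xy)
  have "Q\<dagger> \<cdot> P = S\<dagger> \<cdot> (B \<triangleright> \<sigma>) \<cdot> (\<rho>b \<triangleleft> T) \<cdot> R" unfolding PQ e by simp
  also have "\<dots> = S\<dagger> \<cdot> ((B \<triangleright> \<sigma>) \<cdot> (\<rho>b \<triangleleft> T)) \<cdot> R" by simp
  also have "(B \<triangleright> \<sigma>) \<cdot> (\<rho>b \<triangleleft> T) = (\<sigma>b \<triangleleft> T) \<cdot> (B \<triangleright> \<rho>)" using exchange[of B T] by simp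
  also have "S\<dagger> \<cdot> ((\<sigma>b \<triangleleft> T) \<cdot> (B \<triangleright> \<rho>)) \<cdot> R = S\<dagger> \<cdot> (\<sigma>b \<triangleleft> T) \<cdot> (B \<triangleright> \<rho>) \<cdot> R" by simp
  also have "\<dots> = y" unfolding f xy ..
  finally have QP: "Q\<dagger> \<cdot> P = y" .
  have "(Q\<dagger> \<cdot> P)\<dagger> = P\<dagger> \<cdot> Q" using st by simp
  with QP ys have PQ2: "P\<dagger> \<cdot> Q = y" by simp
  have "Q'\<dagger> \<cdot> P' = R\<dagger> \<cdot> (A \<triangleright> \<rho>) \<cdot> (\<sigma>b \<triangleleft> T\<dagger>) \<cdot> S" unfolding PQ f by simp
  also have "\<dots> = R\<dagger> \<cdot> ((A \<triangleright> \<rho>) \<cdot> (\<sigma>b \<triangleleft> T\<dagger>)) \<cdot> S" by simp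
  also have "(A \<triangleright> \<rho>) \<cdot> (\<sigma>b \<triangleleft> T\<dagger>) = (\<rho>b \<triangleleft> T\<dagger>) \<cdot> (A \<triangleright> \<sigma>)" using exchange[of A "T\<dagger>"] by simp
  also have "R\<dagger> \<cdot> ((\<rho>b \<triangleleft> T\<dagger>) \<cdot> (A \<triangleright> \<sigma>)) \<cdot> S = R\<dagger> \<cdot> (\<rho>b \<triangleleft> T\<dagger>) \<cdot> (A \<triangleright> \<sigma>) \<cdot> S" by simp
  also have "\<dots> = x" unfolding e xy ..
  finally have QP': "Q'\<dagger> \<cdot> P' = x" .
  have "(Q'\<dagger> \<cdot> P')\<dagger> = P'\<dagger> \<cdot> Q'" using st by simp
  with QP' xs have PQ2': "P'\<dagger> \<cdot> Q' = x" by simp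
  have "Q\<dagger> \<cdot> Q = S\<dagger> \<cdot> ((B \<cdot> B\<dagger>) \<triangleright> \<sigma>) \<cdot> S" unfolding PQ by simp
  also have "\<dots> = Sb\<dagger> \<cdot> (\<sigma> \<triangleleft> (B \<cdot> B\<dagger>)) \<cdot> Sb"
    by (rule sphericalD(2)[OF spherical_swap[OF assms(2)], symmetric]) simp_all
  also have "\<dots> = (Sb\<dagger> \<cdot> (\<sigma> \<triangleleft> B)) \<cdot> (Sb\<dagger> \<cdot> (\<sigma> \<triangleleft> B))\<dagger>" by simp
  also have "\<dots> = Rb\<dagger> \<cdot> ((T\<dagger> \<cdot> T) \<triangleright> \<rho>b) \<cdot> Rb" unfolding f by simp
  also have "\<dots> = R\<dagger> \<cdot> (\<rho>b \<triangleleft> (T\<dagger> \<cdot> T)) \<cdot> R"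
    by (rule sphericalD(2)[OF assms(1), symmetric]) simp_all
  also have "\<dots> = x" by (simp add: xy)
  finally have QQ: "Q\<dagger> \<cdot> Q = x" .
  have "Q'\<dagger> \<cdot> Q' = R\<dagger> \<cdot> ((A \<cdot> A\<dagger>) \<triangleright> \<rho>) \<cdot> R" unfolding PQ by simp
  also have "\<dots> = Rb\<dagger> \<cdot> (\<rho> \<triangleleft> (A \<cdot> A\<dagger>)) \<cdot> Rb"
    by (rule sphericalD(2)[OF spherical_swap[OF assms(1)], symmetric]) simp_all
  also have "\<dots> = (Rb\<dagger> \<cdot> (\<rho> \<triangleleft> A)) \<cdot> (Rb\<dagger> \<cdot> (\<rho> \<triangleleft> A))\<dagger>" by simp
  also have "\<dots> = Sb\<dagger> \<cdot> ((T \<cdot> T\<dagger>) \<triangleright> \<sigma>b) \<cdot> Sb" unfolding e by simp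
  also have "\<dots> = S\<dagger> \<cdot> (\<sigma>b \<triangleleft> (T \<cdot> T\<dagger>)) \<cdot> S"
    by (rule sphericalD(2)[OF assms(2), symmetric]) simp_all
  also have "\<dots> = y" by (simp add: xy)
  finally have QQ': "Q'\<dagger> \<cdot> Q' = y" .
  have "P = Q"
    by (rule equal_by_gram[OF a(1,2) st(1,2,5) a(3,4) st(3,4,6) PP QQ PQ2' QP' PQ2 QP PP' QQ'])
  then have "(A \<triangleright> \<sigma>) \<cdot> S = (B\<dagger> \<triangleright> \<sigma>) \<cdot> S" unfolding PQ .
  then have AB: "A = B\<dagger>" using left_cancel[OF d, of A "B\<dagger>"] by simp
  have "(\<sigma> \<triangleleft> A) \<cdot> Sb = (Sb\<dagger> \<cdot> (\<sigma> \<triangleleft> B))\<dagger>" unfolding AB by simp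
  also have "\<dots> = (T \<triangleright> \<rho>b) \<cdot> Rb" unfolding f by simp
  finally show ?thesis using that[OF A e(1)] by blast
qed

text \<open>The cup for a product is one cup nested inside the other. Both snakes are instances of one calculation, in
  which the inner cap of one factor and the inner cup of the other are exchanged.\<close>

lemma solution_tensor:
  assumes "conjugate_solution C \<rho> \<rho>b R Rb" "conjugate_solution C \<sigma> \<sigma>b S Sb"
  shows "conjugate_solution C (\<rho> \<diamondop> \<sigma>) (\<sigma>b \<diamondop> \<rho>b) ((\<sigma>b \<triangleleft> R \<triangleright> \<sigma>) \<cdot> S) ((\<rho> \<triangleleft> Sb \<triangleright> \<rho>b) \<cdot> Rb)"
proof -
  have zigzag: "(((\<rho> \<triangleleft> Sb \<triangleright> \<rho>b) \<cdot> Rb)\<dagger> \<triangleright> (\<rho> \<diamondop> \<sigma>)) \<cdot> ((\<rho> \<diamondop> \<sigma>) \<triangleleft> ((\<sigma>b \<triangleleft> R \<triangleright> \<sigma>) \<cdot> S)) = \<i>\<d> (\<rho> \<diamondop> \<sigma>)"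
    if c: "conjugate_solution C \<rho> \<rho>b R Rb" and d: "conjugate_solution C \<sigma> \<sigma>b S Sb" for \<rho> \<rho>b R Rb \<sigma> \<sigma>b S Sb
  proof -
    note s = solutionD[OF c] and t = solutionD[OF d]
    note [simp] = s t
    have "(((\<rho> \<triangleleft> Sb \<triangleright> \<rho>b) \<cdot> Rb)\<dagger> \<triangleright> (\<rho> \<diamondop> \<sigma>)) \<cdot> ((\<rho> \<diamondop> \<sigma>) \<triangleleft> ((\<sigma>b \<triangleleft> R \<triangleright> \<sigma>) \<cdot> S))
      = (Rb\<dagger> \<triangleright> (\<rho> \<diamondop> \<sigma>)) \<cdot> (\<rho> \<triangleleft> ((Sb\<dagger> \<triangleright> (\<rho>b \<diamondop> \<rho>)) \<cdot> ((\<sigma> \<diamondop> \<sigma>b) \<triangleleft> R)) \<triangleright> \<sigma>) \<cdot> ((\<rho> \<diamondop> \<sigma>) \<triangleleft> S)"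
      by simp
    also have "(Sb\<dagger> \<triangleright> (\<rho>b \<diamondop> \<rho>)) \<cdot> ((\<sigma> \<diamondop> \<sigma>b) \<triangleleft> R) = R \<cdot> Sb\<dagger>" using exchange[of "Sb\<dagger>" R] by simp
    also have "(Rb\<dagger> \<triangleright> (\<rho> \<diamondop> \<sigma>)) \<cdot> (\<rho> \<triangleleft> (R \<cdot> Sb\<dagger>) \<triangleright> \<sigma>) \<cdot> ((\<rho> \<diamondop> \<sigma>) \<triangleleft> S)
      = (((Rb\<dagger> \<triangleright> \<rho>) \<cdot> (\<rho> \<triangleleft> R)) \<triangleright> \<sigma>) \<cdot> (\<rho> \<triangleleft> ((Sb\<dagger> \<triangleright> \<sigma>) \<cdot> (\<sigma> \<triangleleft> S)))" by (simp del: s(9,10) t(9,10))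
    also have "\<dots> = \<i>\<d> (\<rho> \<diamondop> \<sigma>)" by simp
    finally show ?thesis .
  qed
  note [simp] = solutionD[OF assms(1)] solutionD[OF assms(2)]
  show ?thesis
    by (rule solutionI) (simp_all del: star_whisker star_simps whisker_cmp comp_assoc
      add: zigzag[OF assms] zigzag[OF assms(2,1)[THEN solution_swap]])
qed

text \<open>The closure of \<open>X\<close> on the left is first closed over \<open>\<rho>\<close>, giving an endomorphism of \<open>\<sigma>\<close>
  that may be closed on the right instead; the same is then done with the roles of \<open>\<rho>\<close> and \<open>\<sigma>\<close>
  interchanged.\<close>

lemma spherical_tensor:
  assumes "spherical \<rho> \<rho>b R Rb" "spherical \<sigma> \<sigma>b S Sb"
  shows "spherical (\<rho> \<diamondop> \<sigma>) (\<sigma>b \<diamondop> \<rho>b) ((\<sigma>b \<triangleleft> R \<triangleright> \<sigma>) \<cdot> S) ((\<rho> \<triangleleft> Sb \<triangleright> \<rho>b) \<cdot> Rb)"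
  unfolding spherical_def
proof (intro conjI allI impI)
  note c = sphericalD(1)[OF assms(1)] and d = sphericalD(1)[OF assms(2)]
  note [simp] = solutionD[OF c] solutionD[OF d]
  show "conjugate_solution C (\<rho> \<diamondop> \<sigma>) (\<sigma>b \<diamondop> \<rho>b) ((\<sigma>b \<triangleleft> R \<triangleright> \<sigma>) \<cdot> S) ((\<rho> \<triangleleft> Sb \<triangleright> \<rho>b) \<cdot> Rb)"
    using solution_tensor[OF c d] .
  fix X assume "arr X \<and> src X = \<rho> \<diamondop> \<sigma> \<and> tgt X = \<rho> \<diamondop> \<sigma>"
  then have [simp]: "arr X" "src X = \<rho> \<diamondop> \<sigma>" "tgt X = \<rho> \<diamondop> \<sigma>" by auto
  have "((\<sigma>b \<triangleleft> R \<triangleright> \<sigma>) \<cdot> S)\<dagger> \<cdot> ((\<sigma>b \<diamondop> \<rho>b) \<triangleleft> X) \<cdot> (\<sigma>b \<triangleleft> R \<triangleright> \<sigma>) \<cdot> S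
    = S\<dagger> \<cdot> (\<sigma>b \<triangleleft> ((R\<dagger> \<triangleright> \<sigma>) \<cdot> (\<rho>b \<triangleleft> X) \<cdot> (R \<triangleright> \<sigma>))) \<cdot> S" by simp
  also have "\<dots> = Sb\<dagger> \<cdot> (((R\<dagger> \<triangleright> \<sigma>) \<cdot> (\<rho>b \<triangleleft> X) \<cdot> (R \<triangleright> \<sigma>)) \<triangleright> \<sigma>b) \<cdot> Sb"
    by (rule sphericalD(2)[OF assms(2)]) simp_all
  also have "\<dots> = (Sb\<dagger> \<cdot> (R\<dagger> \<triangleright> (\<sigma> \<diamondop> \<sigma>b))) \<cdot> (\<rho>b \<triangleleft> X \<triangleright> \<sigma>b) \<cdot> ((R \<triangleright> (\<sigma> \<diamondop> \<sigma>b)) \<cdot> Sb)" by simp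
  also have "(R \<triangleright> (\<sigma> \<diamondop> \<sigma>b)) \<cdot> Sb = ((\<rho>b \<diamondop> \<rho>) \<triangleleft> Sb) \<cdot> R" using exchange[of R Sb] by simp
  also have "Sb\<dagger> \<cdot> (R\<dagger> \<triangleright> (\<sigma> \<diamondop> \<sigma>b)) = R\<dagger> \<cdot> ((\<rho>b \<diamondop> \<rho>) \<triangleleft> Sb\<dagger>)" using exchange[of "R\<dagger>" "Sb\<dagger>"] by simp
  also have "(R\<dagger> \<cdot> ((\<rho>b \<diamondop> \<rho>) \<triangleleft> Sb\<dagger>)) \<cdot> (\<rho>b \<triangleleft> X \<triangleright> \<sigma>b) \<cdot> ((\<rho>b \<diamondop> \<rho>) \<triangleleft> Sb) \<cdot> R
    = R\<dagger> \<cdot> (\<rho>b \<triangleleft> ((\<rho> \<triangleleft> Sb\<dagger>) \<cdot> (X \<triangleright> \<sigma>b) \<cdot> (\<rho> \<triangleleft> Sb))) \<cdot> R" by simp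
  also have "\<dots> = Rb\<dagger> \<cdot> (((\<rho> \<triangleleft> Sb\<dagger>) \<cdot> (X \<triangleright> \<sigma>b) \<cdot> (\<rho> \<triangleleft> Sb)) \<triangleright> \<rho>b) \<cdot> Rb"
    by (rule sphericalD(2)[OF assms(1)]) simp_all
  also have "\<dots> = ((\<rho> \<triangleleft> Sb \<triangleright> \<rho>b) \<cdot> Rb)\<dagger> \<cdot> (X \<triangleright> (\<sigma>b \<diamondop> \<rho>b)) \<cdot> (\<rho> \<triangleleft> Sb \<triangleright> \<rho>b) \<cdot> Rb" by simp
  finally show "((\<sigma>b \<triangleleft> R \<triangleright> \<sigma>) \<cdot> S)\<dagger> \<cdot> ((\<sigma>b \<diamondop> \<rho>b) \<triangleleft> X) \<cdot> (\<sigma>b \<triangleleft> R \<triangleright> \<sigma>) \<cdot> S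
    = ((\<rho> \<triangleleft> Sb \<triangleright> \<rho>b) \<cdot> Rb)\<dagger> \<cdot> (X \<triangleright> (\<sigma>b \<diamondop> \<rho>b)) \<cdot> (\<rho> \<triangleleft> Sb \<triangleright> \<rho>b) \<cdot> Rb" .
qed

end

section \<open>Sums of spherical solutions\<close>

context TC_star begin

text \<open>Iterating the construction for two arrows: a finite sum of squares vanishes only if every term does.\<close>

lemma square_root_of_hom_sum:
  assumes "finite I" "c \<in> Obj C" "\<And>i. i \<in> I \<Longrightarrow> arr (X i) \<and> src (X i) = c"
  shows "\<exists>Z. arr Z \<and> src Z = c \<and> Z\<dagger> \<cdot> Z = hom_sum c c I (\<lambda>i. (X i)\<dagger> \<cdot> X i) \<and>
    (Z = zero_arr c (tgt Z) \<longrightarrow> (\<forall>i\<in>I. X i = zero_arr c (tgt (X i))))"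
  using assms(1,3)
proof (induction I)
  case empty
  then show ?case using assms(2) by (intro exI[of _ "zero_arr c c"]) simp
next
  case (insert k I)
  then obtain Y where Y: "arr Y" "src Y = c" "Y\<dagger> \<cdot> Y = hom_sum c c I (\<lambda>i. (X i)\<dagger> \<cdot> X i)"
    "Y = zero_arr c (tgt Y) \<longrightarrow> (\<forall>i\<in>I. X i = zero_arr c (tgt (X i)))" by auto
  have "hom_sum c c (insert k I) (\<lambda>i. (X i)\<dagger> \<cdot> X i) = (X k)\<dagger> \<cdot> X k \<boxplus> hom_sum c c I (\<lambda>i. (X i)\<dagger> \<cdot> X i)"
    by (rule hom_sum_insert) (use insert assms(2) in \<open>auto simp: hom_iff\<close>)
  moreover obtain Z where "arr Z" "src Z = c" "Z\<dagger> \<cdot> Z = (X k)\<dagger> \<cdot> X k \<boxplus> Y\<dagger> \<cdot> Y"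
    "Z = zero_arr c (tgt Z) \<Longrightarrow> X k = zero_arr c (tgt (X k)) \<and> Y = zero_arr c (tgt Y)"
    using square_root_of_sum[of "X k" Y c] insert.prems[of k] Y by auto
  ultimately show ?case using Y by (intro exI[of _ Z]) auto
qed

definition complete_family :: "'a \<Rightarrow> 'i set \<Rightarrow> ('i \<Rightarrow> 'a) \<Rightarrow> ('i \<Rightarrow> 'b) \<Rightarrow> bool" where
  "complete_family \<rho> I r W \<longleftrightarrow> \<rho> \<in> Obj C \<and> finite I \<and> (\<forall>i\<in>I. arr (W i) \<and> src (W i) = r i \<and> tgt (W i) = \<rho>) \<and>
    (\<forall>i\<in>I. \<forall>j\<in>I. (W i)\<dagger> \<cdot> W j = (if i = j then \<i>\<d> (r i) else zero_arr (r j) (r i))) \<and>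
    hom_sum \<rho> \<rho> I (\<lambda>i. W i \<cdot> (W i)\<dagger>) = \<i>\<d> \<rho>"

lemma complete_familyD:
  assumes "complete_family \<rho> I r W"
  shows "\<rho> \<in> Obj C" "finite I" "\<And>i. i \<in> I \<Longrightarrow> arr (W i)" "\<And>i. i \<in> I \<Longrightarrow> src (W i) = r i"
    "\<And>i. i \<in> I \<Longrightarrow> tgt (W i) = \<rho>"
    "\<And>i. i \<in> I \<Longrightarrow> r i \<in> Obj C"
    "\<And>i. i \<in> I \<Longrightarrow> (W i)\<dagger> \<cdot> W i = \<i>\<d> (r i)"
      "\<And>i j. i \<in> I \<Longrightarrow> j \<in> I \<Longrightarrow> i \<noteq> j \<Longrightarrow> (W i)\<dagger> \<cdot> W j = zero_arr (r j) (r i)"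
    "hom_sum \<rho> \<rho> I (\<lambda>i. W i \<cdot> (W i)\<dagger>) = \<i>\<d> \<rho>"
proof -
  show W: "\<rho> \<in> Obj C" "finite I" "\<And>i. i \<in> I \<Longrightarrow> arr (W i)" "\<And>i. i \<in> I \<Longrightarrow> src (W i) = r i"
    "\<And>i. i \<in> I \<Longrightarrow> tgt (W i) = \<rho>"
    "\<And>i. i \<in> I \<Longrightarrow> (W i)\<dagger> \<cdot> W i = \<i>\<d> (r i)"
      "\<And>i j. i \<in> I \<Longrightarrow> j \<in> I \<Longrightarrow> i \<noteq> j \<Longrightarrow> (W i)\<dagger> \<cdot> W j = zero_arr (r j) (r i)"
    "hom_sum \<rho> \<rho> I (\<lambda>i. W i \<cdot> (W i)\<dagger>) = \<i>\<d> \<rho>"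
    using assms unfolding complete_family_def by simp_all
  show "r i \<in> Obj C" if "i \<in> I" for i using W(3,4)[OF that] arr_src[of "W i"] by simp
qed

text \<open>Orthogonality is automatic: composing the completeness relation with \<open>W j\<close> on both sides and removing the
  \<open>j\<close>th term leaves a vanishing sum of the squares of \<open>W i\<dagger> \<cdot> W j\<close>.\<close>

lemma complete_family_isometries:
  assumes "\<rho> \<in> Obj C" "finite I" and W: "\<And>i. i \<in> I \<Longrightarrow> arr (W i) \<and> src (W i) = r i \<and> tgt (W i) = \<rho>"
    and i: "\<And>i. i \<in> I \<Longrightarrow> (W i)\<dagger> \<cdot> W i = \<i>\<d> (r i)" and s: "hom_sum \<rho> \<rho> I (\<lambda>i. W i \<cdot> (W i)\<dagger>) = \<i>\<d> \<rho>"
  shows "complete_family \<rho> I r W"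
proof -
  have "(W i)\<dagger> \<cdot> W j = zero_arr (r j) (r i)" if ij: "i \<in> I" "j \<in> I" "i \<noteq> j" for i j
  proof -
    note [simp] = assms(1,2)
    have w [simp]: "arr (W k)" "src (W k) = r k" "tgt (W k) = \<rho>" "r k \<in> Obj C" if "k \<in> I" for k
      using W[OF that] arr_src[of "W k"] by auto
    \<comment> \<open>Separate the term of index \<open>j\<close>, which already accounts for the whole identity.\<close>
    define J where "J = I - {j}"
    have J: "I = insert j J" "finite J" "j \<notin> J" using ij by (auto simp: J_def)
    have 1: "hom_sum \<rho> \<rho> I (\<lambda>i. W i \<cdot> (W i)\<dagger>) = W j \<cdot> (W j)\<dagger> \<boxplus> hom_sum \<rho> \<rho> J (\<lambda>i. W i \<cdot> (W i)\<dagger>)"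
      unfolding J(1) by (rule hom_sum_insert) (use J in \<open>auto simp: hom_iff\<close>)
    have h: "hom_sum \<rho> \<rho> J (\<lambda>i. W i \<cdot> (W i)\<dagger>) \<in> Hom \<rho> \<rho>"
      by (rule hom_sum_hom) (use J in \<open>auto simp: hom_iff\<close>)
    then have h [simp]: "arr (hom_sum \<rho> \<rho> J (\<lambda>i. W i \<cdot> (W i)\<dagger>))"
      "src (hom_sum \<rho> \<rho> J (\<lambda>i. W i \<cdot> (W i)\<dagger>)) = \<rho>" "tgt (hom_sum \<rho> \<rho> J (\<lambda>i. W i \<cdot> (W i)\<dagger>)) = \<rho>"
      by (auto simp: hom_iff)
    have [simp]: "j \<in> I" using ij by simp
    have k: "(W j)\<dagger> \<cdot> W j \<cdot> X = X" if "arr X" "tgt X = r j" for X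
      using that comp_assoc[of X "W j" "(W j)\<dagger>"] i[of j] by (simp del: comp_assoc)
    have "\<i>\<d> (r j) = (W j)\<dagger> \<cdot> \<i>\<d> \<rho> \<cdot> W j" by (simp add: i)
    also have "\<dots> = \<i>\<d> (r j) \<boxplus> (W j)\<dagger> \<cdot> hom_sum \<rho> \<rho> J (\<lambda>i. W i \<cdot> (W i)\<dagger>) \<cdot> W j"
      unfolding s[symmetric] 1 by (simp add: k i)
    finally have "(W j)\<dagger> \<cdot> hom_sum \<rho> \<rho> J (\<lambda>i. W i \<cdot> (W i)\<dagger>) \<cdot> W j = zero_arr (r j) (r j)"
      using add_zero_cancel[of "\<i>\<d> (r j)" "(W j)\<dagger> \<cdot> hom_sum \<rho> \<rho> J (\<lambda>i. W i \<cdot> (W i)\<dagger>) \<cdot> W j"] by simp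
    moreover have "(W j)\<dagger> \<cdot> hom_sum \<rho> \<rho> J (\<lambda>i. W i \<cdot> (W i)\<dagger>) \<cdot> W j
      = hom_sum (r j) (r j) J (\<lambda>i. ((W i)\<dagger> \<cdot> W j)\<dagger> \<cdot> ((W i)\<dagger> \<cdot> W j))"
    proof -
      have "(W j)\<dagger> \<cdot> hom_sum \<rho> \<rho> J (\<lambda>i. W i \<cdot> (W i)\<dagger>) \<cdot> W j
        = (W j)\<dagger> \<cdot> hom_sum (r j) \<rho> J (\<lambda>i. (W i \<cdot> (W i)\<dagger>) \<cdot> W j)"
        using hom_sum_linear(2)[of \<rho> \<rho> J "\<lambda>i. W i \<cdot> (W i)\<dagger>" "W j"] J by (simp add: hom_iff)
      also have "\<dots> = hom_sum (r j) (r j) J (\<lambda>i. (W j)\<dagger> \<cdot> (W i \<cdot> (W i)\<dagger>) \<cdot> W j)"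
        using hom_sum_linear(1)[of "r j" \<rho> J "\<lambda>i. (W i \<cdot> (W i)\<dagger>) \<cdot> W j" "(W j)\<dagger>"] J by (simp add: hom_iff)
      also have "\<dots> = hom_sum (r j) (r j) J (\<lambda>i. ((W i)\<dagger> \<cdot> W j)\<dagger> \<cdot> ((W i)\<dagger> \<cdot> W j))"
        by (rule hom_sum_cong) (use J in \<open>auto simp: hom_iff\<close>)
      finally show ?thesis .
    qed
    ultimately have z: "hom_sum (r j) (r j) J (\<lambda>i. ((W i)\<dagger> \<cdot> W j)\<dagger> \<cdot> ((W i)\<dagger> \<cdot> W j)) = zero_arr (r j) (r j)"
      by simp
    have "\<exists>Z. arr Z \<and> src Z = r j \<and> Z\<dagger> \<cdot> Z = hom_sum (r j) (r j) J (\<lambda>i. ((W i)\<dagger> \<cdot> W j)\<dagger> \<cdot> ((W i)\<dagger> \<cdot> W j)) \<and>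
      (Z = zero_arr (r j) (tgt Z) \<longrightarrow> (\<forall>i\<in>J. (W i)\<dagger> \<cdot> W j = zero_arr (r j) (tgt ((W i)\<dagger> \<cdot> W j))))"
      by (rule square_root_of_hom_sum) (use J in auto)
    then obtain Z where Z: "arr Z" "src Z = r j" "Z\<dagger> \<cdot> Z = zero_arr (r j) (r j)"
      "Z = zero_arr (r j) (tgt Z) \<longrightarrow> (\<forall>i\<in>J. (W i)\<dagger> \<cdot> W j = zero_arr (r j) (tgt ((W i)\<dagger> \<cdot> W j)))" unfolding z
        by blast
    have "Z = zero_arr (r j) (tgt Z)" using star_pos[of Z] Z(1-3) by simp
    with Z(4) ij J(1) have "(W i)\<dagger> \<cdot> W j = zero_arr (r j) (tgt ((W i)\<dagger> \<cdot> W j))" by blast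
    then show ?thesis using ij by simp
  qed
  then show ?thesis using assms unfolding complete_family_def by simp
qed

text \<open>Orthogonality on one leg selects the \<open>j\<close>th summand of the cup. Because of this, no double sums occur in what
  follows.\<close>

lemma cup_component:
  assumes I [simp]: "finite I" and o [simp]: "\<alpha> \<in> Obj C" "\<beta> \<in> Obj C"
    and VW: "\<And>i. i \<in> I \<Longrightarrow> arr (V i) \<and> src (V i) = a i \<and> tgt (V i) = \<alpha> \<and> arr (W i) \<and> src (W i)
      = b i \<and> tgt (W i) = \<beta>"
    and S: "\<And>i. i \<in> I \<Longrightarrow> arr (S i) \<and> src (S i) = \<iota> \<and> tgt (S i) = a i \<diamondop> b i"
    and R: "R = hom_sum \<iota> (\<alpha> \<diamondop> \<beta>) I (\<lambda>i. (V i \<boxtimes> W i) \<cdot> S i)" and j [simp]: "j \<in> I"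
  shows "complete_family \<alpha> I a V \<Longrightarrow> ((V j)\<dagger> \<triangleright> \<beta>) \<cdot> R = (a j \<triangleleft> W j) \<cdot> S j"
    "complete_family \<beta> I b W \<Longrightarrow> (\<alpha> \<triangleleft> (W j)\<dagger>) \<cdot> R = (V j \<triangleright> b j) \<cdot> S j"
proof -
  have [simp]: "arr (V i)" "src (V i) = a i" "tgt (V i) = \<alpha>" "arr (W i)" "src (W i) = b i" "tgt (W i) = \<beta>"
    "arr (S i)" "src (S i) = \<iota>" "tgt (S i) = a i \<diamondop> b i" "a i \<in> Obj C" "b i \<in> Obj C" if "i \<in> I" for i
    using VW[OF that] S[OF that] arr_src[of "V i"] arr_src[of "W i"] by auto
  have m: "(V i \<boxtimes> W i) \<cdot> S i \<in> Hom \<iota> (\<alpha> \<diamondop> \<beta>)" if "i \<in> I" for i using that by (simp add: hom_iff)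
  {
    assume v: "complete_family \<alpha> I a V"
    have e: "((V j)\<dagger> \<triangleright> \<beta>) \<cdot> (V i \<boxtimes> W i) \<cdot> S i = (((V j)\<dagger> \<cdot> V i) \<triangleright> \<beta>) \<cdot> (a i \<triangleleft> W i) \<cdot> S i" if "i \<in> I" for i
      using that by (simp add: tensor_whisker)
    have "((V j)\<dagger> \<triangleright> \<beta>) \<cdot> R = hom_sum \<iota> (a j \<diamondop> \<beta>) I (\<lambda>i. ((V j)\<dagger> \<triangleright> \<beta>) \<cdot> (V i \<boxtimes> W i) \<cdot> S i)"
      unfolding R by (subst hom_sum_linear(1)) (use m in auto)
    also have "\<dots> = (a j \<triangleleft> W j) \<cdot> S j"
      by (rule hom_sum_single[OF _ _ I j]) (simp_all add: e complete_familyD[OF v] hom_iff del: whisker_cmp)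
    finally show "((V j)\<dagger> \<triangleright> \<beta>) \<cdot> R = (a j \<triangleleft> W j) \<cdot> S j" .
  }
  {
    assume v: "complete_family \<beta> I b W"
    have e: "(\<alpha> \<triangleleft> (W j)\<dagger>) \<cdot> (V i \<boxtimes> W i) \<cdot> S i = (\<alpha> \<triangleleft> ((W j)\<dagger> \<cdot> W i)) \<cdot> (V i \<triangleright> b i) \<cdot> S i" if "i \<in> I" for i
      using that exchange[of "V i" "W i"] by (simp add: tensor_whisker)
    have "(\<alpha> \<triangleleft> (W j)\<dagger>) \<cdot> R = hom_sum \<iota> (\<alpha> \<diamondop> b j) I (\<lambda>i. (\<alpha> \<triangleleft> (W j)\<dagger>) \<cdot> (V i \<boxtimes> W i) \<cdot> S i)"
      unfolding R by (subst hom_sum_linear(1)) (use m in auto)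
    also have "\<dots> = (V j \<triangleright> b j) \<cdot> S j"
      by (rule hom_sum_single[OF _ _ I j]) (simp_all add: e complete_familyD[OF v] hom_iff del: whisker_cmp)
    finally show "(\<alpha> \<triangleleft> (W j)\<dagger>) \<cdot> R = (V j \<triangleright> b j) \<cdot> S j" .
  }
qed

text \<open>A cap that is a sum acts term by term; the projections \<open>W i\<dagger>\<close> are placed first, ready for
  \<open>cup_component\<close>.\<close>

lemma summed_cup_star:
  assumes I [simp]: "finite I" and o [simp]: "\<alpha> \<in> Obj C" "\<beta> \<in> Obj C"
    and VW: "\<And>i. i \<in> I \<Longrightarrow> arr (V i) \<and> src (V i) = a i \<and> tgt (V i) = \<alpha> \<and> arr (W i) \<and> src (W i)
      = b i \<and> tgt (W i) = \<beta>"
    and S: "\<And>i. i \<in> I \<Longrightarrow> arr (S i) \<and> src (S i) = \<iota> \<and> tgt (S i) = a i \<diamondop> b i"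
    and R: "R = hom_sum \<iota> (\<alpha> \<diamondop> \<beta>) I (\<lambda>i. (V i \<boxtimes> W i) \<cdot> S i)"
    and Z: "arr Z"
  shows "tgt Z = \<alpha> \<diamondop> \<beta> \<Longrightarrow> R\<dagger> \<cdot> Z = hom_sum (src Z) \<iota> I (\<lambda>i. (S i)\<dagger> \<cdot> ((V i)\<dagger> \<triangleright> b i) \<cdot> (\<alpha> \<triangleleft> (W i)\<dagger>) \<cdot> Z)"
    "c \<in> Obj C \<Longrightarrow> tgt Z = \<alpha> \<diamondop> \<beta> \<diamondop> c \<Longrightarrow>
      (R\<dagger> \<triangleright> c) \<cdot> Z = hom_sum (src Z) c I (\<lambda>i. ((S i)\<dagger> \<triangleright> c) \<cdot> ((V i)\<dagger> \<triangleright> (b i \<diamondop> c)) \<cdot> (\<alpha> \<triangleleft> (W i)\<dagger> \<triangleright> c) \<cdot> Z)"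
proof -
  have [simp]: "arr (V i)" "src (V i) = a i" "tgt (V i) = \<alpha>" "arr (W i)" "src (W i) = b i" "tgt (W i) = \<beta>"
    "arr (S i)" "src (S i) = \<iota>" "tgt (S i) = a i \<diamondop> b i" "a i \<in> Obj C" "b i \<in> Obj C" if "i \<in> I" for i
    using VW[OF that] S[OF that] arr_src[of "V i"] arr_src[of "W i"] by auto
  let ?f = "\<lambda>i. (S i)\<dagger> \<cdot> ((V i)\<dagger> \<triangleright> b i) \<cdot> (\<alpha> \<triangleleft> (W i)\<dagger>)"
  have f: "?f i \<in> Hom (\<alpha> \<diamondop> \<beta>) \<iota>" if "i \<in> I" for i using that by (simp add: hom_iff)
  have "R\<dagger> = hom_sum (\<alpha> \<diamondop> \<beta>) \<iota> I (\<lambda>i. ((V i \<boxtimes> W i) \<cdot> S i)\<dagger>)"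
    unfolding R by (rule hom_sum_star) (simp_all add: hom_iff)
  also have "\<dots> = hom_sum (\<alpha> \<diamondop> \<beta>) \<iota> I ?f"
  proof (rule hom_sum_cong)
    fix i assume [simp]: "i \<in> I"
    show "((V i \<boxtimes> W i) \<cdot> S i)\<dagger> = ?f i" using exchange[of "(V i)\<dagger>" "(W i)\<dagger>"] by (simp add: tensor_whisker)
  qed (use f in simp_all)
  finally have R: "R\<dagger> = hom_sum (\<alpha> \<diamondop> \<beta>) \<iota> I ?f" .
  show "R\<dagger> \<cdot> Z = hom_sum (src Z) \<iota> I (\<lambda>i. (S i)\<dagger> \<cdot> ((V i)\<dagger> \<triangleright> b i) \<cdot> (\<alpha> \<triangleleft> (W i)\<dagger>) \<cdot> Z)" if "tgt Z = \<alpha> \<diamondop> \<beta>"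
  proof -
    have "R\<dagger> \<cdot> Z = hom_sum (src Z) \<iota> I (\<lambda>i. ?f i \<cdot> Z)" unfolding R
      by (rule hom_sum_linear(2)) (use f that Z in simp_all)
    also have "\<dots> = hom_sum (src Z) \<iota> I (\<lambda>i. (S i)\<dagger> \<cdot> ((V i)\<dagger> \<triangleright> b i) \<cdot> (\<alpha> \<triangleleft> (W i)\<dagger>) \<cdot> Z)"
      by (rule hom_sum_cong) (use that Z in \<open>simp_all add: hom_iff\<close>)
    finally show ?thesis .
  qed
  show "(R\<dagger> \<triangleright> c) \<cdot> Z = hom_sum (src Z) c I (\<lambda>i. ((S i)\<dagger> \<triangleright> c) \<cdot> ((V i)\<dagger> \<triangleright> (b i \<diamondop> c)) \<cdot> (\<alpha> \<triangleleft> (W i)\<dagger> \<triangleright> c) \<cdot> Z)"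
    if c: "c \<in> Obj C" "tgt Z = \<alpha> \<diamondop> \<beta> \<diamondop> c"
  proof -
    note [simp] = c Z
    have fc: "?f i \<triangleright> c \<in> Hom (\<alpha> \<diamondop> \<beta> \<diamondop> c) c" if i: "i \<in> I" for i
      using f[OF i] c by (simp add: hom_iff del: whisker_cmp)
    have 1: "R\<dagger> \<triangleright> c = hom_sum (\<alpha> \<diamondop> \<beta> \<diamondop> c) c I (\<lambda>i. ?f i \<triangleright> c)"
      unfolding R using hom_sum_linear(3)[OF _ _ I f c(1)] c by simp
    have "(R\<dagger> \<triangleright> c) \<cdot> Z = hom_sum (src Z) c I (\<lambda>i. (?f i \<triangleright> c) \<cdot> Z)"
      unfolding 1 by (rule hom_sum_linear(2)[OF _ _ I fc]) simp_all
    also have "\<dots> = hom_sum (src Z) c I (\<lambda>i. ((S i)\<dagger> \<triangleright> c) \<cdot> ((V i)\<dagger> \<triangleright> (b i \<diamondop> c)) \<cdot> (\<alpha> \<triangleleft> (W i)\<dagger> \<triangleright> c) \<cdot> Z)"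
      by (rule hom_sum_cong) (simp_all add: hom_iff)
    finally show ?thesis .
  qed
qed

lemma summed_cup_arr:
  assumes "finite I" "\<alpha> \<in> Obj C" "\<beta> \<in> Obj C"
    and "\<And>i. i \<in> I \<Longrightarrow> arr (V i) \<and> src (V i) = a i \<and> tgt (V i) = \<alpha> \<and> arr (W i) \<and> src (W i) = b i \<and> tgt (W i)
      = \<beta>"
    and "\<And>i. i \<in> I \<Longrightarrow> arr (S i) \<and> src (S i) = \<iota> \<and> tgt (S i) = a i \<diamondop> b i"
  shows "arr (hom_sum \<iota> (\<alpha> \<diamondop> \<beta>) I (\<lambda>i. (V i \<boxtimes> W i) \<cdot> S i))"
    "src (hom_sum \<iota> (\<alpha> \<diamondop> \<beta>) I (\<lambda>i. (V i \<boxtimes> W i) \<cdot> S i)) = \<iota>"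
    "tgt (hom_sum \<iota> (\<alpha> \<diamondop> \<beta>) I (\<lambda>i. (V i \<boxtimes> W i) \<cdot> S i)) = \<alpha> \<diamondop> \<beta>"
proof -
  have "(V i \<boxtimes> W i) \<cdot> S i \<in> Hom \<iota> (\<alpha> \<diamondop> \<beta>)" if "i \<in> I" for i using assms that by (simp add: hom_iff)
  from hom_sum_arr[OF _ _ this] assms(1-3) show "arr (hom_sum \<iota> (\<alpha> \<diamondop> \<beta>) I (\<lambda>i. (V i \<boxtimes> W i) \<cdot> S i))"
    "src (hom_sum \<iota> (\<alpha> \<diamondop> \<beta>) I (\<lambda>i. (V i \<boxtimes> W i) \<cdot> S i)) = \<iota>"
    "tgt (hom_sum \<iota> (\<alpha> \<diamondop> \<beta>) I (\<lambda>i. (V i \<boxtimes> W i) \<cdot> S i)) = \<alpha> \<diamondop> \<beta>" by simp_all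
qed

text \<open>Each term of the snake reduces to the snake of the \<open>i\<close>th summand, conjugated with \<open>W i\<close>.\<close>

lemma zigzag_summed:
  assumes W: "complete_family \<rho> I r W" and Wb: "complete_family \<rho>b I rb Wb"
    and S: "\<And>i. i \<in> I \<Longrightarrow> conjugate_solution C (r i) (rb i) (S i) (Sb i)"
    and R: "R = hom_sum \<iota> (\<rho>b \<diamondop> \<rho>) I (\<lambda>i. (Wb i \<boxtimes> W i) \<cdot> S i)"
    and Rb: "Rb = hom_sum \<iota> (\<rho> \<diamondop> \<rho>b) I (\<lambda>i. (W i \<boxtimes> Wb i) \<cdot> Sb i)"
  shows "(Rb\<dagger> \<triangleright> \<rho>) \<cdot> (\<rho> \<triangleleft> R) = \<i>\<d> \<rho>"
proof -
  note w = complete_familyD[OF W] and wb = complete_familyD[OF Wb] and s = solutionD[OF S]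
  note [simp] = w(1-6) wb(1-6) s(1-8)
  have R' [simp]: "arr R" "src R = \<iota>" "tgt R = \<rho>b \<diamondop> \<rho>" unfolding R by (rule summed_cup_arr; simp)+
  have c: "((Wb i)\<dagger> \<triangleright> \<rho>) \<cdot> R = (rb i \<triangleleft> W i) \<cdot> S i" if "i \<in> I" for i
    by (rule cup_component(1)[OF _ _ _ _ _ R that Wb]) simp_all
  have "(Rb\<dagger> \<triangleright> \<rho>) \<cdot> (\<rho> \<triangleleft> R)
    = hom_sum \<rho> \<rho> I (\<lambda>i. ((Sb i)\<dagger> \<triangleright> \<rho>) \<cdot> ((W i)\<dagger> \<triangleright> (rb i \<diamondop> \<rho>)) \<cdot> (\<rho> \<triangleleft> (Wb i)\<dagger> \<triangleright> \<rho>) \<cdot> (\<rho> \<triangleleft> R))"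
    by (subst summed_cup_star(2)[OF _ _ _ _ _ Rb, where a=r and b=rb]) simp_all
  also have "\<dots> = hom_sum \<rho> \<rho> I (\<lambda>i. W i \<cdot> (W i)\<dagger>)"
  proof (rule hom_sum_cong)
    fix i assume i [simp]: "i \<in> I"
    have "((Sb i)\<dagger> \<triangleright> \<rho>) \<cdot> ((W i)\<dagger> \<triangleright> (rb i \<diamondop> \<rho>)) \<cdot> (\<rho> \<triangleleft> (Wb i)\<dagger> \<triangleright> \<rho>) \<cdot> (\<rho> \<triangleleft> R)
      = ((Sb i)\<dagger> \<triangleright> \<rho>) \<cdot> ((W i)\<dagger> \<triangleright> (rb i \<diamondop> \<rho>)) \<cdot> (\<rho> \<triangleleft> (((Wb i)\<dagger> \<triangleright> \<rho>) \<cdot> R))" by simp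
    also have "\<dots> = ((Sb i)\<dagger> \<triangleright> \<rho>) \<cdot> ((W i)\<dagger> \<triangleright> (rb i \<diamondop> \<rho>)) \<cdot> (\<rho> \<triangleleft> ((rb i \<triangleleft> W i) \<cdot> S i))" unfolding c[OF i] ..
    also have "((W i)\<dagger> \<triangleright> (rb i \<diamondop> \<rho>)) \<cdot> (\<rho> \<triangleleft> ((rb i \<triangleleft> W i) \<cdot> S i)) = (r i \<triangleleft> ((rb i \<triangleleft> W i) \<cdot> S i)) \<cdot> (W i)\<dagger>"
      using exchange[of "(W i)\<dagger>" "(rb i \<triangleleft> W i) \<cdot> S i"] by simp
    also have "((Sb i)\<dagger> \<triangleright> \<rho>) \<cdot> (r i \<triangleleft> ((rb i \<triangleleft> W i) \<cdot> S i)) \<cdot> (W i)\<dagger>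
      = (((Sb i)\<dagger> \<triangleright> \<rho>) \<cdot> ((r i \<diamondop> rb i) \<triangleleft> W i)) \<cdot> (r i \<triangleleft> S i) \<cdot> (W i)\<dagger>" by simp
    also have "((Sb i)\<dagger> \<triangleright> \<rho>) \<cdot> ((r i \<diamondop> rb i) \<triangleleft> W i) = W i \<cdot> ((Sb i)\<dagger> \<triangleright> r i)"
      using exchange[of "(Sb i)\<dagger>" "W i"] by simp
    also have "(W i \<cdot> ((Sb i)\<dagger> \<triangleright> r i)) \<cdot> (r i \<triangleleft> S i) \<cdot> (W i)\<dagger>
      = W i \<cdot> (((Sb i)\<dagger> \<triangleright> r i) \<cdot> (r i \<triangleleft> S i)) \<cdot> (W i)\<dagger>" by simp
    also have "\<dots> = W i \<cdot> (W i)\<dagger>" unfolding s(9)[OF i] by simp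
    finally show "((Sb i)\<dagger> \<triangleright> \<rho>) \<cdot> ((W i)\<dagger> \<triangleright> (rb i \<diamondop> \<rho>)) \<cdot> (\<rho> \<triangleleft> (Wb i)\<dagger> \<triangleright> \<rho>) \<cdot> (\<rho> \<triangleleft> R) = W i \<cdot> (W i)\<dagger>" .
  qed (simp_all add: hom_iff)
  also have "\<dots> = \<i>\<d> \<rho>" by (rule w(9))
  finally show ?thesis .
qed

text \<open>Both closures of \<open>X\<close> are sums over \<open>i\<close> of closures of the compression of \<open>X\<close> to the \<open>i\<close>th summand.\<close>

lemma spherical_sum:
  assumes W: "complete_family \<rho> I r W" and Wb: "complete_family \<rho>b I rb Wb"
    and S: "\<And>i. i \<in> I \<Longrightarrow> spherical (r i) (rb i) (S i) (Sb i)"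
    and R: "R = hom_sum \<iota> (\<rho>b \<diamondop> \<rho>) I (\<lambda>i. (Wb i \<boxtimes> W i) \<cdot> S i)"
    and Rb: "Rb = hom_sum \<iota> (\<rho> \<diamondop> \<rho>b) I (\<lambda>i. (W i \<boxtimes> Wb i) \<cdot> Sb i)"
  shows "spherical \<rho> \<rho>b R Rb"
  unfolding spherical_def
proof (intro conjI allI impI)
  note w = complete_familyD[OF W] and wb = complete_familyD[OF Wb]
    and c = sphericalD(1)[OF S] and s = solutionD[OF sphericalD(1)[OF S]]
  note [simp] = w(1-6) wb(1-6) s(1-8)
  have R' [simp]: "arr R" "src R = \<iota>" "tgt R = \<rho>b \<diamondop> \<rho>" unfolding R by (rule summed_cup_arr; simp)+
  have Rb' [simp]: "arr Rb" "src Rb = \<iota>" "tgt Rb = \<rho> \<diamondop> \<rho>b" unfolding Rb by (rule summed_cup_arr; simp)+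
  show "conjugate_solution C \<rho> \<rho>b R Rb"
    by (rule solutionI)
      (simp_all add: zigzag_summed[OF W Wb c R Rb] zigzag_summed[OF Wb W solution_swap[OF c] Rb R])
  fix X assume "arr X \<and> src X = \<rho> \<and> tgt X = \<rho>"
  then have [simp]: "arr X" "src X = \<rho>" "tgt X = \<rho>" by auto
  have 1: "((Wb i)\<dagger> \<triangleright> \<rho>) \<cdot> R = (rb i \<triangleleft> W i) \<cdot> S i" if "i \<in> I" for i
    by (rule cup_component(1)[OF _ _ _ _ _ R that Wb]) simp_all
  have 2: "(\<rho> \<triangleleft> (Wb i)\<dagger>) \<cdot> Rb = (W i \<triangleright> rb i) \<cdot> Sb i" if "i \<in> I" for i
    by (rule cup_component(2)[OF _ _ _ _ _ Rb that Wb]) simp_all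
  have "R\<dagger> \<cdot> (\<rho>b \<triangleleft> X) \<cdot> R
    = hom_sum \<iota> \<iota> I (\<lambda>i. (S i)\<dagger> \<cdot> ((Wb i)\<dagger> \<triangleright> r i) \<cdot> (\<rho>b \<triangleleft> (W i)\<dagger>) \<cdot> (\<rho>b \<triangleleft> X) \<cdot> R)"
    by (subst summed_cup_star(1)[OF _ _ _ _ _ R, where a=rb and b=r]) simp_all
  also have "\<dots> = hom_sum \<iota> \<iota> I (\<lambda>i. (S i)\<dagger> \<cdot> (rb i \<triangleleft> ((W i)\<dagger> \<cdot> X \<cdot> W i)) \<cdot> S i)"
  proof (rule hom_sum_cong)
    fix i assume i [simp]: "i \<in> I"
    have "(S i)\<dagger> \<cdot> ((Wb i)\<dagger> \<triangleright> r i) \<cdot> (\<rho>b \<triangleleft> (W i)\<dagger>) \<cdot> (\<rho>b \<triangleleft> X) \<cdot> R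
      = (S i)\<dagger> \<cdot> (((Wb i)\<dagger> \<triangleright> r i) \<cdot> (\<rho>b \<triangleleft> ((W i)\<dagger> \<cdot> X))) \<cdot> R" by simp
    also have "((Wb i)\<dagger> \<triangleright> r i) \<cdot> (\<rho>b \<triangleleft> ((W i)\<dagger> \<cdot> X)) = (rb i \<triangleleft> ((W i)\<dagger> \<cdot> X)) \<cdot> ((Wb i)\<dagger> \<triangleright> \<rho>)"
      using exchange[of "(Wb i)\<dagger>" "(W i)\<dagger> \<cdot> X"] by simp
    also have "(S i)\<dagger> \<cdot> ((rb i \<triangleleft> ((W i)\<dagger> \<cdot> X)) \<cdot> ((Wb i)\<dagger> \<triangleright> \<rho>)) \<cdot> R
      = (S i)\<dagger> \<cdot> (rb i \<triangleleft> ((W i)\<dagger> \<cdot> X)) \<cdot> ((Wb i)\<dagger> \<triangleright> \<rho>) \<cdot> R" by simp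
    also have "\<dots> = (S i)\<dagger> \<cdot> (rb i \<triangleleft> ((W i)\<dagger> \<cdot> X \<cdot> W i)) \<cdot> S i" unfolding 1[OF i] by simp
    finally show "(S i)\<dagger> \<cdot> ((Wb i)\<dagger> \<triangleright> r i) \<cdot> (\<rho>b \<triangleleft> (W i)\<dagger>) \<cdot> (\<rho>b \<triangleleft> X) \<cdot> R
      = (S i)\<dagger> \<cdot> (rb i \<triangleleft> ((W i)\<dagger> \<cdot> X \<cdot> W i)) \<cdot> S i" .
  qed (simp_all add: hom_iff)
  also have "\<dots> = hom_sum \<iota> \<iota> I (\<lambda>i. (Sb i)\<dagger> \<cdot> (((W i)\<dagger> \<cdot> X \<cdot> W i) \<triangleright> rb i) \<cdot> Sb i)"
    by (rule hom_sum_cong) (simp_all add: sphericalD(2)[OF S] hom_iff del: whisker_cmp)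
  also have "\<dots> = hom_sum \<iota> \<iota> I (\<lambda>i. (Sb i)\<dagger> \<cdot> ((W i)\<dagger> \<triangleright> rb i) \<cdot> (\<rho> \<triangleleft> (Wb i)\<dagger>) \<cdot> (X \<triangleright> \<rho>b) \<cdot> Rb)"
  proof (rule hom_sum_cong)
    fix i assume i [simp]: "i \<in> I"
    have "(Sb i)\<dagger> \<cdot> (((W i)\<dagger> \<cdot> X \<cdot> W i) \<triangleright> rb i) \<cdot> Sb i
      = (Sb i)\<dagger> \<cdot> ((W i)\<dagger> \<triangleright> rb i) \<cdot> (X \<triangleright> rb i) \<cdot> (W i \<triangleright> rb i) \<cdot> Sb i" by simp
    also have "\<dots> = (Sb i)\<dagger> \<cdot> ((W i)\<dagger> \<triangleright> rb i) \<cdot> ((X \<triangleright> rb i) \<cdot> (\<rho> \<triangleleft> (Wb i)\<dagger>)) \<cdot> Rb"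
      unfolding 2[OF i, symmetric] by simp
    also have "(X \<triangleright> rb i) \<cdot> (\<rho> \<triangleleft> (Wb i)\<dagger>) = (\<rho> \<triangleleft> (Wb i)\<dagger>) \<cdot> (X \<triangleright> \<rho>b)" using exchange[of X "(Wb i)\<dagger>"] by simp
    also have "(Sb i)\<dagger> \<cdot> ((W i)\<dagger> \<triangleright> rb i) \<cdot> ((\<rho> \<triangleleft> (Wb i)\<dagger>) \<cdot> (X \<triangleright> \<rho>b)) \<cdot> Rb
      = (Sb i)\<dagger> \<cdot> ((W i)\<dagger> \<triangleright> rb i) \<cdot> (\<rho> \<triangleleft> (Wb i)\<dagger>) \<cdot> (X \<triangleright> \<rho>b) \<cdot> Rb" by simp
    finally show "(Sb i)\<dagger> \<cdot> (((W i)\<dagger> \<cdot> X \<cdot> W i) \<triangleright> rb i) \<cdot> Sb i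
      = (Sb i)\<dagger> \<cdot> ((W i)\<dagger> \<triangleright> rb i) \<cdot> (\<rho> \<triangleleft> (Wb i)\<dagger>) \<cdot> (X \<triangleright> \<rho>b) \<cdot> Rb" .
  qed (simp_all add: hom_iff)
  also have "\<dots> = Rb\<dagger> \<cdot> (X \<triangleright> \<rho>b) \<cdot> Rb"
    by (subst summed_cup_star(1)[OF _ _ _ _ _ Rb, where a=r and b=rb]) simp_all
  finally show "R\<dagger> \<cdot> (\<rho>b \<triangleleft> X) \<cdot> R = Rb\<dagger> \<cdot> (X \<triangleright> \<rho>b) \<cdot> Rb" .
qed

lemma irreducible_scalar:
  assumes "irreducible_obj C \<rho>" "arr X" "src X = \<rho>" "tgt X = \<rho>"
  obtains c where "X = c \<star> \<i>\<d> \<rho>"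
proof -
  have o: "\<rho> \<in> Obj C" using assms(1) unfolding irreducible_obj_def by simp
  then have "X \<in> Hom \<rho> \<rho>" using assms by (simp add: hom_iff)
  then obtain c where "X = c \<odot>\<^bsub>homspace C \<rho> \<rho>\<^esub> \<i>\<d> \<rho>" using assms(1) unfolding irreducible_obj_def by auto
  then have "X = c \<star> \<i>\<d> \<rho>" using o by (simp add: scale_def)
  then show ?thesis using that by blast
qed

text \<open>Every \<open>X\<close> is a scalar, so only the closures of the identity have to be compared.\<close>

lemma spherical_irreducible:
  assumes "irreducible_obj C \<rho>" and c: "conjugate_solution C \<rho> \<rho>b R Rb" and n: "R\<dagger> \<cdot> R = Rb\<dagger> \<cdot> Rb"
  shows "spherical \<rho> \<rho>b R Rb"
  unfolding spherical_def
proof (intro conjI allI impI)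
  fix X assume "arr X \<and> src X = \<rho> \<and> tgt X = \<rho>"
  then obtain k where X: "X = k \<star> \<i>\<d> \<rho>" using irreducible_scalar[OF assms(1)] by blast
  note [simp] = solutionD[OF c]
  show "R\<dagger> \<cdot> (\<rho>b \<triangleleft> X) \<cdot> R = Rb\<dagger> \<cdot> (X \<triangleright> \<rho>b) \<cdot> Rb" by (simp add: X n)
qed (rule c)

text \<open>A decomposition into irreducibles is orthogonal by \<open>complete_family_isometries\<close>, and normalized
  solutions of irreducible objects are spherical.\<close>

lemma standard_imp_spherical:
  assumes "standard_solution C \<rho> \<rho>b R Rb"
  shows "spherical \<rho> \<rho>b R Rb"
proof -
  have fam: "complete_family \<rho> {..<n} r W" if "irreducible_decomposition C \<rho> n r W" for \<rho> n r W
  proof (rule complete_family_isometries)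
    note d = that[unfolded irreducible_decomposition_def]
    show o: "\<rho> \<in> Obj C" using d by simp
    fix i assume "i \<in> {..<n}"
    then have "isometry_arrow C (r i) \<rho> (W i)" "r i \<in> Obj C" using d unfolding irreducible_obj_def by auto
    from isometryD[OF this o] show "arr (W i) \<and> src (W i) = r i \<and> tgt (W i) = \<rho>" "(W i)\<dagger> \<cdot> W i = \<i>\<d> (r i)"
      by auto
  next
    show "hom_sum \<rho> \<rho> {..<n} (\<lambda>i. W i \<cdot> (W i)\<dagger>) = \<i>\<d> \<rho>"
      using that unfolding irreducible_decomposition_def hom_sum_def by simp
  qed simp
  from assms obtain n r rb W Wb S Sb where
    d: "irreducible_decomposition C \<rho> n r W" "irreducible_decomposition C \<rho>b n rb Wb"
    and S: "\<And>i. i < n \<Longrightarrow> normalized_solution C (r i) (rb i) (S i) (Sb i)"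
    and R: "R = (\<Oplus>\<^bsub>homspace C \<iota> (\<rho>b \<diamondop> \<rho>)\<^esub>i\<in>{..<n}. (Wb i \<boxtimes> W i) \<cdot> S i)"
    and Rb: "Rb = (\<Oplus>\<^bsub>homspace C \<iota> (\<rho> \<diamondop> \<rho>b)\<^esub>i\<in>{..<n}. (W i \<boxtimes> Wb i) \<cdot> Sb i)"
    unfolding standard_solution_def by blast
  have "spherical (r i) (rb i) (S i) (Sb i)" if "i \<in> {..<n}" for i
    using S[of i] that spherical_irreducible unfolding normalized_solution_def by auto
  from spherical_sum[OF fam[OF d(1)] fam[OF d(2)] this R[folded hom_sum_def] Rb[folded hom_sum_def]] show ?thesis by simp
qed

end

section \<open>Existence of spherical solutions\<close>

context TC_star begin

text \<open>Definiteness alone does not say that the scalar \<open>X\<dagger> \<cdot> X\<close> is nonnegative. If it were \<open>r < 0\<close>, then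
  \<open>X\<close> and \<open>sqrt (-r) \<star> id\<close> would be two arrows whose squares add up to zero. The case
  distinction treats the degenerate category in which the identity of the unit object is zero.\<close>

lemma unit_norm_scalar:
  assumes X: "arr X" "src X = \<iota>"
  obtains r :: real where "r \<ge> 0" "X\<dagger> \<cdot> X = of_real r \<star> \<i>\<d> \<iota>" "r = 0 \<Longrightarrow> X = zero_arr \<iota> (tgt X)"
proof (cases "\<i>\<d> \<iota> = zero_arr \<iota> \<iota>")
  case True
  have "X = X \<cdot> \<i>\<d> \<iota>" using X by simp
  also have "\<dots> = zero_arr \<iota> (tgt X)" unfolding True using X by simp
  finally have z: "X = zero_arr \<iota> (tgt X)" .
  have "X\<dagger> \<cdot> X = X\<dagger> \<cdot> zero_arr \<iota> (tgt X)" using z by simp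
  also have "\<dots> = of_real 0 \<star> \<i>\<d> \<iota>" using X by simp
  finally show ?thesis using that[of 0] z by blast
next
  case False
  note [simp] = X
  obtain c where c: "X\<dagger> \<cdot> X = c \<star> \<i>\<d> \<iota>" using irreducible_scalar[OF unit_irreducible, of "X\<dagger> \<cdot> X"] by auto
  have "(X\<dagger> \<cdot> X)\<dagger> = X\<dagger> \<cdot> X" by simp
  then have "cnj c \<star> \<i>\<d> \<iota> = c \<star> \<i>\<d> \<iota>" unfolding c by simp
  then have "cnj c = c" using scale_inject[of "\<i>\<d> \<iota>"] False by simp
  then obtain r where r: "c = of_real r" by (metis Reals_cnj_iff Reals_cases)
  have "r \<ge> 0"
  proof (rule ccontr)
    assume "\<not> r \<ge> 0"
    define Y where "Y = complex_of_real (sqrt (- r)) \<star> \<i>\<d> \<iota>"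
    have "complex_of_real (sqrt (- r)) * complex_of_real (sqrt (- r)) = of_real (- r)"
      using \<open>\<not> r \<ge> 0\<close> unfolding of_real_mult[symmetric] by simp
    then have "Y\<dagger> \<cdot> Y = (- c) \<star> \<i>\<d> \<iota>" by (simp add: Y_def r)
    then have "X\<dagger> \<cdot> X \<boxplus> Y\<dagger> \<cdot> Y = zero_arr \<iota> \<iota>" unfolding c using scale_add_left[of "\<i>\<d> \<iota>" c "- c"] by simp
    then have "X = zero_arr \<iota> (tgt X)" by (intro sum_of_squares_zero[of X Y]) (simp_all add: Y_def)
    then have "X\<dagger> \<cdot> X = X\<dagger> \<cdot> zero_arr \<iota> (tgt X)" by simp
    then have "c \<star> \<i>\<d> \<iota> = zero_arr \<iota> \<iota>" unfolding c by simp
    then have "c = 0" using scale_eq_zero[of "\<i>\<d> \<iota>" c] False by simp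
    then show False using r \<open>\<not> r \<ge> 0\<close> by simp
  qed
  moreover have "X = zero_arr \<iota> (tgt X)" if "r = 0" using star_pos[of X] c r that by simp
  ultimately show ?thesis using that c r by blast
qed

text \<open>Multiplying \<open>R\<close> by \<open>q > 0\<close> and \<open>Rb\<close> by \<open>1/q\<close> preserves the conjugate equations, and \<open>q\<close> can be chosen
  so that the two squared norms agree. If one of them vanishes, \<open>\<rho>\<close> is a zero object and both are zero.\<close>

lemma spherical_exists_irreducible:
  assumes i: "irreducible_obj C \<rho>"
  shows "\<exists>\<rho>b R Rb. spherical \<rho> \<rho>b R Rb"
proof -
  have o: "\<rho> \<in> Obj C" using i unfolding irreducible_obj_def by simp
  obtain \<rho>b R Rb where c: "conjugate_solution C \<rho> \<rho>b R Rb" using conjugates o unfolding has_conjugates_def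
    by blast
  note s = solutionD[OF c]
  note [simp] = s
  obtain r :: real where r: "r \<ge> 0" "R\<dagger> \<cdot> R = of_real r \<star> \<i>\<d> \<iota>" "r = 0 \<Longrightarrow> R = zero_arr \<iota> (\<rho>b \<diamondop> \<rho>)"
    using unit_norm_scalar[of R] by auto
  obtain t :: real where t: "t \<ge> 0" "Rb\<dagger> \<cdot> Rb = of_real t \<star> \<i>\<d> \<iota>" "t = 0 \<Longrightarrow> Rb = zero_arr \<iota> (\<rho> \<diamondop> \<rho>b)"
    using unit_norm_scalar[of Rb] by auto
  show ?thesis
  proof (cases "r = 0 \<or> t = 0")
    case True
    have "(Rb\<dagger> \<triangleright> \<rho>) \<cdot> (\<rho> \<triangleleft> R) = zero_arr \<rho> \<rho>"
    proof (cases "r = 0")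
      case True show ?thesis unfolding r(3)[OF True] by simp
    next
      case False
      then have "t = 0" using True by simp
      show ?thesis unfolding t(3)[OF \<open>t = 0\<close>] by (simp del: s(9))
    qed
    then have z: "\<i>\<d> \<rho> = zero_arr \<rho> \<rho>" by simp
    have "R = (\<rho>b \<triangleleft> \<i>\<d> \<rho>) \<cdot> R" "Rb = (\<i>\<d> \<rho> \<triangleright> \<rho>b) \<cdot> Rb" by simp_all
    then have "R = zero_arr \<iota> (\<rho>b \<diamondop> \<rho>)" "Rb = zero_arr \<iota> (\<rho> \<diamondop> \<rho>b)" unfolding z by simp_all
    then have "R\<dagger> \<cdot> R = Rb\<dagger> \<cdot> Rb" by simp
    then show ?thesis using spherical_irreducible[OF i c] by blast
  next
    case False
    then have rt: "r > 0" "t > 0" using r(1) t(1) by auto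
    \<comment> \<open>The squared norms \<open>r\<close> and \<open>t\<close> become \<open>q\<^sup>2 r\<close> and \<open>t / q\<^sup>2\<close>; hence the fourth root.\<close>
    define q where "q = sqrt (sqrt (t / r))"
    have q: "q > 0" "q * q * r = inverse q * inverse q * t"
    proof -
      show q0: "q > 0" using rt by (simp add: q_def)
      have "q * q = sqrt (t / r)" using rt by (simp add: q_def)
      then have "(q * q) * (q * q) = t / r" using rt by simp
      then show "q * q * r = inverse q * inverse q * t" using rt q0 by (simp add: field_simps)
    qed
    define R' Rb' where "R' = of_real q \<star> R" and "Rb' = of_real (inverse q) \<star> Rb"
    have qc: "complex_of_real q * complex_of_real q * complex_of_real r =
      inverse (complex_of_real q) * inverse (complex_of_real q) * complex_of_real t"
      using q(2) by (metis of_real_inverse of_real_mult)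
    have "conjugate_solution C \<rho> \<rho>b R' Rb'"
      by (rule solutionI) (use q(1) in \<open>simp_all add: R'_def Rb'_def\<close>)
    moreover have "R'\<dagger> \<cdot> R' = Rb'\<dagger> \<cdot> Rb'" using qc by (simp add: R'_def Rb'_def r(2) t(2) ac_simps)
    ultimately show ?thesis using spherical_irreducible[OF i] by blast
  qed
qed

text \<open>The endomorphism space has dimension at most \<open>n\<close>. Families instead of sets of arrows are used since they
  can be transported along maps that are not known to be injective.\<close>

definition dependent_beyond :: "'a \<Rightarrow> nat \<Rightarrow> bool" where
  "dependent_beyond \<rho> n \<longleftrightarrow> (\<forall>x. (\<forall>i\<le>n. x i \<in> Hom \<rho> \<rho>) \<longrightarrow>
     (\<exists>c. (\<exists>i\<le>n. c i \<noteq> 0) \<and> hom_sum \<rho> \<rho> {..n} (\<lambda>i. c i \<star> x i) = zero_arr \<rho> \<rho>))"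

lemma dependent_beyond_dim:
  assumes o [simp]: "\<rho> \<in> Obj C"
  shows "\<exists>n. dependent_beyond \<rho> n"
proof
  interpret V: vectorspace class_ring "homspace C \<rho> \<rho>" by (rule hom_vectorspace) (use assms in auto)
  show "dependent_beyond \<rho> V.dim" unfolding dependent_beyond_def
  proof (intro allI impI)
    fix x assume x: "\<forall>i\<le>V.dim. x i \<in> Hom \<rho> \<rho>"
    show "\<exists>c. (\<exists>i\<le>V.dim. c i \<noteq> 0) \<and> hom_sum \<rho> \<rho> {..V.dim} (\<lambda>i. c i \<star> x i) = zero_arr \<rho> \<rho>"
    proof (cases "inj_on x {..V.dim}")
      case True
      have X: "x ` {..V.dim} \<subseteq> Hom \<rho> \<rho>" using x by auto
      have "card (x ` {..V.dim}) = Suc V.dim" using card_image[OF True] by simp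
      then have ld: "V.lin_dep (x ` {..V.dim})" using V.li_le_dim(2)[OF hom_fin_dim[OF o o] X] by auto
      obtain a v where a: "V.lincomb a (x ` {..V.dim}) = zero_arr \<rho> \<rho>" "v \<in> x ` {..V.dim}" "a v \<noteq> 0"
        using V.finite_lin_dep[OF _ ld X] by auto
      have "V.lincomb a (x ` {..V.dim}) = (\<Oplus>\<^bsub>homspace C \<rho> \<rho>\<^esub>i\<in>{..V.dim}. a (x i) \<odot>\<^bsub>homspace C \<rho> \<rho>\<^esub> x i)"
        unfolding V.lincomb_def by (rule V.M.finsum_reindex[OF _ True]) (use x in auto)
      also have "\<dots> = hom_sum \<rho> \<rho> {..V.dim} (\<lambda>i. a (x i) \<star> x i)" unfolding hom_sum_def
        by (rule V.M.finsum_cong') (use x in \<open>auto simp: hom_scale[symmetric]\<close>)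
      finally show ?thesis using a by (intro exI[of _ "a \<circ> x"]) auto
    next
      case False
      then obtain i j where ij: "i \<le> V.dim" "j \<le> V.dim" "i \<noteq> j" "x i = x j" unfolding inj_on_def by auto
      \<comment> \<open>A repetition in the family is a linear relation by itself.\<close>
      define c :: "nat \<Rightarrow> complex" where "c k = (if k = i then 1 else if k = j then -1 else 0)" for k
      define K where "K = {..V.dim} - {i, j}"
      have K: "{..V.dim} = insert i (insert j K)" "finite K" "i \<notin> insert j K" "j \<notin> K" using ij
        by (auto simp: K_def)
      have h: "c k \<star> x k \<in> Hom \<rho> \<rho>" if "k \<in> {..V.dim}" for k using x that by (simp add: hom_iff)
      have "hom_sum \<rho> \<rho> {..V.dim} (\<lambda>i. c i \<star> x i) = c i \<star> x i \<boxplus> (c j \<star> x j \<boxplus> hom_sum \<rho> \<rho> K (\<lambda>i. c i \<star> x i))"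
        unfolding K(1) using K h by (subst hom_sum_insert, auto)+
      also have "hom_sum \<rho> \<rho> K (\<lambda>i. c i \<star> x i) = zero_arr \<rho> \<rho>"
        by (rule hom_sum_zero) (use x in \<open>auto simp: c_def K_def hom_iff\<close>)
      also have "c i \<star> x i \<boxplus> (c j \<star> x j \<boxplus> zero_arr \<rho> \<rho>) = zero_arr \<rho> \<rho>" using ij x
        by (auto simp: c_def hom_iff)
      finally show ?thesis using ij by (intro exI[of _ c]) (auto simp: c_def)
    qed
  qed
qed

text \<open>Transport \<open>n + 1\<close> endomorphisms of \<open>\<sigma>\<close> to \<open>\<rho>\<close> and adjoin the complementary projection \<open>F\<close>. The
  resulting relation restricts to \<open>\<sigma>\<close>, where \<open>F\<close> disappears; it stays nontrivial there because \<open>F\<close> alone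
  satisfies no relation.\<close>

lemma dependent_beyond_subobject:
  assumes d: "dependent_beyond \<rho> (Suc n)" and V [simp]: "arr V" "src V = \<sigma>" "tgt V = \<rho>"
    and i: "V\<dagger> \<cdot> V = \<i>\<d> \<sigma>"
    and ne: "V \<cdot> V\<dagger> \<noteq> \<i>\<d> \<rho>"
  shows "dependent_beyond \<sigma> n"
  unfolding dependent_beyond_def
proof (intro allI impI)
  fix x assume x: "\<forall>i\<le>n. x i \<in> Hom \<sigma> \<sigma>"
  have [simp]: "\<rho> \<in> Obj C" "\<sigma> \<in> Obj C" using V arr_src[of V] arr_tgt[of V] by auto
  have x [simp]: "arr (x i)" "src (x i) = \<sigma>" "tgt (x i) = \<sigma>" if "i \<le> n" for i using x that
    by (auto simp: hom_iff)
  define F where "F = \<i>\<d> \<rho> \<boxplus> (-1) \<star> (V \<cdot> V\<dagger>)"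
  have F [simp]: "arr F" "src F = \<rho>" "tgt F = \<rho>" by (simp_all add: F_def)
  have F0: "F \<noteq> zero_arr \<rho> \<rho>" using diff_zero_eq[of "\<i>\<d> \<rho>" "V \<cdot> V\<dagger>"] ne by (auto simp: F_def)
  have k: "V\<dagger> \<cdot> V \<cdot> X = X" if "arr X" "tgt X = \<sigma>" for X
    using that comp_assoc[of X V "V\<dagger>"] i by (simp del: comp_assoc)
  have VF: "V\<dagger> \<cdot> F \<cdot> V = zero_arr \<sigma> \<sigma>" by (simp add: F_def k i)
  define y where "y j = (if j \<le> n then V \<cdot> x j \<cdot> V\<dagger> else F)" for j
  have y: "y j \<in> Hom \<rho> \<rho>" for j by (simp add: y_def hom_iff)
  obtain c where c: "\<exists>j\<le>Suc n. c j \<noteq> 0" "hom_sum \<rho> \<rho> {..Suc n} (\<lambda>j. c j \<star> y j) = zero_arr \<rho> \<rho>"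
    using d[unfolded dependent_beyond_def, rule_format, of y] y by auto
  have cy: "c j \<star> y j \<in> Hom \<rho> \<rho>" for j using y[of j] by (simp add: hom_iff)
  have hy [simp]: "arr (hom_sum \<rho> \<rho> {..n} (\<lambda>j. c j \<star> y j))" "src (hom_sum \<rho> \<rho> {..n} (\<lambda>j. c j \<star> y j)) = \<rho>"
    "tgt (hom_sum \<rho> \<rho> {..n} (\<lambda>j. c j \<star> y j)) = \<rho>" by (rule hom_sum_arr; simp add: cy)+
  have split: "c (Suc n) \<star> F \<boxplus> hom_sum \<rho> \<rho> {..n} (\<lambda>j. c j \<star> y j) = zero_arr \<rho> \<rho>"
    using c(2) unfolding atMost_Suc by (subst (asm) hom_sum_insert) (use cy in \<open>simp_all add: y_def\<close>)
  have "\<exists>j\<le>n. c j \<noteq> 0"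
  proof (rule ccontr)
    assume n: "\<not> (\<exists>j\<le>n. c j \<noteq> 0)"
    have "hom_sum \<rho> \<rho> {..n} (\<lambda>j. c j \<star> y j) = zero_arr \<rho> \<rho>"
      by (rule hom_sum_zero) (use n y in \<open>auto simp: hom_iff\<close>)
    with split have "c (Suc n) \<star> F = zero_arr \<rho> \<rho>" by simp
    then have "c (Suc n) = 0" using scale_eq_zero[of F] F0 by simp
    with n c(1) show False by (metis le_Suc_eq)
  qed
  moreover have "hom_sum \<sigma> \<sigma> {..n} (\<lambda>j. c j \<star> x j) = zero_arr \<sigma> \<sigma>"
  proof -
    have "zero_arr \<sigma> \<sigma> = V\<dagger> \<cdot> zero_arr \<rho> \<rho> \<cdot> V" by simp
    also have "\<dots> = V\<dagger> \<cdot> hom_sum \<rho> \<rho> {..n} (\<lambda>j. c j \<star> y j) \<cdot> V"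
      unfolding split[symmetric] by (simp add: VF)
    also have "hom_sum \<rho> \<rho> {..n} (\<lambda>j. c j \<star> y j) \<cdot> V = hom_sum \<sigma> \<rho> {..n} (\<lambda>j. (c j \<star> y j) \<cdot> V)"
      by (subst hom_sum_linear(2)) (use cy in simp_all)
    also have "V\<dagger> \<cdot> \<dots> = hom_sum \<sigma> \<sigma> {..n} (\<lambda>j. V\<dagger> \<cdot> (c j \<star> y j) \<cdot> V)"
      by (subst hom_sum_linear(1)) (use y in \<open>simp_all add: hom_iff\<close>)
    also have "\<dots> = hom_sum \<sigma> \<sigma> {..n} (\<lambda>j. c j \<star> x j)"
      by (rule hom_sum_cong) (simp_all add: hom_iff y_def k i)
    finally show ?thesis by simp
  qed
  ultimately show "\<exists>c. (\<exists>j\<le>n. c j \<noteq> 0) \<and> hom_sum \<sigma> \<sigma> {..n} (\<lambda>i. c i \<star> x i) = zero_arr \<sigma> \<sigma>" by blast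
qed

text \<open>The polynomial \<open>p\<close> evaluated at the endomorphism \<open>A\<close> by Horner's scheme.\<close>

definition poly_arr :: "'a \<Rightarrow> 'b \<Rightarrow> complex poly \<Rightarrow> 'b" where
  "poly_arr \<rho> A p = fold_coeffs (\<lambda>a Y. a \<star> \<i>\<d> \<rho> \<boxplus> A \<cdot> Y) p (zero_arr \<rho> \<rho>)"

context
  fixes \<rho> A
  assumes [simp]: "\<rho> \<in> Obj C" "arr A" "src A = \<rho>" "tgt A = \<rho>"
begin

lemma poly_arr_0 [simp]: "poly_arr \<rho> A 0 = zero_arr \<rho> \<rho>" by (simp add: poly_arr_def)

lemma poly_arr_pCons [simp]: "poly_arr \<rho> A (pCons a p) = a \<star> \<i>\<d> \<rho> \<boxplus> A \<cdot> poly_arr \<rho> A p"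
  by (cases "a = 0 \<and> p = 0") (auto simp: poly_arr_def)

lemma poly_arr_arr [simp]: "arr (poly_arr \<rho> A p)" "src (poly_arr \<rho> A p) = \<rho>" "tgt (poly_arr \<rho> A p) = \<rho>"
  by (induction p) auto

lemma poly_arr_add: "poly_arr \<rho> A (p + q) = poly_arr \<rho> A p \<boxplus> poly_arr \<rho> A q"
proof (induction p q rule: poly_induct2)
  case (pCons a p b q)
  then show ?case by (simp add: scale_add_left add_ac)
qed simp

lemma poly_arr_smult: "poly_arr \<rho> A (Polynomial.smult c p) = c \<star> poly_arr \<rho> A p"
  by (induction p) (auto simp: scale_add_right)

lemma poly_arr_linear_factor:
  "poly_arr \<rho> A ([:-l, 1:] * q) = A \<cdot> poly_arr \<rho> A q \<boxplus> (- l) \<star> poly_arr \<rho> A q"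
proof -
  have "[:-l, 1:] * q = pCons 0 q + Polynomial.smult (- l) q" by simp
  then show ?thesis by (simp only: poly_arr_add poly_arr_smult) simp
qed

text \<open>The powers of \<open>A\<close> are linearly dependent.\<close>

lemma annihilating_polynomial:
  assumes "dependent_beyond \<rho> n"
  shows "\<exists>p. p \<noteq> 0 \<and> poly_arr \<rho> A p = zero_arr \<rho> \<rho>"
proof -
  obtain c where c: "\<exists>i\<le>n. c i \<noteq> 0" "hom_sum \<rho> \<rho> {..n} (\<lambda>i. c i \<star> poly_arr \<rho> A (monom 1 i)) = zero_arr \<rho> \<rho>"
    using assms[unfolded dependent_beyond_def, rule_format, of "\<lambda>i. poly_arr \<rho> A (monom 1 i)"]
      by (auto simp: hom_iff)
  have s: "poly_arr \<rho> A (\<Sum>i\<in>I. monom (c i) i)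
    = hom_sum \<rho> \<rho> I (\<lambda>i. c i \<star> poly_arr \<rho> A (monom 1 i))" if "finite I" for I
    using that
  proof (induction I)
    case (insert k I)
    have "poly_arr \<rho> A (monom (c k) k) = c k \<star> poly_arr \<rho> A (monom 1 k)"
      using poly_arr_smult[of "c k" "monom 1 k"] by (simp add: smult_monom)
    then show ?case using insert by (subst hom_sum_insert) (simp_all add: poly_arr_add hom_iff)
  qed simp
  from c(1) obtain i where "i \<le> n" "c i \<noteq> 0" by blast
  then have "coeff (\<Sum>i\<le>n. monom (c i) i) i \<noteq> 0" by (simp add: coeff_sum)
  then have "(\<Sum>i\<le>n. monom (c i) i) \<noteq> 0" by auto
  with s[of "{..n}"] c(2) show ?thesis by auto
qed

text \<open>Split a linear factor off the minimal polynomial of \<open>A\<close>. The value of the cofactor \<open>q\<close> at \<open>A\<close> is a nonzero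
  eigenvector for the left multiplication by \<open>A\<close>.\<close>

lemma eigenvector_exists:
  assumes "dependent_beyond \<rho> n" and ne: "\<i>\<d> \<rho> \<noteq> zero_arr \<rho> \<rho>"
  obtains q l where "poly_arr \<rho> A q \<noteq> zero_arr \<rho> \<rho>" "A \<cdot> poly_arr \<rho> A q = l \<star> poly_arr \<rho> A q"
proof -
  obtain p where p: "p \<noteq> 0" "poly_arr \<rho> A p = zero_arr \<rho> \<rho>"
    and min: "\<And>q. q \<noteq> 0 \<Longrightarrow> poly_arr \<rho> A q = zero_arr \<rho> \<rho> \<Longrightarrow> degree p \<le> degree q"
    using ex_has_least_nat[of "\<lambda>p. p \<noteq> 0 \<and> poly_arr \<rho> A p
      = zero_arr \<rho> \<rho>" _ degree] annihilating_polynomial[OF assms(1)] by blast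
  have "degree p \<noteq> 0"
  proof
    assume "degree p = 0"
    then obtain a where a: "p = [:a:]" by (metis degree_eq_zeroE)
    have "a = 0" using scale_eq_zero[of "\<i>\<d> \<rho>" a] ne p(2) unfolding a by simp
    with p(1) a show False by simp
  qed
  then obtain l where "poly p l = 0" using fundamental_theorem_of_algebra[of p] constant_degree[of p]
    by auto
  then obtain q where q: "p = [:-l, 1:] * q" using poly_eq_0_iff_dvd by blast
  with p(1) have "q \<noteq> 0" by auto
  then have "degree p = Suc (degree q)" unfolding q by (subst degree_mult_eq) auto
  with min[of q] \<open>q \<noteq> 0\<close> have z: "poly_arr \<rho> A q \<noteq> zero_arr \<rho> \<rho>" by fastforce
  have "A \<cdot> poly_arr \<rho> A q = l \<star> poly_arr \<rho> A q"
  proof (rule diff_zero_eq)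
    show "A \<cdot> poly_arr \<rho> A q \<boxplus> (- 1) \<star> l \<star> poly_arr \<rho> A q
      = zero_arr (src (l \<star> poly_arr \<rho> A q)) (tgt (l \<star> poly_arr \<rho> A q))"
      using p(2) poly_arr_linear_factor[of l q] unfolding q by simp
  qed simp_all
  with z that show ?thesis by blast
qed

text \<open>The second equation lets \<open>B\<dagger> \<cdot> B\<close> be evaluated when \<open>B\<close> itself is a polynomial in \<open>A\<close>.\<close>

lemma poly_arr_eigenvector:
  assumes [simp]: "arr B" "tgt B = \<rho>" and e: "A \<cdot> B = l \<star> B"
  shows "poly_arr \<rho> A p \<cdot> B = poly p l \<star> B"
    "A\<dagger> = A \<Longrightarrow> cnj l = l \<Longrightarrow> (poly_arr \<rho> A p)\<dagger> \<cdot> B = cnj (poly p l) \<star> B"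
proof (induction p)
  case (pCons a p)
  {
    case 1
    have "poly_arr \<rho> A (pCons a p) \<cdot> B = a \<star> B \<boxplus> A \<cdot> (poly_arr \<rho> A p \<cdot> B)" by simp
    also have "\<dots> = a \<star> B \<boxplus> (poly p l * l) \<star> B" using pCons e by simp
    finally show ?case by (simp add: scale_add_left mult.commute)
  next
    case 2
    have "(poly_arr \<rho> A (pCons a p))\<dagger> \<cdot> B = cnj a \<star> B \<boxplus> (poly_arr \<rho> A p)\<dagger> \<cdot> (A \<cdot> B)" using 2 by simp
    also have "\<dots> = cnj a \<star> B \<boxplus> (cnj (poly p l) * l) \<star> B" unfolding e using pCons 2
      by (simp add: mult.commute)
    finally show ?case using 2 by (simp add: scale_add_left mult.commute)
  }
qed simp_all

text \<open>Let \<open>B\<close> be the polynomial in \<open>A\<close> with \<open>A \<cdot> B = l \<star> B\<close>. Since \<open>A\<close> is self-adjoint, \<open>l\<close> is real, and both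
  \<open>B \<cdot> B\<close> and \<open>B\<dagger> \<cdot> B\<close> are multiples of \<open>B\<close>. The second one is not zero, so a multiple of \<open>B\<close> is a
  projection: the spectral projection of \<open>A\<close> for the eigenvalue \<open>l\<close>. It is not the identity, as \<open>A\<close> would then
  be the scalar \<open>l\<close>.\<close>

lemma self_adjoint_projection:
  assumes d: "dependent_beyond \<rho> n" and sa: "A\<dagger> = A" and ns: "\<And>c. A \<noteq> c \<star> \<i>\<d> \<rho>"
  obtains E where "projection_arrow C \<rho> E" "E \<noteq> zero_arr \<rho> \<rho>" "E \<noteq> \<i>\<d> \<rho>"
proof -
  have ne: "\<i>\<d> \<rho> \<noteq> zero_arr \<rho> \<rho>"
  proof
    assume z: "\<i>\<d> \<rho> = zero_arr \<rho> \<rho>"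
    have "A = A \<cdot> \<i>\<d> \<rho>" by simp
    also have "\<dots> = 0 \<star> \<i>\<d> \<rho>" unfolding z by simp
    finally show False using ns by blast
  qed
  obtain q l where B: "poly_arr \<rho> A q \<noteq> zero_arr \<rho> \<rho>" and e: "A \<cdot> poly_arr \<rho> A q = l \<star> poly_arr \<rho> A q"
    using eigenvector_exists[OF d ne] .
  define B where "B = poly_arr \<rho> A q"
  have [simp]: "arr B" "src B = \<rho>" "tgt B = \<rho>" by (simp_all add: B_def)
  note e = e[folded B_def] and B = B[folded B_def]
  have BB: "B\<dagger> \<cdot> B \<noteq> zero_arr \<rho> \<rho>" using star_pos[of B] B by auto
  have "B\<dagger> \<cdot> A \<cdot> B = l \<star> (B\<dagger> \<cdot> B)" unfolding e by simp
  moreover have "(B\<dagger> \<cdot> A \<cdot> B)\<dagger> = B\<dagger> \<cdot> A \<cdot> B" using sa by simp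
  ultimately have "cnj l \<star> (B\<dagger> \<cdot> B) = l \<star> (B\<dagger> \<cdot> B)" by simp
  then have l: "cnj l = l" using scale_inject[of "B\<dagger> \<cdot> B"] BB by simp
  define b where "b = poly q l"
  have b1: "B \<cdot> B = b \<star> B" and b2: "B\<dagger> \<cdot> B = cnj b \<star> B"
    using poly_arr_eigenvector[of B l q] e sa l by (simp_all add: B_def[symmetric] b_def)
  have b0: "b \<noteq> 0" using b2 BB by auto
  have "(B\<dagger> \<cdot> B)\<dagger> = B\<dagger> \<cdot> B" by simp
  then have "b \<star> B\<dagger> = cnj b \<star> B" unfolding b2 by simp
  then have "(inverse b * b) \<star> B\<dagger> = (inverse b * cnj b) \<star> B" by (simp flip: scale_rules(3))
  then have Bs: "B\<dagger> = (inverse b * cnj b) \<star> B" using b0 by simp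
  define E where "E = inverse b \<star> B"
  have [simp]: "arr E" "src E = \<rho>" "tgt E = \<rho>" by (simp_all add: E_def)
  have "E\<dagger> = (inverse (cnj b) * (inverse b * cnj b)) \<star> B" by (simp add: E_def Bs)
  also have "inverse (cnj b) * (inverse b * cnj b) = inverse b" using b0 by (simp add: field_simps)
  finally have "E\<dagger> = E" by (simp add: E_def)
  moreover have "E \<cdot> E = E" using b0 by (simp add: E_def b1)
  ultimately have "projection_arrow C \<rho> E" unfolding projection_arrow_def by (simp add: hom_iff)
  moreover have "E \<noteq> zero_arr \<rho> \<rho>"
  proof
    assume "E = zero_arr \<rho> \<rho>"
    then have "inverse b = 0" using scale_eq_zero[of B "inverse b"] B by (simp add: E_def)
    with b0 show False by simp
  qed
  moreover have "E \<noteq> \<i>\<d> \<rho>"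
  proof
    assume E: "E = \<i>\<d> \<rho>"
    have "A = A \<cdot> E" by (simp add: E)
    also have "\<dots> = l \<star> E" unfolding E_def by (simp add: e mult.commute)
    finally show False using ns[of l] unfolding E by blast
  qed
  ultimately show ?thesis using that by blast
qed

end

text \<open>A nonscalar arrow has a nonscalar real or imaginary part.\<close>

lemma reducible_projection:
  assumes d: "dependent_beyond \<rho> n" and o [simp]: "\<rho> \<in> Obj C" and ni: "\<not> irreducible_obj C \<rho>"
  obtains E where "projection_arrow C \<rho> E" "E \<noteq> zero_arr \<rho> \<rho>" "E \<noteq> \<i>\<d> \<rho>"
proof -
  have "{c \<odot>\<^bsub>homspace C \<rho> \<rho>\<^esub> \<i>\<d> \<rho> | c. True} = {c \<star> \<i>\<d> \<rho> | c. True}" by (simp add: scale_def)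
  moreover have "{c \<star> \<i>\<d> \<rho> | c. True} \<subseteq> Hom \<rho> \<rho>" by (auto simp: hom_iff)
  ultimately obtain X where "X \<in> Hom \<rho> \<rho>" and X: "\<And>c. X \<noteq> c \<star> \<i>\<d> \<rho>"
    using ni o unfolding irreducible_obj_def by auto
  then have [simp]: "arr X" "src X = \<rho>" "tgt X = \<rho>" by (auto simp: hom_iff)
  \<comment> \<open>Twice the real part and, up to sign, twice the imaginary part of \<open>X\<close>.\<close>
  define P Q where "P = X \<boxplus> X\<dagger>" and "Q = \<i> \<star> X \<boxplus> (-\<i>) \<star> X\<dagger>"
  have [simp]: "arr P" "src P = \<rho>" "tgt P = \<rho>" "arr Q" "src Q = \<rho>" "tgt Q = \<rho>"
    by (simp_all add: P_def Q_def)
  have sa: "P\<dagger> = P" "Q\<dagger> = Q" by (simp_all add: P_def Q_def add_comm)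
  have "(1/2) \<star> P \<boxplus> (-\<i>/2) \<star> Q = ((1/2) \<star> X \<boxplus> (1/2) \<star> X) \<boxplus> ((1/2) \<star> X\<dagger> \<boxplus> (-1/2) \<star> X\<dagger>)"
    by (simp add: P_def Q_def scale_add_right add_ac)
  also have "(1/2) \<star> X \<boxplus> (1/2) \<star> X = X" using scale_add_left[of X "1/2" "1/2"] by simp
  also have "(1/2) \<star> X\<dagger> \<boxplus> (-1/2) \<star> X\<dagger> = zero_arr \<rho> \<rho>" using scale_add_left[of "X\<dagger>" "1/2" "-1/2"] by simp
  finally have XPQ: "X = (1/2) \<star> P \<boxplus> (-\<i>/2) \<star> Q" by simp
  consider "\<And>c. P \<noteq> c \<star> \<i>\<d> \<rho>" | "\<And>c. Q \<noteq> c \<star> \<i>\<d> \<rho>"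
  proof (rule ccontr)
    assume "\<not> thesis"
    with that obtain a b where "P = a \<star> \<i>\<d> \<rho>" "Q = b \<star> \<i>\<d> \<rho>" by blast
    then have "X = (1/2 * a + (-\<i>/2) * b) \<star> \<i>\<d> \<rho>" unfolding XPQ
      using scale_add_left[of "\<i>\<d> \<rho>" "1/2 * a" "(-\<i>/2) * b"] by simp
    then show False using X by blast
  qed
  then show ?thesis
  proof cases
    case 1
    show ?thesis by (rule self_adjoint_projection[OF _ _ _ _ d sa(1) 1]) (use that in simp_all)
  next
    case 2
    show ?thesis by (rule self_adjoint_projection[OF _ _ _ _ d sa(2) 2]) (use that in simp_all)
  qed
qed

lemma complete_family_two:
  assumes V: "arr V1" "src V1 = a" "tgt V1 = t" "arr V2" "src V2 = b" "tgt V2 = t"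
    and e: "V1\<dagger> \<cdot> V1 = \<i>\<d> a" "V2\<dagger> \<cdot> V2 = \<i>\<d> b" "V1 \<cdot> V1\<dagger> \<boxplus> V2 \<cdot> V2\<dagger> = \<i>\<d> t"
  shows "complete_family t UNIV (\<lambda>i. if i then a else b) (\<lambda>i. if i then V1 else V2)"
proof (rule complete_family_isometries)
  have [simp]: "t \<in> Obj C" using V arr_tgt by blast
  show "t \<in> Obj C" by simp
  have U: "(UNIV :: bool set) = insert True (insert False {})" by auto
  show "hom_sum t t UNIV (\<lambda>i. (if i then V1 else V2) \<cdot> (if i then V1 else V2)\<dagger>) = \<i>\<d> t"
    unfolding U by (subst hom_sum_insert; (subst hom_sum_insert)?) (use V e in \<open>auto simp: hom_iff\<close>)
qed (use V e in \<open>auto split: if_splits\<close>)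

text \<open>Induction on the dimension of the endomorphism space: a reducible object is the direct sum of two
  subobjects with smaller endomorphism spaces, and its conjugate is a direct sum of their conjugates.\<close>

lemma spherical_exists_bounded:
  assumes "dependent_beyond \<rho> n" "\<rho> \<in> Obj C"
  shows "\<exists>\<rho>b R Rb. spherical \<rho> \<rho>b R Rb"
  using assms
proof (induction n arbitrary: \<rho>)
  case 0
  obtain c :: "nat \<Rightarrow> complex" where c: "c 0 \<noteq> 0" "hom_sum \<rho> \<rho> {..0} (\<lambda>i. c i \<star> \<i>\<d> \<rho>) = zero_arr \<rho> \<rho>"
    using 0(1)[unfolded dependent_beyond_def, rule_format, of "\<lambda>_. \<i>\<d> \<rho>"] 0(2) by (auto simp: hom_iff)
  have "hom_sum \<rho> \<rho> {..0} (\<lambda>i. c i \<star> \<i>\<d> \<rho>) = c 0 \<star> \<i>\<d> \<rho>"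
    by (rule hom_sum_single[of _ _ _ 0]) (use 0 in \<open>auto simp: hom_iff\<close>)
  then have z: "\<i>\<d> \<rho> = zero_arr \<rho> \<rho>" using scale_cancel[of "\<i>\<d> \<rho>" "c 0"] c 0(2) by simp
  have "X = c \<star> \<i>\<d> \<rho>" if "X \<in> Hom \<rho> \<rho>" for X c
  proof -
    have X: "arr X" "src X = \<rho>" "tgt X = \<rho>" using that 0(2) by (auto simp: hom_iff)
    then have "X = X \<cdot> \<i>\<d> \<rho>" by simp
    then show ?thesis unfolding z using X 0(2) by simp
  qed
  then have "irreducible_obj C \<rho>" unfolding irreducible_obj_def using 0(2)
    by (auto simp: hom_scale id_closed hom_iff)
  then show ?case by (rule spherical_exists_irreducible)
next
  case (Suc n)
  note o [simp] = Suc.prems(2)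
  show ?case
  proof (cases "irreducible_obj C \<rho>")
    case True then show ?thesis by (rule spherical_exists_irreducible)
  next
    case False
    obtain E where E: "projection_arrow C \<rho> E" and E0: "E \<noteq> zero_arr \<rho> \<rho>" and E1: "E \<noteq> \<i>\<d> \<rho>"
      using reducible_projection[OF Suc.prems False] .
    then have [simp]: "arr E" "src E = \<rho>" "tgt E = \<rho>" and Ee: "E\<dagger> = E" "E \<cdot> E = E"
      unfolding projection_arrow_def by (auto simp: hom_iff)
    define F where "F = \<i>\<d> \<rho> \<boxplus> (-1) \<star> E"
    have [simp]: "arr F" "src F = \<rho>" "tgt F = \<rho>" by (simp_all add: F_def)
    have EF: "E \<boxplus> F = \<i>\<d> \<rho>" unfolding F_def by (subst add_left_comm) simp_all
    have "F \<cdot> F = F" by (simp add: F_def Ee scale_add_right)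
    then have F: "projection_arrow C \<rho> F" unfolding projection_arrow_def
      by (simp add: hom_iff) (simp add: F_def Ee)
    have F1: "F \<noteq> \<i>\<d> \<rho>"
    proof
      assume "F = \<i>\<d> \<rho>"
      then have "F \<boxplus> E = F" using EF add_comm[of E F] by simp
      then show False using add_zero_cancel[of F E] E0 by simp
    qed
    obtain a V1 where a [simp]: "a \<in> Obj C" and V1: "isometry_arrow C a \<rho> V1" "V1 \<cdot> V1\<dagger> = E"
      using subobjects E o unfolding has_subobjects_def by blast
    obtain b V2 where b [simp]: "b \<in> Obj C" and V2: "isometry_arrow C b \<rho> V2" "V2 \<cdot> V2\<dagger> = F"
      using subobjects F o unfolding has_subobjects_def by blast
    note v1 = isometryD[OF V1(1) a o] and v2 = isometryD[OF V2(1) b o]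
    obtain ab S1 S1b where s1: "spherical a ab S1 S1b"
      using Suc.IH[OF dependent_beyond_subobject[OF Suc.prems(1) v1]] V1(2) E1 by auto
    obtain bb S2 S2b where s2: "spherical b bb S2 S2b"
      using Suc.IH[OF dependent_beyond_subobject[OF Suc.prems(1) v2]] V2(2) F1 by auto
    have o' : "ab \<in> Obj C" "bb \<in> Obj C"
      using solutionD[OF sphericalD(1)[OF s1]] solutionD[OF sphericalD(1)[OF s2]] by auto
    obtain t W1 W2 where W: "arr W1" "src W1 = ab" "tgt W1 = t" "arr W2" "src W2 = bb" "tgt W2 = t"
      "W1\<dagger> \<cdot> W1 = \<i>\<d> ab" "W2\<dagger> \<cdot> W2 = \<i>\<d> bb" "W1 \<cdot> W1\<dagger> \<boxplus> W2 \<cdot> W2\<dagger> = \<i>\<d> t" using direct_sum[OF o'] by metis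
    have "V1 \<cdot> V1\<dagger> \<boxplus> V2 \<cdot> V2\<dagger> = \<i>\<d> \<rho>" unfolding V1(2) V2(2) by (rule EF)
    note f = complete_family_two[OF v1(1-3) v2(1-3) v1(4) v2(4) this] and g = complete_family_two[OF W]
    have "spherical (if i then a else b) (if i then ab else bb) (if i then S1 else S2) (if i then S1b else S2b)" for i using s1 s2 by simp
    from spherical_sum[OF f g this refl refl] show ?thesis by blast
  qed
qed

lemma spherical_exists:
  assumes "\<rho> \<in> Obj C" obtains \<rho>b R Rb where "spherical \<rho> \<rho>b R Rb"
  using spherical_exists_bounded dependent_beyond_dim assms by metis

end

section \<open>The twist of a spherical solution\<close>

context BTC_star begin

lemma braiding_arr [simp]:
  assumes "a \<in> Obj C" "b \<in> Obj C"
  shows "arr (\<epsilon> a b)" "src (\<epsilon> a b) = a \<diamondop> b" "tgt (\<epsilon> a b) = b \<diamondop> a"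
    "(\<epsilon> a b)\<dagger> \<cdot> \<epsilon> a b = \<i>\<d> (a \<diamondop> b)" "\<epsilon> a b \<cdot> (\<epsilon> a b)\<dagger> = \<i>\<d> (b \<diamondop> a)"
  using braiding_unitary[OF assms] homD[of "\<epsilon> a b" "a \<diamondop> b" "b \<diamondop> a"] assms
  unfolding unitary_arrow_def by auto

lemma braiding_slide:
  assumes "arr X" "c \<in> Obj C"
  shows "\<epsilon> (tgt X) c \<cdot> (X \<triangleright> c) = (c \<triangleleft> X) \<cdot> \<epsilon> (src X) c"
    "\<epsilon> c (tgt X) \<cdot> (c \<triangleleft> X) = (X \<triangleright> c) \<cdot> \<epsilon> c (src X)"
  using braiding_natural[of "src X" c "tgt X" c X "\<i>\<d> c"] braiding_natural[of c "src X" c "tgt X" "\<i>\<d> c" X]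
    assms arr_hom id_closed unfolding left_whisker_def right_whisker_def by auto

lemma braiding_star_slide:
  assumes "arr X" "c \<in> Obj C"
  shows "(X \<triangleright> c) \<cdot> (\<epsilon> (src X) c)\<dagger> = (\<epsilon> (tgt X) c)\<dagger> \<cdot> (c \<triangleleft> X)"
    "(c \<triangleleft> X) \<cdot> (\<epsilon> c (src X))\<dagger> = (\<epsilon> c (tgt X))\<dagger> \<cdot> (X \<triangleright> c)"
proof -
  have "(\<epsilon> (tgt (X\<dagger>)) c \<cdot> (X\<dagger> \<triangleright> c))\<dagger> = ((c \<triangleleft> X\<dagger>) \<cdot> \<epsilon> (src (X\<dagger>)) c)\<dagger>"
    "(\<epsilon> c (tgt (X\<dagger>)) \<cdot> (c \<triangleleft> X\<dagger>))\<dagger> = ((X\<dagger> \<triangleright> c) \<cdot> \<epsilon> c (src (X\<dagger>)))\<dagger>"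
    using braiding_slide[of "X\<dagger>" c] assms by simp_all
  then show "(X \<triangleright> c) \<cdot> (\<epsilon> (src X) c)\<dagger> = (\<epsilon> (tgt X) c)\<dagger> \<cdot> (c \<triangleleft> X)"
    "(c \<triangleleft> X) \<cdot> (\<epsilon> c (src X))\<dagger> = (\<epsilon> c (tgt X))\<dagger> \<cdot> (X \<triangleright> c)"
    using assms by simp_all
qed

lemma hexagon:
  assumes "a \<in> Obj C" "b \<in> Obj C" "c \<in> Obj C"
  shows "\<epsilon> (a \<diamondop> b) c = (\<epsilon> a c \<triangleright> b) \<cdot> (a \<triangleleft> \<epsilon> b c)"
    "\<epsilon> a (b \<diamondop> c) = (b \<triangleleft> \<epsilon> a c) \<cdot> (\<epsilon> a b \<triangleright> c)"
  using hexagon_left[OF assms] hexagon_right[OF assms] by (simp_all add: left_whisker_def right_whisker_def)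

lemma braiding_cancel:
  assumes "a \<in> Obj C" "b \<in> Obj C" "arr X"
  shows "tgt X = a \<diamondop> b \<Longrightarrow> (\<epsilon> a b)\<dagger> \<cdot> \<epsilon> a b \<cdot> X = X" "tgt X = b \<diamondop> a \<Longrightarrow> \<epsilon> a b \<cdot> (\<epsilon> a b)\<dagger> \<cdot> X = X"
  using assms comp_assoc[of X "\<epsilon> a b" "(\<epsilon> a b)\<dagger>"] comp_assoc[of X "(\<epsilon> a b)\<dagger>" "\<epsilon> a b"]
  by (simp_all del: comp_assoc)

text \<open>The hexagon identities make these braidings idempotent, and a unitary idempotent is the identity.\<close>

lemma braiding_unit:
  assumes "a \<in> Obj C" shows "\<epsilon> \<iota> a = \<i>\<d> a" "\<epsilon> a \<iota> = \<i>\<d> a"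
proof -
  have "\<epsilon> \<iota> a = \<epsilon> \<iota> a \<cdot> \<epsilon> \<iota> a" "\<epsilon> a \<iota> = \<epsilon> a \<iota> \<cdot> \<epsilon> a \<iota>"
    using hexagon[of \<iota> \<iota> a] hexagon[of a \<iota> \<iota>] assms by simp_all
  then show "\<epsilon> \<iota> a = \<i>\<d> a" "\<epsilon> a \<iota> = \<i>\<d> a"
    using braiding_cancel(1)[of \<iota> a "\<epsilon> \<iota> a"] braiding_cancel(1)[of a \<iota> "\<epsilon> a \<iota>"] braiding_arr(4)[of \<iota> a] braiding_arr(4)[of a \<iota>] assms by simp_all
qed

text \<open>Pulling the strand \<open>c\<close> through a cup is trivial, since it amounts to braiding with \<open>\<iota>\<close>. By the hexagon
  identity it crosses both legs; moving one of the crossings to the other side gives the two equations.\<close>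

lemma cup_slide:
  assumes "arr X" "src X = \<iota>" "tgt X = a \<diamondop> b" "a \<in> Obj C" "b \<in> Obj C" "c \<in> Obj C"
  shows "(a \<triangleleft> \<epsilon> b c) \<cdot> (X \<triangleright> c) = ((\<epsilon> a c)\<dagger> \<triangleright> b) \<cdot> (c \<triangleleft> X)"
    "(\<epsilon> c a \<triangleright> b) \<cdot> (c \<triangleleft> X) = (a \<triangleleft> (\<epsilon> c b)\<dagger>) \<cdot> (X \<triangleright> c)"
proof -
  note [simp] = assms
  have "c \<triangleleft> X = (\<epsilon> a c \<triangleright> b) \<cdot> (a \<triangleleft> \<epsilon> b c) \<cdot> (X \<triangleright> c)"
    using braiding_slide(1)[of X c] by (simp add: hexagon braiding_unit)
  then have "((\<epsilon> a c)\<dagger> \<triangleright> b) \<cdot> (c \<triangleleft> X) = (((\<epsilon> a c)\<dagger> \<cdot> \<epsilon> a c) \<triangleright> b) \<cdot> (a \<triangleleft> \<epsilon> b c) \<cdot> (X \<triangleright> c)"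
    by (simp del: braiding_arr(4))
  then show "(a \<triangleleft> \<epsilon> b c) \<cdot> (X \<triangleright> c) = ((\<epsilon> a c)\<dagger> \<triangleright> b) \<cdot> (c \<triangleleft> X)"
    by (simp del: whisker_cmp)
  have "X \<triangleright> c = (a \<triangleleft> \<epsilon> c b) \<cdot> (\<epsilon> c a \<triangleright> b) \<cdot> (c \<triangleleft> X)"
    using braiding_slide(2)[of X c] by (simp add: hexagon braiding_unit)
  then have "(a \<triangleleft> (\<epsilon> c b)\<dagger>) \<cdot> (X \<triangleright> c) = (a \<triangleleft> ((\<epsilon> c b)\<dagger> \<cdot> \<epsilon> c b)) \<cdot> (\<epsilon> c a \<triangleright> b) \<cdot> (c \<triangleleft> X)"
    by (simp del: braiding_arr(4))
  then show "(\<epsilon> c a \<triangleright> b) \<cdot> (c \<triangleleft> X) = (a \<triangleleft> (\<epsilon> c b)\<dagger>) \<cdot> (X \<triangleright> c)"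
    by (simp del: whisker_cmp)
qed

text \<open>The equation is the bent form of the curl \<open>K = (R\<dagger> \<boxtimes> 1) \<cdot> (1 \<boxtimes> \<epsilon> \<rho> \<rho>) \<cdot> (R \<boxtimes> 1)\<close>.\<close>

definition twist_for :: "'a \<Rightarrow> 'a \<Rightarrow> 'b \<Rightarrow> 'b \<Rightarrow> 'b \<Rightarrow> bool" where
  "twist_for \<rho> \<rho>b R Rb K \<longleftrightarrow> spherical \<rho> \<rho>b R Rb \<and> arr K \<and> src K = \<rho> \<and> tgt K = \<rho> \<and>
     (K \<triangleright> \<rho>b) \<cdot> Rb = (\<epsilon> \<rho> \<rho>b)\<dagger> \<cdot> R"

lemma twist_forD:
  assumes "twist_for \<rho> \<rho>b R Rb K"
  shows "spherical \<rho> \<rho>b R Rb" "arr K" "src K = \<rho>" "tgt K = \<rho>" "(K \<triangleright> \<rho>b) \<cdot> Rb = (\<epsilon> \<rho> \<rho>b)\<dagger> \<cdot> R"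
  using assms unfolding twist_for_def by auto

lemma twist_for_exists:
  assumes "spherical \<rho> \<rho>b R Rb"
  obtains K where "twist_for \<rho> \<rho>b R Rb K"
proof -
  note c = sphericalD(1)[OF assms]
  note [simp] = solutionD[OF c]
  define K where "K = (\<rho> \<triangleleft> R\<dagger>) \<cdot> (((\<epsilon> \<rho> \<rho>b)\<dagger> \<cdot> R) \<triangleright> \<rho>)"
  have "arr K" "src K = \<rho>" "tgt K = \<rho>" "(K \<triangleright> \<rho>b) \<cdot> Rb = (\<epsilon> \<rho> \<rho>b)\<dagger> \<cdot> R"
    unfolding K_def by (rule bend_left[OF solution_swap[OF c]]; simp)+
  with assms have "twist_for \<rho> \<rho>b R Rb K" unfolding twist_for_def by blast
  then show ?thesis using that by blast
qed

text \<open>Sphericity enters through the transpose \<open>A\<close> of \<open>T\<close>: it is produced by sliding \<open>T\<close> along \<open>Rb\<close> and absorbed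
  by sliding it back along \<open>R\<close>, which requires the two transposes to agree. Taking \<open>T\<close> to be
  an identity shows that the twist depends on the object only.\<close>

lemma twist_natural:
  assumes "twist_for \<rho> \<rho>b R Rb K" "twist_for \<sigma> \<sigma>b S Sb L" and T [simp]: "arr T" "src T = \<rho>" "tgt T = \<sigma>"
  shows "T \<cdot> K = L \<cdot> T"
proof -
  note k = twist_forD[OF assms(1)] and l = twist_forD[OF assms(2)]
  note c = sphericalD(1)[OF k(1)] and d = sphericalD(1)[OF l(1)]
  note [simp] = solutionD[OF c] solutionD[OF d] k(2-4) l(2-4)
  obtain A where A [simp]: "arr A" "src A = \<sigma>b" "tgt A = \<rho>b" and e: "(A \<triangleright> \<sigma>) \<cdot> S = (\<rho>b \<triangleleft> T) \<cdot> R"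
    "(\<sigma> \<triangleleft> A) \<cdot> Sb = (T \<triangleright> \<rho>b) \<cdot> Rb" using transpose_spherical[OF k(1) l(1) T] .
  have "((L \<cdot> T) \<triangleright> \<rho>b) \<cdot> Rb = (L \<triangleright> \<rho>b) \<cdot> (T \<triangleright> \<rho>b) \<cdot> Rb" by simp
  also have "\<dots> = ((L \<triangleright> \<rho>b) \<cdot> (\<sigma> \<triangleleft> A)) \<cdot> Sb" unfolding e(2)[symmetric] by simp
  also have "(L \<triangleright> \<rho>b) \<cdot> (\<sigma> \<triangleleft> A) = (\<sigma> \<triangleleft> A) \<cdot> (L \<triangleright> \<sigma>b)" using exchange[of L A] by simp
  also have "((\<sigma> \<triangleleft> A) \<cdot> (L \<triangleright> \<sigma>b)) \<cdot> Sb = (\<sigma> \<triangleleft> A) \<cdot> (L \<triangleright> \<sigma>b) \<cdot> Sb" by simp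
  also have "\<dots> = ((\<sigma> \<triangleleft> A) \<cdot> (\<epsilon> \<sigma> \<sigma>b)\<dagger>) \<cdot> S" unfolding l(5) by simp
  also have "(\<sigma> \<triangleleft> A) \<cdot> (\<epsilon> \<sigma> \<sigma>b)\<dagger> = (\<epsilon> \<sigma> \<rho>b)\<dagger> \<cdot> (A \<triangleright> \<sigma>)" using braiding_star_slide(2)[of A \<sigma>] by simp
  also have "((\<epsilon> \<sigma> \<rho>b)\<dagger> \<cdot> (A \<triangleright> \<sigma>)) \<cdot> S = (\<epsilon> \<sigma> \<rho>b)\<dagger> \<cdot> (A \<triangleright> \<sigma>) \<cdot> S" by simp
  also have "\<dots> = ((\<epsilon> \<sigma> \<rho>b)\<dagger> \<cdot> (\<rho>b \<triangleleft> T)) \<cdot> R" unfolding e(1) by simp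
  also have "(\<epsilon> \<sigma> \<rho>b)\<dagger> \<cdot> (\<rho>b \<triangleleft> T) = (T \<triangleright> \<rho>b) \<cdot> (\<epsilon> \<rho> \<rho>b)\<dagger>" using braiding_star_slide(1)[of T \<rho>b] by simp
  also have "((T \<triangleright> \<rho>b) \<cdot> (\<epsilon> \<rho> \<rho>b)\<dagger>) \<cdot> R = (T \<triangleright> \<rho>b) \<cdot> (\<epsilon> \<rho> \<rho>b)\<dagger> \<cdot> R" by simp
  also have "\<dots> = ((T \<cdot> K) \<triangleright> \<rho>b) \<cdot> Rb" unfolding k(5)[symmetric] by simp
  finally show ?thesis using left_cancel[OF solution_swap[OF c], of "T \<cdot> K" "L \<cdot> T"] by simp
qed

lemma twist_for_unique:
  assumes "twist_for \<rho> \<rho>b R Rb K" "twist_for \<rho> \<sigma>b S Sb L" shows "K = L"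
proof -
  note k = twist_forD[OF assms(1)] and l = twist_forD[OF assms(2)]
  have [simp]: "\<rho> \<in> Obj C" using solutionD(1)[OF sphericalD(1)[OF k(1)]] .
  have "\<i>\<d> \<rho> \<cdot> K = L \<cdot> \<i>\<d> \<rho>" by (rule twist_natural[OF assms]) simp_all
  then show ?thesis using k l by simp
qed

text \<open>Bending \<open>\<epsilon> \<rho> \<rho>b \<cdot> Rb\<close> produces the curl \<open>L\<dagger>\<close> with the loop on the other side. Its trace against any \<open>Y\<close>
  equals the trace of \<open>Y \<cdot> K\<close>, by sliding \<open>Y\<close> through the crossing. As \<open>K\<close> commutes with \<open>Y\<close> and the
  trace form is nondegenerate, the two curls agree; the curls with opposite crossings cancel.\<close>

lemma twist_unitary:
  assumes "twist_for \<rho> \<rho>b R Rb K"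
  shows "K \<cdot> K\<dagger> = \<i>\<d> \<rho>" "K\<dagger> \<cdot> K = \<i>\<d> \<rho>" "\<epsilon> \<rho> \<rho>b \<cdot> Rb = (\<rho>b \<triangleleft> K\<dagger>) \<cdot> R"
proof -
  note k = twist_forD[OF assms]
  note c = sphericalD(1)[OF k(1)]
  note [simp] = solutionD[OF c] k(2-4)
  define L where "L = (Rb\<dagger> \<triangleright> \<rho>) \<cdot> (\<rho> \<triangleleft> (\<epsilon> \<rho> \<rho>b \<cdot> Rb))"
  have L [simp]: "arr L" "src L = \<rho>" "tgt L = \<rho>" and l: "(\<rho>b \<triangleleft> L) \<cdot> R = \<epsilon> \<rho> \<rho>b \<cdot> Rb"
    unfolding L_def by (rule bend_right[OF c]; simp)+
  define P Q where "P = (\<rho>b \<triangleleft> K\<dagger>) \<cdot> R" and "Q = (\<rho>b \<triangleleft> L) \<cdot> R"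
  have Q: "Q\<dagger> \<cdot> (\<rho>b \<triangleleft> Y) \<cdot> R = P\<dagger> \<cdot> (\<rho>b \<triangleleft> Y) \<cdot> R" if [simp]: "arr Y" "src Y = \<rho>" "tgt Y = \<rho>" for Y
  proof -
    have "Q\<dagger> \<cdot> (\<rho>b \<triangleleft> Y) \<cdot> R = Rb\<dagger> \<cdot> ((\<epsilon> \<rho> \<rho>b)\<dagger> \<cdot> (\<rho>b \<triangleleft> Y)) \<cdot> R" unfolding Q_def l by simp
    also have "(\<epsilon> \<rho> \<rho>b)\<dagger> \<cdot> (\<rho>b \<triangleleft> Y) = (Y \<triangleright> \<rho>b) \<cdot> (\<epsilon> \<rho> \<rho>b)\<dagger>" using braiding_star_slide(1)[of Y \<rho>b] by simp
    also have "Rb\<dagger> \<cdot> ((Y \<triangleright> \<rho>b) \<cdot> (\<epsilon> \<rho> \<rho>b)\<dagger>) \<cdot> R = Rb\<dagger> \<cdot> (Y \<triangleright> \<rho>b) \<cdot> (\<epsilon> \<rho> \<rho>b)\<dagger> \<cdot> R" by simp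
    also have "\<dots> = Rb\<dagger> \<cdot> ((Y \<cdot> K) \<triangleright> \<rho>b) \<cdot> Rb" unfolding k(5)[symmetric] by simp
    also have "Y \<cdot> K = K \<cdot> Y" by (rule twist_natural[OF assms assms]) simp_all
    also have "Rb\<dagger> \<cdot> ((K \<cdot> Y) \<triangleright> \<rho>b) \<cdot> Rb = R\<dagger> \<cdot> (\<rho>b \<triangleleft> (K \<cdot> Y)) \<cdot> R"
      by (rule sphericalD(2)[OF k(1), symmetric]) simp_all
    also have "\<dots> = P\<dagger> \<cdot> (\<rho>b \<triangleleft> Y) \<cdot> R" unfolding P_def by simp
    finally show ?thesis .
  qed
  have a: "arr P" "arr Q" "src P = \<iota>" "src Q = \<iota>" "tgt P = tgt Q" by (simp_all add: P_def Q_def)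
  have QP: "Q\<dagger> \<cdot> P = P\<dagger> \<cdot> P" and QQ: "Q\<dagger> \<cdot> Q = P\<dagger> \<cdot> Q"
    using Q[of "K\<dagger>"] Q[of L] by (simp_all add: P_def[symmetric] Q_def[symmetric])
  have "(Q\<dagger> \<cdot> P)\<dagger> = (P\<dagger> \<cdot> P)\<dagger>" unfolding QP ..
  then have PQ: "P\<dagger> \<cdot> Q = P\<dagger> \<cdot> P" using a by simp
  \<comment> \<open>The second pair of arrows is trivial here, since all four inner products of \<open>P\<close> and \<open>Q\<close> agree.\<close>
  have "P = Q" by (rule equal_by_gram[of P Q \<iota> P P "P\<dagger> \<cdot> P" "P\<dagger> \<cdot> P"]) (use a QP QQ PQ in simp_all)
  then have KL: "K\<dagger> = L" using right_cancel[OF c, of "K\<dagger>" L] by (simp add: P_def Q_def)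
  show lk: "\<epsilon> \<rho> \<rho>b \<cdot> Rb = (\<rho>b \<triangleleft> K\<dagger>) \<cdot> R" unfolding KL l ..
  have "(\<rho>b \<triangleleft> \<i>\<d> \<rho>) \<cdot> R = \<epsilon> \<rho> \<rho>b \<cdot> (\<epsilon> \<rho> \<rho>b)\<dagger> \<cdot> R" by (simp add: braiding_cancel)
  also have "\<dots> = (\<epsilon> \<rho> \<rho>b \<cdot> (K \<triangleright> \<rho>b)) \<cdot> Rb" unfolding k(5)[symmetric] by simp
  also have "\<epsilon> \<rho> \<rho>b \<cdot> (K \<triangleright> \<rho>b) = (\<rho>b \<triangleleft> K) \<cdot> \<epsilon> \<rho> \<rho>b" using braiding_slide(1)[of K \<rho>b] by simp
  also have "((\<rho>b \<triangleleft> K) \<cdot> \<epsilon> \<rho> \<rho>b) \<cdot> Rb = (\<rho>b \<triangleleft> K) \<cdot> \<epsilon> \<rho> \<rho>b \<cdot> Rb" by simp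
  also have "\<dots> = (\<rho>b \<triangleleft> (K \<cdot> K\<dagger>)) \<cdot> R" unfolding lk by simp
  finally show *: "K \<cdot> K\<dagger> = \<i>\<d> \<rho>" using right_cancel[OF c, of "\<i>\<d> \<rho>" "K \<cdot> K\<dagger>"] by simp
  have "K\<dagger> \<cdot> K = K \<cdot> K\<dagger>" by (rule twist_natural[OF assms assms]) simp_all
  with * show "K\<dagger> \<cdot> K = \<i>\<d> \<rho>" by simp
qed

text \<open>The strand can be slid through the cup of the curl in two ways. One of them bends the curl along
  \<open>\<epsilon> \<rho> \<rho>b\<close>, which is the defining equation; the other one bends its adjoint along \<open>\<epsilon> \<rho>b \<rho>\<close>.\<close>

lemma twist_star_left:
  assumes "twist_for \<rho> \<rho>b R Rb K"
  shows "(K\<dagger> \<triangleright> \<rho>b) \<cdot> Rb = \<epsilon> \<rho>b \<rho> \<cdot> R"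
proof -
  note k = twist_forD[OF assms]
  note c = sphericalD(1)[OF k(1)]
  note [simp] = solutionD[OF c] k(2-4)
  \<comment> \<open>The arrow obtained by bending the right-hand side; it remains to identify it with \<open>K\<dagger>\<close>.\<close>
  define G where "G = (\<rho> \<triangleleft> R\<dagger>) \<cdot> ((\<epsilon> \<rho>b \<rho> \<cdot> R) \<triangleright> \<rho>)"
  have "K = (\<rho> \<triangleleft> R\<dagger>) \<cdot> (((K \<triangleright> \<rho>b) \<cdot> Rb) \<triangleright> \<rho>)"
    using bend_left_unique[OF solution_swap[OF c], of K] by simp
  then have K: "K = (\<rho> \<triangleleft> R\<dagger>) \<cdot> (((\<epsilon> \<rho> \<rho>b)\<dagger> \<cdot> R) \<triangleright> \<rho>)" unfolding k(5) .
  have "K\<dagger> = (R\<dagger> \<triangleright> \<rho>) \<cdot> (\<epsilon> \<rho> \<rho>b \<triangleright> \<rho>) \<cdot> (\<rho> \<triangleleft> R)"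
    by (subst K) simp
  also have "\<dots> = (R\<dagger> \<triangleright> \<rho>) \<cdot> (\<rho>b \<triangleleft> (\<epsilon> \<rho> \<rho>)\<dagger>) \<cdot> (R \<triangleright> \<rho>)"
    using cup_slide(2)[of R \<rho>b \<rho> \<rho>] by simp
  also have "\<dots> = ((\<rho>b \<triangleleft> \<epsilon> \<rho> \<rho>) \<cdot> (R \<triangleright> \<rho>))\<dagger> \<cdot> (R \<triangleright> \<rho>)" by simp
  also have "(\<rho>b \<triangleleft> \<epsilon> \<rho> \<rho>) \<cdot> (R \<triangleright> \<rho>) = ((\<epsilon> \<rho>b \<rho>)\<dagger> \<triangleright> \<rho>) \<cdot> (\<rho> \<triangleleft> R)"
    by (rule cup_slide(1)) simp_all
  also have "(((\<epsilon> \<rho>b \<rho>)\<dagger> \<triangleright> \<rho>) \<cdot> (\<rho> \<triangleleft> R))\<dagger> \<cdot> (R \<triangleright> \<rho>) = G" by (simp add: G_def)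
  finally show ?thesis using bend_left(4)[OF solution_swap[OF c], of "\<epsilon> \<rho>b \<rho> \<cdot> R" \<rho>] by (simp add: G_def)
qed

text \<open>By \<open>twist_star_left\<close> for \<open>\<rho>b\<close> and \<open>twist_unitary\<close> for \<open>\<rho>\<close>, both \<open>(L\<dagger> \<triangleright> \<rho>) \<cdot> R\<close> and
  \<open>(\<rho>b \<triangleleft> K\<dagger>) \<cdot> R\<close> equal \<open>\<epsilon> \<rho> \<rho>b \<cdot> Rb\<close>. Unitarity removes the adjoints.\<close>

lemma twist_conjugate:
  assumes "twist_for \<rho> \<rho>b R Rb K" "twist_for \<rho>b \<rho> Rb R L"
  shows "(L \<triangleright> \<rho>) \<cdot> R = (\<rho>b \<triangleleft> K) \<cdot> R"
proof -
  note k = twist_forD[OF assms(1)] and l = twist_forD[OF assms(2)]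
  note c = sphericalD(1)[OF k(1)]
  note [simp] = solutionD[OF c] k(2-4) l(2-4)
  have "(L\<dagger> \<triangleright> \<rho>) \<cdot> R = (\<rho>b \<triangleleft> K\<dagger>) \<cdot> R"
    unfolding twist_star_left[OF assms(2)] twist_unitary(3)[OF assms(1)] ..
  then have "(L \<triangleright> \<rho>) \<cdot> (\<rho>b \<triangleleft> K) \<cdot> (L\<dagger> \<triangleright> \<rho>) \<cdot> R = (L \<triangleright> \<rho>) \<cdot> (\<rho>b \<triangleleft> (K \<cdot> K\<dagger>)) \<cdot> R" by simp
  also have "\<dots> = (L \<triangleright> \<rho>) \<cdot> R" unfolding twist_unitary(1)[OF assms(1)] by simp
  finally have "(L \<triangleright> \<rho>) \<cdot> R = ((L \<triangleright> \<rho>) \<cdot> (\<rho>b \<triangleleft> K)) \<cdot> (L\<dagger> \<triangleright> \<rho>) \<cdot> R" by simp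
  also have "(L \<triangleright> \<rho>) \<cdot> (\<rho>b \<triangleleft> K) = (\<rho>b \<triangleleft> K) \<cdot> (L \<triangleright> \<rho>)" using exchange[of L K] by simp
  also have "((\<rho>b \<triangleleft> K) \<cdot> (L \<triangleright> \<rho>)) \<cdot> (L\<dagger> \<triangleright> \<rho>) \<cdot> R = (\<rho>b \<triangleleft> K) \<cdot> ((L \<cdot> L\<dagger>) \<triangleright> \<rho>) \<cdot> R" by simp
  also have "\<dots> = (\<rho>b \<triangleleft> K) \<cdot> R" unfolding twist_unitary(1)[OF assms(2)] by simp
  finally show ?thesis .
qed

text \<open>Apply the defining equations of the two factors to the nested cups and then braid with the product of the
  conjugates. Each single braiding with a conjugate cancels against a defining equation, and what remains are
  the crossings of \<open>\<rho>\<close> with \<open>\<sigma>\<close>, which cancel against the double braiding.\<close>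

lemma twist_for_tensor:
  assumes "twist_for \<rho> \<rho>b R Rb K" "twist_for \<sigma> \<sigma>b S Sb L"
  shows "twist_for (\<rho> \<diamondop> \<sigma>) (\<sigma>b \<diamondop> \<rho>b) ((\<sigma>b \<triangleleft> R \<triangleright> \<sigma>) \<cdot> S) ((\<rho> \<triangleleft> Sb \<triangleright> \<rho>b) \<cdot> Rb)
    ((K \<boxtimes> L) \<cdot> \<epsilon> \<sigma> \<rho> \<cdot> \<epsilon> \<rho> \<sigma>)"
proof -
  note k = twist_forD[OF assms(1)] and l = twist_forD[OF assms(2)]
  note c = sphericalD(1)[OF k(1)] and d = sphericalD(1)[OF l(1)]
  note [simp] = solutionD[OF c] solutionD[OF d] k(2-4) l(2-4)
  let ?b = "\<sigma>b \<diamondop> \<rho>b"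
  define e where "e = \<epsilon> \<sigma> \<rho> \<cdot> \<epsilon> \<rho> \<sigma>"
  have e [simp]: "arr e" "src e = \<rho> \<diamondop> \<sigma>" "tgt e = \<rho> \<diamondop> \<sigma>" by (simp_all add: e_def)
  define Y where "Y = (\<epsilon> \<rho> \<rho>b)\<dagger> \<cdot> R"
  define X where "X = (\<epsilon> \<sigma> \<sigma>b)\<dagger> \<cdot> S"
  have XY [simp]: "arr X" "src X = \<iota>" "tgt X = \<sigma> \<diamondop> \<sigma>b" "arr Y" "src Y = \<iota>" "tgt Y = \<rho> \<diamondop> \<rho>b"
    by (simp_all add: X_def Y_def)
  \<comment> \<open>The twists of the factors commute with the double braiding and can act first.\<close>
  have M: "(K \<boxtimes> L) \<cdot> \<epsilon> \<sigma> \<rho> \<cdot> \<epsilon> \<rho> \<sigma> = e \<cdot> (K \<boxtimes> L)"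
  proof -
    have "e \<cdot> (K \<boxtimes> L) = \<epsilon> \<sigma> \<rho> \<cdot> (\<epsilon> \<rho> \<sigma> \<cdot> (K \<boxtimes> L))" by (simp add: e_def)
    also have "\<epsilon> \<rho> \<sigma> \<cdot> (K \<boxtimes> L) = (L \<boxtimes> K) \<cdot> \<epsilon> \<rho> \<sigma>" by (rule braiding_natural) (simp_all add: hom_iff)
    also have "\<epsilon> \<sigma> \<rho> \<cdot> (L \<boxtimes> K) \<cdot> \<epsilon> \<rho> \<sigma> = (\<epsilon> \<sigma> \<rho> \<cdot> (L \<boxtimes> K)) \<cdot> \<epsilon> \<rho> \<sigma>" by simp
    also have "\<epsilon> \<sigma> \<rho> \<cdot> (L \<boxtimes> K) = (K \<boxtimes> L) \<cdot> \<epsilon> \<sigma> \<rho>" by (rule braiding_natural) (simp_all add: hom_iff)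
    finally show ?thesis by simp
  qed
  have 1: "((e \<cdot> (K \<boxtimes> L)) \<triangleright> ?b) \<cdot> (\<rho> \<triangleleft> Sb \<triangleright> \<rho>b) \<cdot> Rb = (e \<triangleright> ?b) \<cdot> (\<rho> \<triangleleft> X \<triangleright> \<rho>b) \<cdot> Y"
  proof -
    have "((e \<cdot> (K \<boxtimes> L)) \<triangleright> ?b) \<cdot> (\<rho> \<triangleleft> Sb \<triangleright> \<rho>b) \<cdot> Rb
      = (e \<triangleright> ?b) \<cdot> (K \<triangleright> (\<sigma> \<diamondop> ?b)) \<cdot> (\<rho> \<triangleleft> ((L \<triangleright> \<sigma>b) \<cdot> Sb) \<triangleright> \<rho>b) \<cdot> Rb"
      by (simp add: tensor_whisker)
    also have "(L \<triangleright> \<sigma>b) \<cdot> Sb = X" unfolding l(5) X_def ..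
    also have "(e \<triangleright> ?b) \<cdot> (K \<triangleright> (\<sigma> \<diamondop> ?b)) \<cdot> (\<rho> \<triangleleft> X \<triangleright> \<rho>b) \<cdot> Rb
      = (e \<triangleright> ?b) \<cdot> ((K \<triangleright> (\<sigma> \<diamondop> ?b)) \<cdot> (\<rho> \<triangleleft> X \<triangleright> \<rho>b)) \<cdot> Rb" by simp
    also have "(K \<triangleright> (\<sigma> \<diamondop> ?b)) \<cdot> (\<rho> \<triangleleft> X \<triangleright> \<rho>b) = (\<rho> \<triangleleft> X \<triangleright> \<rho>b) \<cdot> (K \<triangleright> \<rho>b)"
      using exchange[of K "X \<triangleright> \<rho>b"] by simp
    also have "(e \<triangleright> ?b) \<cdot> ((\<rho> \<triangleleft> X \<triangleright> \<rho>b) \<cdot> (K \<triangleright> \<rho>b)) \<cdot> Rb = (e \<triangleright> ?b) \<cdot> (\<rho> \<triangleleft> X \<triangleright> \<rho>b) \<cdot> ((K \<triangleright> \<rho>b) \<cdot> Rb)"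
      by simp
    also have "\<dots> = (e \<triangleright> ?b) \<cdot> (\<rho> \<triangleleft> X \<triangleright> \<rho>b) \<cdot> Y" unfolding k(5) Y_def ..
    finally show ?thesis .
  qed
  have 2: "\<epsilon> (\<rho> \<diamondop> \<sigma>) \<sigma>b \<cdot> (\<rho> \<triangleleft> X) = (\<sigma>b \<triangleleft> (\<epsilon> \<rho> \<sigma>)\<dagger>) \<cdot> (S \<triangleright> \<rho>)"
  proof -
    have "\<epsilon> (\<rho> \<diamondop> \<sigma>) \<sigma>b \<cdot> (\<rho> \<triangleleft> X) = (\<epsilon> \<rho> \<sigma>b \<triangleright> \<sigma>) \<cdot> (\<rho> \<triangleleft> (\<epsilon> \<sigma> \<sigma>b \<cdot> X))" by (simp add: hexagon)
    also have "\<epsilon> \<sigma> \<sigma>b \<cdot> X = S" by (simp add: X_def braiding_cancel)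
    also have "(\<epsilon> \<rho> \<sigma>b \<triangleright> \<sigma>) \<cdot> (\<rho> \<triangleleft> S) = (\<sigma>b \<triangleleft> (\<epsilon> \<rho> \<sigma>)\<dagger>) \<cdot> (S \<triangleright> \<rho>)" by (rule cup_slide) simp_all
    finally show ?thesis .
  qed
  have 3: "\<epsilon> (\<sigma> \<diamondop> \<rho>) \<rho>b \<cdot> (\<sigma> \<triangleleft> Y) = (\<rho>b \<triangleleft> (\<epsilon> \<sigma> \<rho>)\<dagger>) \<cdot> (R \<triangleright> \<sigma>)"
  proof -
    have "\<epsilon> (\<sigma> \<diamondop> \<rho>) \<rho>b \<cdot> (\<sigma> \<triangleleft> Y) = (\<epsilon> \<sigma> \<rho>b \<triangleright> \<rho>) \<cdot> (\<sigma> \<triangleleft> (\<epsilon> \<rho> \<rho>b \<cdot> Y))" by (simp add: hexagon)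
    also have "\<epsilon> \<rho> \<rho>b \<cdot> Y = R" by (simp add: Y_def braiding_cancel)
    also have "(\<epsilon> \<sigma> \<rho>b \<triangleright> \<rho>) \<cdot> (\<sigma> \<triangleleft> R) = (\<rho>b \<triangleleft> (\<epsilon> \<sigma> \<rho>)\<dagger>) \<cdot> (R \<triangleright> \<sigma>)" by (rule cup_slide) simp_all
    finally show ?thesis .
  qed
  have 4: "\<epsilon> (\<rho> \<diamondop> \<sigma>) \<rho>b \<cdot> ((\<epsilon> \<rho> \<sigma>)\<dagger> \<triangleright> \<rho>b) = (\<rho>b \<triangleleft> (\<epsilon> \<rho> \<sigma>)\<dagger>) \<cdot> \<epsilon> (\<sigma> \<diamondop> \<rho>) \<rho>b"
    using braiding_slide(1)[of "(\<epsilon> \<rho> \<sigma>)\<dagger>" \<rho>b] by simp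
  have 5: "e \<cdot> (\<epsilon> \<rho> \<sigma>)\<dagger> = \<epsilon> \<sigma> \<rho>" by (simp add: e_def)
  have "\<epsilon> (\<rho> \<diamondop> \<sigma>) ?b \<cdot> (e \<triangleright> ?b) \<cdot> (\<rho> \<triangleleft> X \<triangleright> \<rho>b) \<cdot> Y = (\<epsilon> (\<rho> \<diamondop> \<sigma>) ?b \<cdot> (e \<triangleright> ?b)) \<cdot> (\<rho> \<triangleleft> X \<triangleright> \<rho>b) \<cdot> Y" by simp
  also have "\<epsilon> (\<rho> \<diamondop> \<sigma>) ?b \<cdot> (e \<triangleright> ?b) = (?b \<triangleleft> e) \<cdot> \<epsilon> (\<rho> \<diamondop> \<sigma>) ?b" using braiding_slide(1)[of e ?b] by simp
  also have "((?b \<triangleleft> e) \<cdot> \<epsilon> (\<rho> \<diamondop> \<sigma>) ?b) \<cdot> (\<rho> \<triangleleft> X \<triangleright> \<rho>b) \<cdot> Y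
    = (?b \<triangleleft> e) \<cdot> (\<sigma>b \<triangleleft> \<epsilon> (\<rho> \<diamondop> \<sigma>) \<rho>b) \<cdot> ((\<epsilon> (\<rho> \<diamondop> \<sigma>) \<sigma>b \<cdot> (\<rho> \<triangleleft> X)) \<triangleright> \<rho>b) \<cdot> Y"
    by (simp add: hexagon(2)[of "\<rho> \<diamondop> \<sigma>" \<sigma>b \<rho>b])
  also have "\<dots> = (?b \<triangleleft> e) \<cdot> (\<sigma>b \<triangleleft> (\<epsilon> (\<rho> \<diamondop> \<sigma>) \<rho>b \<cdot> ((\<epsilon> \<rho> \<sigma>)\<dagger> \<triangleright> \<rho>b))) \<cdot> (S \<triangleright> (\<rho> \<diamondop> \<rho>b)) \<cdot> Y"
    unfolding 2 by simp
  also have "\<dots> = (?b \<triangleleft> (e \<cdot> (\<epsilon> \<rho> \<sigma>)\<dagger>)) \<cdot> (\<sigma>b \<triangleleft> \<epsilon> (\<sigma> \<diamondop> \<rho>) \<rho>b) \<cdot> (S \<triangleright> (\<rho> \<diamondop> \<rho>b)) \<cdot> Y" unfolding 4 by simp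
  also have "(S \<triangleright> (\<rho> \<diamondop> \<rho>b)) \<cdot> Y = ((\<sigma>b \<diamondop> \<sigma>) \<triangleleft> Y) \<cdot> S" using exchange[of S Y] by simp
  also have "(?b \<triangleleft> (e \<cdot> (\<epsilon> \<rho> \<sigma>)\<dagger>)) \<cdot> (\<sigma>b \<triangleleft> \<epsilon> (\<sigma> \<diamondop> \<rho>) \<rho>b) \<cdot> ((\<sigma>b \<diamondop> \<sigma>) \<triangleleft> Y) \<cdot> S
    = (?b \<triangleleft> \<epsilon> \<sigma> \<rho>) \<cdot> (\<sigma>b \<triangleleft> (\<epsilon> (\<sigma> \<diamondop> \<rho>) \<rho>b \<cdot> (\<sigma> \<triangleleft> Y))) \<cdot> S" unfolding 5 by simp
  also have "\<dots> = (?b \<triangleleft> (\<epsilon> \<sigma> \<rho> \<cdot> (\<epsilon> \<sigma> \<rho>)\<dagger>)) \<cdot> (\<sigma>b \<triangleleft> R \<triangleright> \<sigma>) \<cdot> S" unfolding 3 by (simp del: braiding_arr(5))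
  also have "\<dots> = (\<sigma>b \<triangleleft> R \<triangleright> \<sigma>) \<cdot> S" by (simp del: whisker_cmp)
  finally have "(\<epsilon> (\<rho> \<diamondop> \<sigma>) ?b)\<dagger> \<cdot> \<epsilon> (\<rho> \<diamondop> \<sigma>) ?b \<cdot> (e \<triangleright> ?b) \<cdot> (\<rho> \<triangleleft> X \<triangleright> \<rho>b) \<cdot> Y
    = (\<epsilon> (\<rho> \<diamondop> \<sigma>) ?b)\<dagger> \<cdot> (\<sigma>b \<triangleleft> R \<triangleright> \<sigma>) \<cdot> S"
    by simp
  then have 6: "(e \<triangleright> ?b) \<cdot> (\<rho> \<triangleleft> X \<triangleright> \<rho>b) \<cdot> Y = (\<epsilon> (\<rho> \<diamondop> \<sigma>) ?b)\<dagger> \<cdot> (\<sigma>b \<triangleleft> R \<triangleright> \<sigma>) \<cdot> S"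
    by (subst (asm) braiding_cancel) simp_all
  show ?thesis unfolding twist_for_def M 1 6
    using spherical_tensor[OF k(1) l(1)] by simp
qed

end

section \<open>The ribbon structure\<close>

theorem proposition2p4:
  fixes C :: "('o, 'm) tensor_cat" (structure) and \<epsilon> :: "'o \<Rightarrow> 'o \<Rightarrow> 'm"
  assumes "BTC_star C \<epsilon>"
  shows "\<exists>\<kappa> :: 'o \<Rightarrow> 'm.
    (\<forall>\<rho>\<in>Obj C. unitary_arrow C \<rho> \<rho> (\<kappa> \<rho>)) \<and>
    (\<forall>\<rho>\<in>Obj C. \<forall>\<sigma>\<in>Obj C. \<forall>T\<in>Hom \<rho> \<sigma>. T \<cdot> \<kappa> \<rho> = \<kappa> \<sigma> \<cdot> T) \<and>
    (\<forall>\<rho>\<^sub>1\<in>Obj C. \<forall>\<rho>\<^sub>2\<in>Obj C.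
       \<kappa> (\<rho>\<^sub>1 \<diamondop> \<rho>\<^sub>2) = (\<kappa> \<rho>\<^sub>1 \<boxtimes> \<kappa> \<rho>\<^sub>2) \<cdot> \<epsilon> \<rho>\<^sub>2 \<rho>\<^sub>1 \<cdot> \<epsilon> \<rho>\<^sub>1 \<rho>\<^sub>2) \<and>
    (\<forall>\<rho> \<rho>b R Rb. standard_solution C \<rho> \<rho>b R Rb \<longrightarrow>
       (\<kappa> \<rho>b \<boxtimes> \<i>\<d> \<rho>) \<cdot> R = (\<i>\<d> \<rho>b \<boxtimes> \<kappa> \<rho>) \<cdot> R)"
proof -
  interpret BTC_star C \<epsilon> by (rule assms)
  have "\<forall>\<rho>\<in>Obj C. \<exists>K \<rho>b R Rb. twist_for \<rho> \<rho>b R Rb K" using spherical_exists twist_for_exists by metis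
  then obtain \<kappa> where \<kappa>: "\<And>\<rho>. \<rho> \<in> Obj C \<Longrightarrow> \<exists>\<rho>b R Rb. twist_for \<rho> \<rho>b R Rb (\<kappa> \<rho>)" by metis
  \<comment> \<open>The twist may be computed from any spherical solution, not only from the one it was chosen from.\<close>
  have \<kappa>_any: "twist_for \<rho> \<rho>b R Rb (\<kappa> \<rho>)" if s: "spherical \<rho> \<rho>b R Rb" for \<rho> \<rho>b R Rb
  proof -
    have "\<rho> \<in> Obj C" using solutionD(1)[OF sphericalD(1)[OF s]] .
    then obtain \<rho>b' R' Rb' where k: "twist_for \<rho> \<rho>b' R' Rb' (\<kappa> \<rho>)" using \<kappa> by blast
    obtain K where K: "twist_for \<rho> \<rho>b R Rb K" using twist_for_exists[OF s] .
    show ?thesis using K twist_for_unique[OF K k] by simp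
  qed
  show ?thesis
  proof (intro exI[of _ \<kappa>] conjI ballI allI impI)
    fix \<rho> assume "\<rho> \<in> Obj C"
    then obtain \<rho>b R Rb where k: "twist_for \<rho> \<rho>b R Rb (\<kappa> \<rho>)" using \<kappa> by blast
    show "unitary_arrow C \<rho> \<rho> (\<kappa> \<rho>)"
      using twist_forD[OF k] twist_unitary[OF k] \<open>\<rho> \<in> Obj C\<close> unfolding unitary_arrow_def
        by (simp add: hom_iff)
  next
    fix \<rho> \<sigma> T assume o: "\<rho> \<in> Obj C" "\<sigma> \<in> Obj C" and T: "T \<in> Hom \<rho> \<sigma>"
    from \<kappa>[OF o(1)] \<kappa>[OF o(2)] show "T \<cdot> \<kappa> \<rho> = \<kappa> \<sigma> \<cdot> T"
      using twist_natural homD[OF T o] by blast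
  next
    fix \<rho> \<sigma> assume o: "\<rho> \<in> Obj C" "\<sigma> \<in> Obj C"
    obtain \<rho>b R Rb \<sigma>b S Sb where k: "twist_for \<rho> \<rho>b R Rb (\<kappa> \<rho>)" "twist_for \<sigma> \<sigma>b S Sb (\<kappa> \<sigma>)" using \<kappa> o
      by metis
    note t = twist_for_tensor[OF k]
    show "\<kappa> (\<rho> \<diamondop> \<sigma>) = (\<kappa> \<rho> \<boxtimes> \<kappa> \<sigma>) \<cdot> \<epsilon> \<sigma> \<rho> \<cdot> \<epsilon> \<rho> \<sigma>"
      using twist_for_unique[OF \<kappa>_any[OF twist_forD(1)[OF t]] t] .
  next
    fix \<rho> \<rho>b R Rb assume "standard_solution C \<rho> \<rho>b R Rb"
    then have s: "spherical \<rho> \<rho>b R Rb" by (rule standard_imp_spherical)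
    show "(\<kappa> \<rho>b \<boxtimes> \<i>\<d> \<rho>) \<cdot> R = (\<i>\<d> \<rho>b \<boxtimes> \<kappa> \<rho>) \<cdot> R"
      using twist_conjugate[OF \<kappa>_any[OF s] \<kappa>_any[OF spherical_swap[OF s]]]
        unfolding left_whisker_def right_whisker_def .
  qed
qed

end
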